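(* Let $H$ be a graph with vertex set $\{1,\dots,m\}$ and with $e(H)$ edges. For every $\theta>0$, there exist $c,\epsilon>0$ of size at least polynomial in $\theta$ so that the following holds. Let $p\in(0,1]$ and let $\Gamma$ be a graph with vertex subsets $X_1,\dots,X_m$, and suppose that the bipartite graph $(X_i,X_j)_\Gamma$ is $(p,cp^k\sqrt{|X_i||X_j|})$-jumbled for every $i<j$, where $k\ge\min\left\{\frac{\Delta(L(H))+4}{2},\frac{d(L(H))+6}{2}\right\}$. Let $G$ be a subgraph of $\Gamma$, with the vertex $i$ of $H$ assigned to the vertex subset $X_i$ of $G$. For each edge $ij$ of $H$, assume that $(X_i,X_j)_G$ satisfies $\mathrm{DISC}(q_{ij},p,\epsilon)$, where $0\le q_{ij}\le p$. Define $$G(H):=\frac{1}{|X_1|\cdots|X_m|}\sum_{x_1\in X_1,\dots,x_m\in X_m}\ \prod_{ij\in E(H)}G(x_i,x_j),\qquad q(H):=\prod_{ij\in E(H)}q_{ij}.$$ Then $|G(H)-q(H)|\le\theta p^{e(H)}$.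
   Context: Graphs are finite and simple; vertex subsets are finite and nonempty. A graph $G$ is identified with the characteristic function $G(x,y)\in\{0,1\}$ of its edge set, and $(X,Y)_G$ denotes the bipartite graph induced between $X$ and $Y$, viewed as the restriction of $G$ to $X\times Y$. $L(H)$ is the line graph of $H$ (vertices are the edges of $H$, adjacent when they share an endpoint); $\Delta(\cdot)$ is the maximum degree; $d(\cdot)$ is the degeneracy (the smallest $d\ge 0$ such that the vertices can be ordered so that each vertex has at most $d$ neighbours earlier in the ordering). A bipartite graph $\Gamma$ between $X$ and $Y$ is $(p,\beta)$-jumbled if $\left|\sum_{x\in X,y\in Y}(\Gamma(x,y)-p)u(x)v(y)\right|\le\beta\sqrt{\sum_{x\in X} u(x)}\sqrt{\sum_{y\in Y} v(y)}$ for all $u:X\to[0,1]$, $v:Y\to[0,1]$. A bipartite graph $G$ between $X$ and $Y$ satisfies $\mathrm{DISC}(q,p,\epsilon)$ if $\left|\frac{1}{|X||Y|}\sum_{x\in X,y\in Y}(G(x,y)-q)u(x)v(y)\right|\le\epsilon p$ for all $u:X\to[0,1]$, $v:Y\to[0,1]$. "Of size at least polynomial in $\theta$" means $c,\epsilon\ge\Omega(\theta^r)$ as $\theta\to0$ for some $r>0$, where $r$ and the implied constant depend only on $H$. *)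

theory Defs
  imports Complex_Main "HOL-Library.FuncSet" "HOL-Library.Landau_Symbols"
begin

type_synonym 'a ugraph = "'a set \<times> 'a set set"

abbreviation verts :: "'a ugraph \<Rightarrow> 'a set" where "verts \<equiv> fst"
abbreviation edges :: "'a ugraph \<Rightarrow> 'a set set" where "edges \<equiv> snd"

definition simple_graph :: "'a ugraph \<Rightarrow> bool" where
  "simple_graph G \<longleftrightarrow> finite (verts G) \<and> (\<forall>e\<in>edges G. e \<subseteq> verts G \<and> card e = 2)"

definition subgraph :: "'a ugraph \<Rightarrow> 'a ugraph \<Rightarrow> bool" where
  "subgraph G \<Gamma> \<longleftrightarrow> simple_graph G \<and> verts G \<subseteq> verts \<Gamma> \<and> edges G \<subseteq> edges \<Gamma>"

text \<open>The characteristic function of the edge set. It vanishes on the diagonal of a simple graph,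
  since \<open>{x, x}\<close> has only one element.\<close>

definition adj :: "'a ugraph \<Rightarrow> 'a \<Rightarrow> 'a \<Rightarrow> real" where
  "adj G x y = of_bool ({x, y} \<in> edges G)"

definition line_graph :: "'a ugraph \<Rightarrow> 'a set ugraph" where
  "line_graph H =
     (edges H, {{e, f} | e f. e \<in> edges H \<and> f \<in> edges H \<and> e \<noteq> f \<and> e \<inter> f \<noteq> {}})"

definition degree :: "'a ugraph \<Rightarrow> 'a \<Rightarrow> nat" where
  "degree G v = card {w \<in> verts G. {v, w} \<in> edges G}"

text \<open>Inserting 0 only matters for the graph without vertices, whose maximum degree is 0.\<close>

definition max_degree :: "'a ugraph \<Rightarrow> nat" where
  "max_degree G = Max (insert 0 (degree G ` verts G))"

definition degeneracy :: "'a ugraph \<Rightarrow> nat" where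
  "degeneracy G =
     (LEAST d. \<exists>vs. distinct vs \<and> set vs = verts G \<and>
        (\<forall>i<length vs. card {j. j < i \<and> {vs ! j, vs ! i} \<in> edges G} \<le> d))"

text \<open>A bipartite graph between \<open>X\<close> and \<open>Y\<close> is given by the two sets and a function \<open>g\<close> of which
  only the values on \<open>X \<times> Y\<close> matter; \<open>X\<close> and \<open>Y\<close> need not be disjoint. Thus the bipartite graph
  induced by \<open>G\<close> between \<open>X\<close> and \<open>Y\<close> is given by \<open>X\<close>, \<open>Y\<close> and \<open>adj G\<close>.\<close>

definition jumbled ::
  "'a set \<Rightarrow> 'b set \<Rightarrow> ('a \<Rightarrow> 'b \<Rightarrow> real) \<Rightarrow> real \<Rightarrow> real \<Rightarrow> bool" where
  "jumbled X Y g p \<beta> \<longleftrightarrow>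
     (\<forall>u v. (\<forall>x\<in>X. u x \<in> {0..1}) \<and> (\<forall>y\<in>Y. v y \<in> {0..1}) \<longrightarrow>
        \<bar>\<Sum>x\<in>X. \<Sum>y\<in>Y. (g x y - p) * u x * v y\<bar> \<le> \<beta> * sqrt (\<Sum>x\<in>X. u x) * sqrt (\<Sum>y\<in>Y. v y))"

definition DISC ::
  "'a set \<Rightarrow> 'b set \<Rightarrow> ('a \<Rightarrow> 'b \<Rightarrow> real) \<Rightarrow> real \<Rightarrow> real \<Rightarrow> real \<Rightarrow> bool" where
  "DISC X Y g q p \<epsilon> \<longleftrightarrow>
     (\<forall>u v. (\<forall>x\<in>X. u x \<in> {0..1}) \<and> (\<forall>y\<in>Y. v y \<in> {0..1}) \<longrightarrow>
        \<bar>1 / (real (card X) * real (card Y)) * (\<Sum>x\<in>X. \<Sum>y\<in>Y. (g x y - q) * u x * v y)\<bar> \<le> \<epsilon> * p)"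

text \<open>For graphs on natural numbers each edge \<open>{i, j}\<close> is listed once, as the pair with \<open>i < j\<close>.\<close>

definition edge_pairs :: "nat ugraph \<Rightarrow> (nat \<times> nat) set" where
  "edge_pairs H = {(i, j). i < j \<and> {i, j} \<in> edges H}"

text \<open>\<open>hom_density G H X\<close> and \<open>edge_weight q H\<close> are the quantities \<open>G(H)\<close> and \<open>q(H)\<close>.\<close>

definition hom_density :: "'a ugraph \<Rightarrow> nat ugraph \<Rightarrow> (nat \<Rightarrow> 'a set) \<Rightarrow> real" where
  "hom_density G H X =
     1 / (\<Prod>i\<in>verts H. real (card (X i))) *
     (\<Sum>x\<in>PiE (verts H) X. \<Prod>(i, j)\<in>edge_pairs H. adj G (x i) (x j))"

definition edge_weight :: "(nat \<Rightarrow> nat \<Rightarrow> real) \<Rightarrow> nat ugraph \<Rightarrow> real" where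
  "edge_weight q H = (\<Prod>(i, j)\<in>edge_pairs H. q i j)"

end

theory Submission
  imports Defs "HOL-Analysis.Convex"
begin

text \<open>The edges are replaced one at a time by their densities, following an ordering of the edges
  witnessing the degeneracy of the line graph (any ordering if the maximum degree is used). To bound
  the average of \<open>f(x\<^sub>a, x\<^sub>b)\<close> times the remaining factors, where \<open>f = G - q\<close>, apply Cauchy-Schwarz to
  duplicate \<open>b\<close>. All edges of \<open>G\<close> not touching \<open>b\<close> are thereby majorized by edges of \<open>\<Gamma>\<close>, and
  jumbledness removes these one by one, each at the cost of a factor \<open>p\<close>. Removing an edge is possible
  as long as at most \<open>2k - 2\<close> of the remaining edges meet it; duplication adds 2 to the maximum degree
  and at most 4 to the degeneracy, which is where the two thresholds for \<open>k\<close> come from.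
  Duplicating \<open>a\<close> in the same way and removing the edges at \<open>b\<close> leaves the 4-cycle count of \<open>f\<close>.
  It is small by discrepancy, since codegrees are essentially bounded by a multiple of \<open>p\<^sup>2\<close>.\<close>

section \<open>Averages and jumbledness\<close>

text \<open>The error has to be small relative to \<open>p ^ e(H)\<close>, so no edge may simply be
  bounded by 1: that would lose a factor p for good. Discrepancy only controls one edge of G against
  bounded weights, without any gain when the weights have small mass. The error in jumbledness does
  scale with the square roots of the masses of the test functions; this is why the other edges are
  carried over to \<Gamma> before they are removed. The price is that each use of Cauchy-Schwarz on
  a small quantity takes the square root of the error. Four square roots lie on the way: one for the
  degree variance and one for the bounded weight inside the 4-cycle estimate, then one for each of
  the two duplicated vertices. If jumbledness and discrepancy are of order \<open>s ^ 16\<close>,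
  the errors are successively of order \<open>s ^ 8\<close>, \<open>s ^ 4\<close> (the 4-cycle
  count), \<open>s ^ 2\<close> and \<open>s\<close>. With s proportional to \<theta> this explains
  the power 16.\<close>

definition mean :: "'b set \<Rightarrow> ('b \<Rightarrow> real) \<Rightarrow> real" where
  "mean A f = (\<Sum>x\<in>A. f x) / real (card A)"

lemma mean_cong: "(\<And>x. x \<in> A \<Longrightarrow> f x = g x) \<Longrightarrow> mean A f = mean A g"
  by (simp add: mean_def)

lemma mean_add: "mean A (\<lambda>x. f x + g x) = mean A f + mean A g"
  by (simp add: mean_def sum.distrib add_divide_distrib)

lemma mean_diff: "mean A (\<lambda>x. f x - g x) = mean A f - mean A g"
  by (simp add: mean_def sum_subtractf diff_divide_distrib)

lemma mean_cmult: "mean A (\<lambda>x. c * f x) = c * mean A f"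
  by (simp add: mean_def sum_distrib_left)

lemma mean_multc: "mean A (\<lambda>x. f x * c) = mean A f * c"
  by (simp add: mean_def sum_distrib_right)

lemma mean_const: "finite A \<Longrightarrow> A \<noteq> {} \<Longrightarrow> mean A (\<lambda>x. c) = c"
  by (simp add: mean_def)

lemma mean_mono: "(\<And>x. x \<in> A \<Longrightarrow> f x \<le> g x) \<Longrightarrow> mean A f \<le> mean A g"
  by (simp add: mean_def divide_right_mono sum_mono)

lemma mean_nonneg: "(\<And>x. x \<in> A \<Longrightarrow> 0 \<le> f x) \<Longrightarrow> 0 \<le> mean A f"
  by (simp add: mean_def sum_nonneg)

lemma mean_abs: "\<bar>mean A f\<bar> \<le> mean A (\<lambda>x. \<bar>f x\<bar>)"
  by (simp add: mean_def abs_divide divide_right_mono sum_abs)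

lemma mean_abs_le:
  "finite A \<Longrightarrow> A \<noteq> {} \<Longrightarrow> (\<And>x. x \<in> A \<Longrightarrow> \<bar>f x\<bar> \<le> C) \<Longrightarrow> \<bar>mean A f\<bar> \<le> C"
  using order_trans[OF mean_abs[of A f] mean_mono[of A "\<lambda>x. \<bar>f x\<bar>" "\<lambda>_. C"]]
  by (simp add: mean_const)

lemma mean_swap: "mean A (\<lambda>x. mean B (f x)) = mean B (\<lambda>y. mean A (\<lambda>x. f x y))"
  by (simp add: mean_def sum_divide_distrib[symmetric] sum.swap[of f B A] mult.commute)

lemma mean_mult_mean: "mean A f * mean B g = mean A (\<lambda>x. mean B (\<lambda>y. f x * g y))"
  by (simp add: mean_cmult mean_multc)

lemma mean_power2: "(mean A f)\<^sup>2 = mean A (\<lambda>x. mean A (\<lambda>y. f x * f y))"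
  by (simp add: power2_eq_square mean_mult_mean)

text \<open>Distributing the majorant as \<open>sqrt \<rho>\<close> over both factors makes the
  signed function \<open>r\<close> disappear. Applied to products of edges, this trades edges of G
  for edges of \<Gamma>.\<close>

lemma mean_weighted_Cauchy_Schwarz:
  assumes "\<And>x. x \<in> A \<Longrightarrow> \<bar>r x\<bar> \<le> \<rho> x"
  shows "(mean A (\<lambda>x. r x * h x))\<^sup>2 \<le> mean A \<rho> * mean A (\<lambda>x. \<rho> x * (h x)\<^sup>2)"
proof -
  have nn: "0 \<le> \<rho> x" if "x \<in> A" for x
    using assms[OF that] by linarith
  have "\<bar>\<Sum>x\<in>A. r x * h x\<bar> \<le> (\<Sum>x\<in>A. \<bar>r x * h x\<bar>)"
    by (rule sum_abs)
  also have "\<dots> \<le> (\<Sum>x\<in>A. sqrt (\<rho> x) * (sqrt (\<rho> x) * \<bar>h x\<bar>))"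
    using assms nn by (intro sum_mono)
      (simp add: abs_mult mult.assoc[symmetric] mult_right_mono)
  finally have "(\<Sum>x\<in>A. r x * h x)\<^sup>2 \<le> (\<Sum>x\<in>A. sqrt (\<rho> x) * (sqrt (\<rho> x) * \<bar>h x\<bar>))\<^sup>2"
    by (simp add: abs_le_square_iff[symmetric])
  also have "\<dots> \<le> (\<Sum>x\<in>A. (sqrt (\<rho> x))\<^sup>2) * (\<Sum>x\<in>A. (sqrt (\<rho> x) * \<bar>h x\<bar>)\<^sup>2)"
    by (rule Cauchy_Schwarz_ineq_sum)
  also have "\<dots> = (\<Sum>x\<in>A. \<rho> x) * (\<Sum>x\<in>A. \<rho> x * (h x)\<^sup>2)"
    using nn by (simp add: power_mult_distrib)
  finally show ?thesis
    by (simp add: mean_def power_divide divide_right_mono power2_eq_square)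
qed

lemma mean_Cauchy_Schwarz:
  "\<bar>mean A (\<lambda>x. f x * g x)\<bar> \<le> sqrt (mean A (\<lambda>x. (f x)\<^sup>2)) * sqrt (mean A (\<lambda>x. (g x)\<^sup>2))"
proof -
  have "(\<Sum>x\<in>A. f x * g x)\<^sup>2 \<le> (\<Sum>x\<in>A. (f x)\<^sup>2) * (\<Sum>x\<in>A. (g x)\<^sup>2)"
    by (rule Cauchy_Schwarz_ineq_sum)
  then have "(mean A (\<lambda>x. f x * g x))\<^sup>2 \<le> mean A (\<lambda>x. (f x)\<^sup>2) * mean A (\<lambda>x. (g x)\<^sup>2)"
    by (simp add: mean_def power_divide divide_right_mono power2_eq_square)
  then have "sqrt ((mean A (\<lambda>x. f x * g x))\<^sup>2) \<le> sqrt (mean A (\<lambda>x. (f x)\<^sup>2) * mean A (\<lambda>x. (g x)\<^sup>2))"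
    by (rule real_sqrt_le_mono)
  then show ?thesis
    by (simp add: real_sqrt_mult)
qed

lemma mean_sqrt_mult_sqrt:
  assumes "\<And>x. x \<in> A \<Longrightarrow> 0 \<le> f x" "\<And>x. x \<in> A \<Longrightarrow> 0 \<le> g x"
  shows "mean A (\<lambda>x. sqrt (f x) * sqrt (g x)) \<le> sqrt (mean A f) * sqrt (mean A g)"
proof -
  have "mean A (\<lambda>x. sqrt (f x) * sqrt (g x)) \<le>
      sqrt (mean A (\<lambda>x. (sqrt (f x))\<^sup>2)) * sqrt (mean A (\<lambda>x. (sqrt (g x))\<^sup>2))"
    using mean_Cauchy_Schwarz[of A "\<lambda>x. sqrt (f x)" "\<lambda>x. sqrt (g x)"] by linarith
  also have "\<dots> = sqrt (mean A f) * sqrt (mean A g)"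
    using assms by (simp cong: mean_cong)
  finally show ?thesis .
qed

lemma mean_sqrt_le:
  assumes "finite A" "A \<noteq> {}" "\<And>x. x \<in> A \<Longrightarrow> 0 \<le> f x"
  shows "mean A (\<lambda>x. sqrt (f x)) \<le> sqrt (mean A f)"
  using mean_sqrt_mult_sqrt[of A f "\<lambda>_. 1"] assms mean_const[of A 1] by simp

lemma mean_PiE_insert:
  assumes "finite V" "v \<notin> V"
  shows "mean (PiE (insert v V) X) F = mean (X v) (\<lambda>y. mean (PiE V X) (\<lambda>x. F (x(v := y))))"
proof -
  have inj: "inj_on (\<lambda>(y, g). g(v := y)) (X v \<times> PiE V X)"
    using assms(2) by (rule inj_combinator)
  have "(\<Sum>x\<in>PiE (insert v V) X. F x) = (\<Sum>(y, g)\<in>X v \<times> PiE V X. F (g(v := y)))"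
    unfolding PiE_insert_eq by (subst sum.reindex[OF inj]) (simp add: case_prod_unfold)
  also have "\<dots> = (\<Sum>y\<in>X v. \<Sum>g\<in>PiE V X. F (g(v := y)))"
    by (simp add: sum.cartesian_product)
  finally show ?thesis
    unfolding mean_def card_PiE[OF finite.insertI[OF assms(1)]] card_PiE[OF assms(1)]
    using assms by (simp add: sum_divide_distrib[symmetric])
qed

lemma finite_nonempty_PiE:
  assumes "finite V" "\<And>i. i \<in> V \<Longrightarrow> finite (X i) \<and> X i \<noteq> {}"
  shows "finite (PiE V X)" "PiE V X \<noteq> {}"
  using assms by (auto intro: finite_PiE simp: PiE_eq_empty_iff)

lemma mean_PiE_insert':
  assumes "finite V" "v \<notin> V"
  shows "mean (PiE (insert v V) X) F = mean (PiE V X) (\<lambda>x. mean (X v) (\<lambda>y. F (x(v := y))))"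
  unfolding mean_PiE_insert[OF assms] by (rule mean_swap)

text \<open>Because sums are normalized, a vertex on which nothing depends can be added or dropped
  freely, so counts over different vertex sets stay comparable.\<close>

lemma mean_PiE_insert_indep:
  assumes "finite V" "v \<notin> V" "finite (X v)" "X v \<noteq> {}" "\<And>x y. F (x(v := y)) = F x"
  shows "mean (PiE (insert v V) X) F = mean (PiE V X) F"
  unfolding mean_PiE_insert[OF assms(1,2)] using assms(3-) by (simp add: mean_const)

text \<open>Here \<open>h\<close> is the deviation from the density, the test functions may be negative, and all sums are
  normalized, so that \<open>\<beta>\<close> lacks the factor \<open>sqrt (card A * card B)\<close> of \<open>jumbled\<close>.\<close>

definition sjumb :: "'b set \<Rightarrow> 'c set \<Rightarrow> ('b \<Rightarrow> 'c \<Rightarrow> real) \<Rightarrow> real \<Rightarrow> bool" where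
  "sjumb A B h \<beta> \<longleftrightarrow>
     (\<forall>u v. (\<forall>x\<in>A. \<bar>u x\<bar> \<le> 1) \<and> (\<forall>y\<in>B. \<bar>v y\<bar> \<le> 1) \<longrightarrow>
        \<bar>mean A (\<lambda>x. mean B (\<lambda>y. h x y * u x * v y))\<bar>
          \<le> \<beta> * sqrt (mean A (\<lambda>x. \<bar>u x\<bar>)) * sqrt (mean B (\<lambda>y. \<bar>v y\<bar>)))"

lemma sjumbD:
  assumes "sjumb A B h \<beta>" "\<And>x. x \<in> A \<Longrightarrow> \<bar>u x\<bar> \<le> 1" "\<And>y. y \<in> B \<Longrightarrow> \<bar>v y\<bar> \<le> 1"
  shows "\<bar>mean A (\<lambda>x. mean B (\<lambda>y. h x y * u x * v y))\<bar>
          \<le> \<beta> * sqrt (mean A (\<lambda>x. \<bar>u x\<bar>)) * sqrt (mean B (\<lambda>y. \<bar>v y\<bar>))"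
  using assms unfolding sjumb_def by blast

lemma sjumb_swap:
  assumes "sjumb A B h \<beta>"
  shows "sjumb B A (\<lambda>y x. h x y) \<beta>"
  unfolding sjumb_def
proof (intro allI impI, elim conjE)
  fix u :: "_ \<Rightarrow> real" and v :: "_ \<Rightarrow> real" assume "\<forall>y\<in>B. \<bar>u y\<bar> \<le> 1" "\<forall>x\<in>A. \<bar>v x\<bar> \<le> (1::real)"
  then have "\<bar>mean A (\<lambda>x. mean B (\<lambda>y. h x y * v x * u y))\<bar>
          \<le> \<beta> * sqrt (mean A (\<lambda>x. \<bar>v x\<bar>)) * sqrt (mean B (\<lambda>y. \<bar>u y\<bar>))"
    by (intro sjumbD[OF assms]) auto
  then show "\<bar>mean B (\<lambda>y. mean A (\<lambda>x. h x y * u y * v x))\<bar>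
          \<le> \<beta> * sqrt (mean B (\<lambda>y. \<bar>u y\<bar>)) * sqrt (mean A (\<lambda>x. \<bar>v x\<bar>))"
    unfolding mean_swap[of B] by (simp add: mult_ac)
qed

lemma sjumb_cmult:
  assumes "sjumb A B h \<beta>"
  shows "sjumb A B (\<lambda>x y. a * h x y) (\<bar>a\<bar> * \<beta>)"
  unfolding sjumb_def
proof (intro allI impI, elim conjE)
  fix u :: "_ \<Rightarrow> real" and v :: "_ \<Rightarrow> real" assume "\<forall>x\<in>A. \<bar>u x\<bar> \<le> 1" "\<forall>y\<in>B. \<bar>v y\<bar> \<le> (1::real)"
  then have "\<bar>mean A (\<lambda>x. mean B (\<lambda>y. h x y * u x * v y))\<bar>
          \<le> \<beta> * sqrt (mean A (\<lambda>x. \<bar>u x\<bar>)) * sqrt (mean B (\<lambda>y. \<bar>v y\<bar>))"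
    by (intro sjumbD[OF assms]) auto
  then have "\<bar>a\<bar> * \<bar>mean A (\<lambda>x. mean B (\<lambda>y. h x y * u x * v y))\<bar>
          \<le> \<bar>a\<bar> * (\<beta> * sqrt (mean A (\<lambda>x. \<bar>u x\<bar>)) * sqrt (mean B (\<lambda>y. \<bar>v y\<bar>)))"
    by (intro mult_left_mono) auto
  then show "\<bar>mean A (\<lambda>x. mean B (\<lambda>y. a * h x y * u x * v y))\<bar>
          \<le> \<bar>a\<bar> * \<beta> * sqrt (mean A (\<lambda>x. \<bar>u x\<bar>)) * sqrt (mean B (\<lambda>y. \<bar>v y\<bar>))"
    by (simp add: mean_cmult abs_mult mult.assoc)
qed

lemma sjumb_mono:
  assumes "sjumb A B h \<beta>" "\<beta> \<le> \<beta>'"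
  shows "sjumb A B h \<beta>'"
  unfolding sjumb_def
proof (intro allI impI, elim conjE)
  fix u :: "_ \<Rightarrow> real" and v :: "_ \<Rightarrow> real"
  assume "\<forall>x\<in>A. \<bar>u x\<bar> \<le> 1" "\<forall>y\<in>B. \<bar>v y\<bar> \<le> 1"
  then have "\<bar>mean A (\<lambda>x. mean B (\<lambda>y. h x y * u x * v y))\<bar>
          \<le> \<beta> * (sqrt (mean A (\<lambda>x. \<bar>u x\<bar>)) * sqrt (mean B (\<lambda>y. \<bar>v y\<bar>)))"
    using sjumbD[OF assms(1), of u v] by (simp add: mult.assoc)
  also have "\<dots> \<le> \<beta>' * (sqrt (mean A (\<lambda>x. \<bar>u x\<bar>)) * sqrt (mean B (\<lambda>y. \<bar>v y\<bar>)))"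
    using assms(2) by (rule mult_right_mono) (simp add: mean_nonneg)
  finally show "\<bar>mean A (\<lambda>x. mean B (\<lambda>y. h x y * u x * v y))\<bar>
          \<le> \<beta>' * sqrt (mean A (\<lambda>x. \<bar>u x\<bar>)) * sqrt (mean B (\<lambda>y. \<bar>v y\<bar>))"
    by (simp only: mult.assoc)
qed

text \<open>For uses in which nothing but the bound 1 is known about \<open>v\<close>; its factor
  under the root is then given up.\<close>

lemma sjumb_abs_le:
  assumes "sjumb A B h \<beta>" "0 \<le> \<beta>" "finite A" "A \<noteq> {}" "finite B" "B \<noteq> {}"
    "\<And>x. x \<in> A \<Longrightarrow> \<bar>u x\<bar> \<le> 1" "\<And>y. y \<in> B \<Longrightarrow> \<bar>v y\<bar> \<le> 1"
  shows "\<bar>mean A (\<lambda>x. mean B (\<lambda>y. h x y * u x * v y))\<bar> \<le> \<beta> * sqrt (mean A (\<lambda>x. \<bar>u x\<bar>))"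
proof -
  have "mean B (\<lambda>y. \<bar>v y\<bar>) \<le> 1"
    using mean_abs_le[of B "\<lambda>y. \<bar>v y\<bar>" 1] assms(5,6,8) by simp
  then have "\<beta> * sqrt (mean A (\<lambda>x. \<bar>u x\<bar>)) * sqrt (mean B (\<lambda>y. \<bar>v y\<bar>))
    \<le> \<beta> * sqrt (mean A (\<lambda>x. \<bar>u x\<bar>)) * 1"
    using assms(2) by (intro mult_left_mono) (simp_all add: mean_nonneg)
  moreover have "\<bar>mean A (\<lambda>x. mean B (\<lambda>y. h x y * u x * v y))\<bar>
          \<le> \<beta> * sqrt (mean A (\<lambda>x. \<bar>u x\<bar>)) * sqrt (mean B (\<lambda>y. \<bar>v y\<bar>))"
    using assms by (intro sjumbD[OF assms(1)])
  ultimately show ?thesis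
    by linarith
qed

section \<open>Removing edges\<close>

abbreviation ends :: "'v \<times> 'v \<Rightarrow> 'v set" where
  "ends e \<equiv> {fst e, snd e}"

text \<open>Weights are attached to edges, since after a duplication different edges carry different
  functions: the deviation, G or \<Gamma>. The edges form a list because the order of removal
  matters.\<close>

definition eprod :: "('v \<times> 'v \<Rightarrow> 'a \<Rightarrow> 'a \<Rightarrow> real) \<Rightarrow> ('v \<times> 'v) list \<Rightarrow> ('v \<Rightarrow> 'a) \<Rightarrow> real" where
  "eprod w K x = (\<Prod>e\<leftarrow>K. w e (x (fst e)) (x (snd e)))"

lemma eprod_Nil [simp]: "eprod w [] x = 1"
  and eprod_Cons [simp]: "eprod w (e # K) x = w e (x (fst e)) (x (snd e)) * eprod w K x"
  and eprod_append [simp]: "eprod w (K @ L) x = eprod w K x * eprod w L x"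
  by (simp_all add: eprod_def)

lemma eprod_Cons_eq: "eprod w (e # K) = (\<lambda>x. w e (x (fst e)) (x (snd e)) * eprod w K x)"
  and eprod_append_eq: "eprod w (K @ L) = (\<lambda>x. eprod w K x * eprod w L x)"
  by auto

lemma eprod_filter_split:
  "eprod w K x = eprod w (filter P K) x * eprod w (filter (\<lambda>e. \<not> P e) K) x"
  by (induction K) auto

lemma eprod_upd: "(\<And>e. e \<in> set K \<Longrightarrow> v \<notin> ends e) \<Longrightarrow> eprod w K (x(v := y)) = eprod w K x"
  by (induction K) auto

lemma eprod_cong: "(\<And>e. e \<in> set K \<Longrightarrow> w e = w' e) \<Longrightarrow> eprod w K x = eprod w' K x"
  by (induction K) auto

text \<open>Nonnegativity of \<open>\<nu>\<close> is implied. The bound 1 keeps products of edges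
  within the range of test functions that \<open>sjumb\<close> admits.\<close>

definition majorized ::
  "'v set \<Rightarrow> ('v \<Rightarrow> 'a set) \<Rightarrow> ('v \<times> 'v \<Rightarrow> 'a \<Rightarrow> 'a \<Rightarrow> real) \<Rightarrow> ('v \<times> 'v \<Rightarrow> 'a \<Rightarrow> 'a \<Rightarrow> real)
    \<Rightarrow> ('v \<times> 'v) list \<Rightarrow> bool" where
  "majorized V X w \<nu> K \<longleftrightarrow>
     (\<forall>e\<in>set K. ends e \<subseteq> V \<and>
        (\<forall>x\<in>X (fst e). \<forall>y\<in>X (snd e). \<bar>w e x y\<bar> \<le> \<nu> e x y \<and> \<nu> e x y \<le> 1))"

lemma majorized_filter: "majorized V X w \<nu> K \<Longrightarrow> majorized V X w \<nu> (filter P K)"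
  by (simp add: majorized_def)

lemma majorized_append [simp]:
  "majorized V X w \<nu> (K @ L) \<longleftrightarrow> majorized V X w \<nu> K \<and> majorized V X w \<nu> L"
  by (auto simp: majorized_def)

lemma majorized_ConsD: "majorized V X w \<nu> (e # K) \<Longrightarrow> majorized V X w \<nu> K"
  by (simp add: majorized_def)

lemma eprod_majorized:
  assumes "majorized V X w \<nu> K" "x \<in> PiE V X"
  shows "\<bar>eprod w K x\<bar> \<le> eprod \<nu> K x" "eprod \<nu> K x \<le> 1"
proof -
  have "\<bar>eprod w K x\<bar> \<le> eprod \<nu> K x \<and> eprod \<nu> K x \<le> 1"
    using assms(1)
  proof (induction K)
    case (Cons e K)
    then have IH: "\<bar>eprod w K x\<bar> \<le> eprod \<nu> K x" "eprod \<nu> K x \<le> 1"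
      by (simp_all add: majorized_def)
    have e: "\<bar>w e (x (fst e)) (x (snd e))\<bar> \<le> \<nu> e (x (fst e)) (x (snd e))"
      "\<nu> e (x (fst e)) (x (snd e)) \<le> 1"
      using Cons.prems assms(2) by (auto simp: majorized_def PiE_iff)
    show ?case
      using IH e by (auto simp: abs_mult intro!: mult_mono mult_le_one)
  qed simp
  then show "\<bar>eprod w K x\<bar> \<le> eprod \<nu> K x" "eprod \<nu> K x \<le> 1"
    by auto
qed

lemma eprod_majorant_nonneg:
  "majorized V X w \<nu> K \<Longrightarrow> x \<in> PiE V X \<Longrightarrow> 0 \<le> eprod \<nu> K x"
  using eprod_majorized(1) by fastforce

text \<open>Distinctness of \<open>ends\<close> excludes an edge together with its reversal as well
  as a repeated pair.\<close>

definition loopfree_simple :: "('v \<times> 'v) list \<Rightarrow> bool" where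
  "loopfree_simple K \<longleftrightarrow> distinct (map ends K) \<and> (\<forall>e\<in>set K. fst e \<noteq> snd e)"

lemma loopfree_simple_filter: "loopfree_simple K \<Longrightarrow> loopfree_simple (filter P K)"
  by (simp add: loopfree_simple_def distinct_map_filter)

lemma loopfree_simple_Cons [simp]:
  "loopfree_simple (e # K) \<longleftrightarrow> loopfree_simple K \<and> fst e \<noteq> snd e \<and> ends e \<notin> ends ` set K"
  by (auto simp: loopfree_simple_def)

text \<open>Fixing all vertices but the two ends of the edge, the other factors split into a function
  of either end; the average over the fixed vertices is then taken by Cauchy-Schwarz.\<close>

lemma mean_jumbled_edge:
  assumes fin: "finite V" "\<And>i. i \<in> V \<Longrightarrow> finite (X i) \<and> X i \<noteq> {}"
    and ab: "a \<in> V" "b \<in> V"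
    and simple: "loopfree_simple ((a, b) # K)"
    and maj: "majorized V X w \<nu> K"
    and h: "sjumb (X a) (X b) h \<beta>" "0 \<le> \<beta>"
  shows "\<bar>mean (PiE V X) (\<lambda>x. h (x a) (x b) * eprod w K x)\<bar> \<le>
    \<beta> * (sqrt (mean (PiE V X) (eprod \<nu> (filter (\<lambda>e. b \<notin> ends e) K)))
       * sqrt (mean (PiE V X) (eprod \<nu> (filter (\<lambda>e. a \<notin> ends e) K))))"
proof -
  define V0 where "V0 = V - {a, b}"
  have neq: "a \<noteq> b"
    using simple by simp
  have V: "V = insert a (insert b V0)" "V = insert b (insert a V0)" "finite V0"
    "a \<notin> insert b V0" "b \<notin> V0" "a \<notin> V0" "b \<notin> insert a V0"
    using ab fin neq by (auto simp: V0_def)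
  have Xab: "finite (X a)" "X a \<noteq> {}" "finite (X b)" "X b \<noteq> {}"
    using fin(2) ab by auto
  \<comment> \<open>The edges at \<open>a\<close>, those at \<open>b\<close> and those at neither
    end. No edge of \<open>K\<close> joins \<open>a\<close> and \<open>b\<close>, so
    \<open>U\<close> does not depend on \<open>b\<close>, nor \<open>Va\<close> on
    \<open>a\<close>.\<close>
  define U where "U = filter (\<lambda>e. a \<in> ends e) K"
  define Va where "Va = filter (\<lambda>e. b \<in> ends e) (filter (\<lambda>e. a \<notin> ends e) K)"
  define W where "W = filter (\<lambda>e. b \<notin> ends e) (filter (\<lambda>e. a \<notin> ends e) K)"
  have noab: "\<not> (a \<in> ends e \<and> b \<in> ends e)" if "e \<in> set K" for e
  proof
    assume "a \<in> ends e \<and> b \<in> ends e"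
    then have "ends e = ends (a, b)"
      using neq by auto
    then show False
      using simple that by auto
  qed
  have notin: "b \<notin> ends e" if "e \<in> set U" for e
    using that noab[of e] unfolding U_def by (simp only: set_filter mem_Collect_eq) blast
  have split: "eprod f K x = eprod f U x * eprod f Va x * eprod f W x" for f x
    using eprod_filter_split[of f K x "\<lambda>e. a \<in> ends e"]
      eprod_filter_split[of f "filter (\<lambda>e. a \<notin> ends e) K" x "\<lambda>e. b \<in> ends e"]
    by (simp add: U_def Va_def W_def mult.assoc)
  have U_eq: "filter (\<lambda>e. a \<in> ends e) (filter (\<lambda>e. b \<notin> ends e) K) = U"
    unfolding U_def filter_filter using noab by (intro filter_cong) auto
  have W_eq: "filter (\<lambda>e. a \<notin> ends e) (filter (\<lambda>e. b \<notin> ends e) K) = W"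
    unfolding W_def filter_filter by (intro filter_cong) auto
  have split_b: "eprod f (filter (\<lambda>e. b \<notin> ends e) K) x = eprod f U x * eprod f W x" for f x
    using eprod_filter_split[of f "filter (\<lambda>e. b \<notin> ends e) K" x "\<lambda>e. a \<in> ends e"] U_eq W_eq
    by simp
  have split_a: "eprod f (filter (\<lambda>e. a \<notin> ends e) K) x = eprod f Va x * eprod f W x" for f x
    using eprod_filter_split[of f "filter (\<lambda>e. a \<notin> ends e) K" x "\<lambda>e. b \<in> ends e"]
    by (simp add: Va_def W_def)
  have updW: "eprod f W (x(a := s)) = eprod f W x" "eprod f W (x(b := s)) = eprod f W x" for f x s
    by (rule eprod_upd; auto simp: W_def)+
  have updU: "eprod f U (x(b := s)) = eprod f U x" for f x s
    using notin by (intro eprod_upd) auto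
  have updV: "eprod f Va (x(a := s)) = eprod f Va x" for f x s
    by (rule eprod_upd) (auto simp: Va_def)
  have majs: "majorized V X w \<nu> U" "majorized V X w \<nu> Va" "majorized V X w \<nu> W"
    using maj by (auto simp: U_def Va_def W_def intro!: majorized_filter)
  \<comment> \<open>The majorants are known on \<open>PiE V X\<close> only; these values extend an
    assignment on \<open>V0\<close> to all of \<open>V\<close> without changing the factors in
    question.\<close>
  obtain s0 t0 where s0: "s0 \<in> X a" and t0: "t0 \<in> X b"
    using Xab by auto
  have mem: "x(b := t, a := s) \<in> PiE V X" if "x \<in> PiE V0 X" "s \<in> X a" "t \<in> X b" for x s t
    using that V(1) by (auto intro!: PiE_fun_upd)
  have bU: "\<bar>eprod w U (x(a := s))\<bar> \<le> eprod \<nu> U (x(a := s))" "eprod \<nu> U (x(a := s)) \<le> 1"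
    if "x \<in> PiE V0 X" "s \<in> X a" for x s
    using eprod_majorized[OF majs(1) mem[OF that t0]] V
    by (simp_all add: fun_upd_twist[OF neq[symmetric]] updU)
  have bV: "\<bar>eprod w Va (x(b := t))\<bar> \<le> eprod \<nu> Va (x(b := t))" "eprod \<nu> Va (x(b := t)) \<le> 1"
    if "x \<in> PiE V0 X" "t \<in> X b" for x t
    using eprod_majorized[OF majs(2) mem[OF that(1) s0 that(2)]] by (simp_all add: updV)
  have bW: "\<bar>eprod w W x\<bar> \<le> eprod \<nu> W x" if "x \<in> PiE V0 X" for x
    using eprod_majorized(1)[OF majs(3) mem[OF that(1) s0 t0]] by (simp add: updW)
  define \<phi> where "\<phi> f x = mean (X a) (\<lambda>s. eprod f U (x(a := s)))" for f x
  define \<psi> where "\<psi> f x = mean (X b) (\<lambda>t. eprod f Va (x(b := t)))" for f x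
  have LHS: "mean (PiE V X) (\<lambda>x. h (x a) (x b) * eprod w K x) =
    mean (PiE V0 X) (\<lambda>x. eprod w W x *
      mean (X a) (\<lambda>s. mean (X b) (\<lambda>t. h s t * eprod w U (x(a := s)) * eprod w Va (x(b := t)))))"
  proof -
    have "mean (PiE V X) (\<lambda>x. h (x a) (x b) * eprod w K x) =
      mean (PiE V0 X) (\<lambda>x. mean (X a) (\<lambda>s. mean (X b) (\<lambda>t.
        h s t * eprod w K (x(a := s, b := t)))))"
      unfolding V(2) mean_PiE_insert'[OF finite.insertI[OF V(3)] V(7)] mean_PiE_insert'[OF V(3,6)]
      using neq by simp
    also have "\<dots> = mean (PiE V0 X) (\<lambda>x. mean (X a) (\<lambda>s. mean (X b) (\<lambda>t. eprod w W x *
        (h s t * eprod w U (x(a := s)) * eprod w Va (x(b := t))))))"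
      by (simp add: split updU updW fun_upd_twist[OF neq] updV mult_ac
        del: fun_upd_apply)
        (simp add: fun_upd_twist[OF neq[symmetric]] updU mult_ac del: fun_upd_apply)
    finally show ?thesis
      by (simp add: mean_cmult)
  qed
  have "\<bar>mean (PiE V X) (\<lambda>x. h (x a) (x b) * eprod w K x)\<bar> \<le>
    mean (PiE V0 X) (\<lambda>x. \<bar>eprod w W x *
      mean (X a) (\<lambda>s. mean (X b) (\<lambda>t. h s t * eprod w U (x(a := s)) * eprod w Va (x(b := t))))\<bar>)"
    unfolding LHS by (rule mean_abs)
  also have "\<dots> \<le> mean (PiE V0 X) (\<lambda>x. eprod \<nu> W x * (\<beta> * sqrt (\<phi> \<nu> x) * sqrt (\<psi> \<nu> x)))"
  proof (rule mean_mono)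
    fix x assume x: "x \<in> PiE V0 X"
    have "\<bar>mean (X a) (\<lambda>s. mean (X b) (\<lambda>t. h s t * eprod w U (x(a := s)) * eprod w Va (x(b := t))))\<bar>
      \<le> \<beta> * sqrt (mean (X a) (\<lambda>s. \<bar>eprod w U (x(a := s))\<bar>))
        * sqrt (mean (X b) (\<lambda>t. \<bar>eprod w Va (x(b := t))\<bar>))"
      using bU[OF x] bV[OF x] by (intro sjumbD[OF h(1)]) (force intro: order_trans)+
    also have "\<dots> \<le> \<beta> * sqrt (\<phi> \<nu> x) * sqrt (\<psi> \<nu> x)"
    proof -
      have "0 \<le> mean (X a) (\<lambda>s. \<bar>eprod w U (x(a := s))\<bar>)"
        "0 \<le> mean (X b) (\<lambda>t. \<bar>eprod w Va (x(b := t))\<bar>)"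
        by (rule mean_nonneg, simp)+
      moreover have "mean (X a) (\<lambda>s. \<bar>eprod w U (x(a := s))\<bar>) \<le> \<phi> \<nu> x"
        unfolding \<phi>_def by (rule mean_mono) (rule bU(1)[OF x])
      moreover have "mean (X b) (\<lambda>t. \<bar>eprod w Va (x(b := t))\<bar>) \<le> \<psi> \<nu> x"
        unfolding \<psi>_def by (rule mean_mono) (rule bV(1)[OF x])
      ultimately show ?thesis
        using h(2) by (intro mult_mono mult_left_mono real_sqrt_le_mono) simp_all
    qed
    finally show "\<bar>eprod w W x *
      mean (X a) (\<lambda>s. mean (X b) (\<lambda>t. h s t * eprod w U (x(a := s)) * eprod w Va (x(b := t))))\<bar>
      \<le> eprod \<nu> W x * (\<beta> * sqrt (\<phi> \<nu> x) * sqrt (\<psi> \<nu> x))"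
      unfolding abs_mult using bW[OF x] by (intro mult_mono) auto
  qed
  \<comment> \<open>The factor of \<open>W\<close> is split into two equal square roots, one for
    each side, so that Cauchy-Schwarz rebuilds the counts of \<open>K\<close> without the edges at
    \<open>b\<close> and without those at \<open>a\<close>.\<close>
  also have "\<dots> = \<beta> * mean (PiE V0 X)
      (\<lambda>x. sqrt (eprod \<nu> W x * \<phi> \<nu> x) * sqrt (eprod \<nu> W x * \<psi> \<nu> x))"
    unfolding mean_cmult[symmetric]
  proof (rule mean_cong)
    fix x assume "x \<in> PiE V0 X"
    then have "0 \<le> eprod \<nu> W x"
      using bW by force
    then have "eprod \<nu> W x = sqrt (eprod \<nu> W x) * sqrt (eprod \<nu> W x)"
      by simp
    then show "eprod \<nu> W x * (\<beta> * sqrt (\<phi> \<nu> x) * sqrt (\<psi> \<nu> x)) =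
      \<beta> * (sqrt (eprod \<nu> W x * \<phi> \<nu> x) * sqrt (eprod \<nu> W x * \<psi> \<nu> x))"
      unfolding real_sqrt_mult by (simp add: mult_ac)
  qed
  also have "\<dots> \<le> \<beta> * (sqrt (mean (PiE V0 X) (\<lambda>x. eprod \<nu> W x * \<phi> \<nu> x))
      * sqrt (mean (PiE V0 X) (\<lambda>x. eprod \<nu> W x * \<psi> \<nu> x)))"
  proof (rule mult_left_mono[OF mean_sqrt_mult_sqrt h(2)])
    fix x assume x: "x \<in> PiE V0 X"
    have "0 \<le> eprod \<nu> W x" "0 \<le> \<phi> \<nu> x" "0 \<le> \<psi> \<nu> x"
      unfolding \<phi>_def \<psi>_def using bU(1)[OF x] bV(1)[OF x] bW[OF x]
      by (force intro: mean_nonneg)+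
    then show "0 \<le> eprod \<nu> W x * \<phi> \<nu> x" "0 \<le> eprod \<nu> W x * \<psi> \<nu> x"
      by simp_all
  qed
  also have "mean (PiE V0 X) (\<lambda>x. eprod \<nu> W x * \<phi> \<nu> x) =
      mean (PiE V X) (eprod \<nu> (filter (\<lambda>e. b \<notin> ends e) K))"
  proof -
    have "mean (PiE V X) (eprod \<nu> (filter (\<lambda>e. b \<notin> ends e) K)) =
        mean (PiE (insert a V0) X) (eprod \<nu> (filter (\<lambda>e. b \<notin> ends e) K))"
      unfolding V(2) using V Xab by (intro mean_PiE_insert_indep) (auto intro: eprod_upd)
    also have "\<dots> = mean (PiE V0 X) (\<lambda>x. eprod \<nu> W x * \<phi> \<nu> x)"
      unfolding mean_PiE_insert'[OF V(3,6)] split_b updW \<phi>_def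
      by (simp only: mean_cmult[symmetric] mult.commute)
    finally show ?thesis by simp
  qed
  also have "mean (PiE V0 X) (\<lambda>x. eprod \<nu> W x * \<psi> \<nu> x) =
      mean (PiE V X) (eprod \<nu> (filter (\<lambda>e. a \<notin> ends e) K))"
  proof -
    have "mean (PiE V X) (eprod \<nu> (filter (\<lambda>e. a \<notin> ends e) K)) =
        mean (PiE (insert b V0) X) (eprod \<nu> (filter (\<lambda>e. a \<notin> ends e) K))"
      unfolding V(1) using V Xab by (intro mean_PiE_insert_indep) (auto intro: eprod_upd)
    also have "\<dots> = mean (PiE V0 X) (\<lambda>x. eprod \<nu> W x * \<psi> \<nu> x)"
      unfolding mean_PiE_insert'[OF V(3,5)] split_a updW \<psi>_def
      by (simp only: mean_cmult[symmetric] mult.commute)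
    finally show ?thesis by simp
  qed
  finally show ?thesis .
qed


section \<open>Orders of removal and lists of edges that jumbledness can remove\<close>

definition nb :: "'v \<times> 'v \<Rightarrow> ('v \<times> 'v) list \<Rightarrow> nat" where
  "nb e K = length (filter (\<lambda>e'. ends e \<inter> ends e' \<noteq> {}) K)"

lemma nb_Nil [simp]: "nb e [] = 0"
  and nb_Cons: "nb e (e' # K) = (if ends e \<inter> ends e' \<noteq> {} then 1 else 0) + nb e K"
  and nb_append [simp]: "nb e (K @ L) = nb e K + nb e L"
  by (simp_all add: nb_def)

lemma nb_le_length: "nb e K \<le> length K"
  by (simp add: nb_def)

lemma nb_filter_split: "nb e K = nb e (filter P K) + nb e (filter (\<lambda>e. \<not> P e) K)"
  by (induction K) (auto simp: nb_Cons)

lemma nb_filter_le: "nb e (filter P K) \<le> nb e K"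
  using nb_filter_split[of e K P] by simp

text \<open>Edges are removed from the front of the list, and removing one of them costs jumbledness
  with exponent 1 plus half the number of later edges meeting it.\<close>

primrec removable :: "real \<Rightarrow> ('v \<times> 'v) list \<Rightarrow> bool" where
  "removable k [] \<longleftrightarrow> True"
| "removable k (e # K) \<longleftrightarrow> real (nb e K) + 2 \<le> 2 * k \<and> removable k K"

lemma removable_filter: "removable k K \<Longrightarrow> removable k (filter P K)"
proof (induction K)
  case (Cons e K)
  then show ?case
    using nb_filter_le[of e P K] by auto
qed simp

lemma removable_appendI:
  assumes "removable k T"
    "\<And>S1 e S2. S = S1 @ e # S2 \<Longrightarrow> real (nb e S2 + nb e T) + 2 \<le> 2 * k"
  shows "removable k (S @ T)"
  using assms(2)
proof (induction S)
  case (Cons e S)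
  have "removable k (S @ T)"
    using Cons.prems by (intro Cons.IH) (metis append_Cons)
  moreover have "real (nb e S + nb e T) + 2 \<le> 2 * k"
    by (rule Cons.prems[of "[]"]) simp
  ultimately show ?case
    by simp
qed (use assms(1) in simp)

text \<open>No edge of \<open>K\<close> has both \<open>a\<close> and \<open>b\<close> as ends, so
  an edge meeting \<open>(a, b)\<close> is missing from exactly one of the two filtered lists, and
  any other edge from neither.\<close>

lemma length_avoiding_ends:
  assumes "loopfree_simple ((a, b) # K)"
  shows "length (filter (\<lambda>e. b \<notin> ends e) K) + length (filter (\<lambda>e. a \<notin> ends e) K) + nb (a, b) K
    = 2 * length K"
  using assms
proof (induction K)
  case (Cons e K)
  then have "length (filter (\<lambda>e. b \<notin> ends e) K) + length (filter (\<lambda>e. a \<notin> ends e) K) + nb (a, b) K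
    = 2 * length K"
    by simp
  moreover have "\<not> (a \<in> ends e \<and> b \<in> ends e)"
    using Cons.prems by auto
  ultimately show ?case
    by (auto simp: nb_Cons)
qed simp

text \<open>The exponent of \<open>p\<close> is \<open>k + (n1 + n2) / 2 = k + n - N / 2\<close>,
  and it must reach \<open>n + 1\<close>, the number of edges before the removal. This is the
  condition \<open>N + 2 \<le> 2 * k\<close> behind \<open>removable\<close>.\<close>

lemma jumbled_error_bound:
  fixes p c k :: real
  assumes "0 < p" "p \<le> 1" "0 \<le> c" "real N + 2 \<le> 2 * k" "n1 + n2 + N = 2 * n"
  shows "c * p powr k * (sqrt ((2 * p) ^ n1) * sqrt ((2 * p) ^ n2)) \<le> c * (2 ^ n * p ^ (n + 1))"
proof -
  define M where "M = n1 + n2"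
  have "sqrt ((2 * p) ^ n1) * sqrt ((2 * p) ^ n2) = sqrt (2 ^ M) * sqrt (p ^ M)"
    unfolding M_def power_mult_distrib real_sqrt_mult power_add by (simp only: mult_ac)
  also have "\<dots> \<le> sqrt (2 ^ (2 * n)) * sqrt (p ^ M)"
    using assms by (intro mult_right_mono real_sqrt_le_mono power_increasing) (auto simp: M_def)
  also have "sqrt (2 ^ (2 * n)) = (2 ^ n :: real)"
    by (simp add: power_even_eq)
  also have "sqrt (p ^ M) = p powr (M / 2)"
  proof -
    have "sqrt (p ^ M) = (p powr M) powr (1 / 2)"
      using assms(1) by (simp add: powr_half_sqrt powr_realpow)
    then show ?thesis
      by (simp add: powr_powr)
  qed
  finally have 1: "sqrt ((2 * p) ^ n1) * sqrt ((2 * p) ^ n2) \<le> 2 ^ n * p powr (M / 2)" .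
  have "real n1 + real n2 + real N = 2 * real n"
    using arg_cong[OF assms(5), of real] by simp
  then have "real (n + 1) \<le> k + M / 2"
    using assms(4) by (simp add: M_def field_simps)
  then have "p powr (k + M / 2) \<le> p powr real (n + 1)"
    using assms(1,2) by (intro powr_mono') auto
  also have "\<dots> = p ^ (n + 1)"
    using assms(1) by (rule powr_realpow)
  finally have 2: "p powr k * p powr (M / 2) \<le> p ^ (n + 1)"
    by (simp add: powr_add)
  have "c * p powr k * (sqrt ((2 * p) ^ n1) * sqrt ((2 * p) ^ n2)) \<le>
    c * p powr k * (2 ^ n * p powr (M / 2))"
    using 1 assms(3) by (intro mult_left_mono) auto
  also have "\<dots> = (c * 2 ^ n) * (p powr k * p powr (M / 2))"
    by (simp add: mult_ac)
  also have "\<dots> \<le> (c * 2 ^ n) * p ^ (n + 1)"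
    using 2 assms(3) by (intro mult_left_mono) auto
  finally show ?thesis
    by (simp add: mult_ac)
qed

text \<open>The conditions under which edges can be removed one after another from the front. They
  pass to sublists, which the induction in \<open>mean_eprod_host_le\<close> relies on.\<close>

definition host ::
  "'v set \<Rightarrow> ('v \<Rightarrow> 'a set) \<Rightarrow> real \<Rightarrow> real \<Rightarrow> real \<Rightarrow> ('v \<times> 'v \<Rightarrow> 'a \<Rightarrow> 'a \<Rightarrow> real)
    \<Rightarrow> ('v \<times> 'v) list \<Rightarrow> bool" where
  "host V X p c k \<nu> K \<longleftrightarrow> majorized V X \<nu> \<nu> K \<and> loopfree_simple K \<and> removable k K \<and>
     (\<forall>e\<in>set K. sjumb (X (fst e)) (X (snd e)) (\<lambda>x y. \<nu> e x y - p) (c * p powr k))"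

lemma host_filter: "host V X p c k \<nu> K \<Longrightarrow> host V X p c k \<nu> (filter P K)"
  by (simp add: host_def majorized_filter loopfree_simple_filter removable_filter)

lemma host_ConsD: "host V X p c k \<nu> (e # K) \<Longrightarrow> host V X p c k \<nu> K"
  by (auto simp: host_def dest: majorized_ConsD)

context
  fixes V :: "'v set" and X :: "'v \<Rightarrow> 'a set" and p c k :: real
  assumes fin: "finite V" "\<And>i. i \<in> V \<Longrightarrow> finite (X i) \<and> X i \<noteq> {}"
    and p: "0 < p" "p \<le> 1" and c: "0 \<le> c" "c \<le> 1"
begin

text \<open>\<open>mean_jumbled_edge\<close> leaves two counts over filtered lists, hence the form
  of \<open>up\<close>. Keeping it as an assumption lets the lemma serve inside the induction that
  establishes it.\<close>

lemma mean_removed_edge: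
  assumes K: "host V X p c k \<nu> (e # K)" "majorized V X w \<nu> K"
    and up: "\<And>P. mean (PiE V X) (eprod \<nu> (filter P K)) \<le> (2 * p) ^ length (filter P K)"
  shows "\<bar>mean (PiE V X) (\<lambda>x. (\<nu> e (x (fst e)) (x (snd e)) - p) * eprod w K x)\<bar>
    \<le> c * (2 ^ length K * p ^ (length K + 1))"
proof -
  obtain a b where e: "e = (a, b)"
    by (cases e)
  have "\<bar>mean (PiE V X) (\<lambda>x. (\<nu> e (x a) (x b) - p) * eprod w K x)\<bar> \<le>
    c * p powr k * (sqrt (mean (PiE V X) (eprod \<nu> (filter (\<lambda>e. b \<notin> ends e) K)))
       * sqrt (mean (PiE V X) (eprod \<nu> (filter (\<lambda>e. a \<notin> ends e) K))))"
    using K c(1) by (intro mean_jumbled_edge[OF fin]) (auto simp: host_def e majorized_def)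
  also have "\<dots> \<le> c * p powr k * (sqrt ((2 * p) ^ length (filter (\<lambda>e. b \<notin> ends e) K))
       * sqrt ((2 * p) ^ length (filter (\<lambda>e. a \<notin> ends e) K)))"
  proof -
    have "0 \<le> mean (PiE V X) (eprod \<nu> (filter P K))" for P
      using K(2) by (intro mean_nonneg eprod_majorant_nonneg[OF majorized_filter])
    then show ?thesis
      using c(1) p by (intro mult_left_mono mult_mono real_sqrt_le_mono up) auto
  qed
  also have "\<dots> \<le> c * (2 ^ length K * p ^ (length K + 1))"
    using K(1) by (intro jumbled_error_bound[OF p c(1) _ length_avoiding_ends])
      (auto simp: host_def e)
  finally show ?thesis
    by (simp add: e)
qed

text \<open>Induction on the length, as the error term leads to filtered lists and not only to the
  tail. Replacing the first edge by \<open>p\<close> gives \<open>p * (2 * p) ^ n\<close>, the error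
  at most \<open>2 ^ n * p ^ (n + 1)\<close> because \<open>c \<le> 1\<close>; the two are equal and
  account for the 2.\<close>

lemma mean_eprod_host_le:
  "host V X p c k \<nu> K \<Longrightarrow> mean (PiE V X) (eprod \<nu> K) \<le> (2 * p) ^ length K"
proof (induction K rule: length_induct)
  case (1 K)
  show ?case
  proof (cases K)
    case Nil
    then show ?thesis
      using finite_nonempty_PiE[of V X] fin by (simp add: mean_const)
  next
    case (Cons e L)
    have up: "mean (PiE V X) (eprod \<nu> (filter P L)) \<le> (2 * p) ^ length (filter P L)" for P
    proof -
      have "host V X p c k \<nu> (filter P L)"
        using 1(2) Cons by (auto dest!: host_ConsD intro: host_filter)
      then show ?thesis
        using 1(1) Cons by (simp add: le_imp_less_Suc)
    qed
    let ?E = "mean (PiE V X) (\<lambda>x. (\<nu> e (x (fst e)) (x (snd e)) - p) * eprod \<nu> L x)"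
    have "?E \<le> c * (2 ^ length L * p ^ (length L + 1))"
      using 1(2) by (intro order_trans[OF abs_ge_self mean_removed_edge] up)
        (auto simp: Cons host_def majorized_def)
    also have "\<dots> \<le> 1 * (2 ^ length L * p ^ (length L + 1))"
      using c p by (intro mult_right_mono) auto
    finally have E: "?E \<le> 1 * (2 ^ length L * p ^ (length L + 1))" .
    have "mean (PiE V X) (eprod \<nu> K) = ?E + p * mean (PiE V X) (eprod \<nu> L)"
      by (simp add: Cons eprod_Cons_eq mean_add[symmetric] mean_cmult[symmetric] left_diff_distrib)
    also have "\<dots> \<le> 1 * (2 ^ length L * p ^ (length L + 1)) + p * (2 * p) ^ length L"
      using E up[of "\<lambda>_. True"] p by (intro add_mono mult_left_mono) auto
    also have "\<dots> = (2 * p) ^ length K"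
      by (simp add: Cons power_mult_distrib)
    finally show ?thesis .
  qed
qed

text \<open>Only the edges of \<open>S\<close> need to be true host edges; those of \<open>T\<close>
  may carry any majorized weights, as they merely act as test functions. This is what allows the
  deviation to sit in \<open>T\<close>.\<close>

lemma mean_remove_edges:
  assumes "host V X p c k \<nu> (S @ T)" "majorized V X w \<nu> (S @ T)" "\<And>e. e \<in> set S \<Longrightarrow> w e = \<nu> e"
  shows "\<bar>mean (PiE V X) (eprod w (S @ T)) - p ^ length S * mean (PiE V X) (eprod w T)\<bar>
    \<le> length S * (c * (2 * p) ^ (length S + length T))"
  using assms
proof (induction S)
  case (Cons e S)
  define n where "n = length S + length T"
  define E where "E = mean (PiE V X) (\<lambda>x. (\<nu> e (x (fst e)) (x (snd e)) - p) * eprod w (S @ T) x)"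
  have h: "host V X p c k \<nu> (S @ T)"
    using Cons.prems(1) by (auto dest: host_ConsD)
  have m: "majorized V X w \<nu> (S @ T)"
    using Cons.prems(2) by (auto dest: majorized_ConsD)
  have IH: "\<bar>mean (PiE V X) (eprod w (S @ T)) - p ^ length S * mean (PiE V X) (eprod w T)\<bar>
    \<le> length S * (c * (2 * p) ^ n)"
    unfolding n_def using Cons.prems(3) by (intro Cons.IH h m) auto
  have "\<bar>E\<bar> \<le> c * (2 ^ length (S @ T) * p ^ (length (S @ T) + 1))"
    unfolding E_def using Cons.prems(1) m
    by (intro mean_removed_edge mean_eprod_host_le host_filter[OF h]) auto
  also have "\<dots> \<le> c * (2 * p) ^ Suc n"
    unfolding power_mult_distrib using p c by (intro mult_left_mono mult_mono) (auto simp: n_def)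
  finally have E: "\<bar>E\<bar> \<le> c * (2 * p) ^ Suc n" .
  have "mean (PiE V X) (eprod w ((e # S) @ T)) = E + p * mean (PiE V X) (eprod w (S @ T))"
    unfolding E_def using Cons.prems(3)
    by (simp add: eprod_Cons_eq mean_add[symmetric] mean_cmult[symmetric] left_diff_distrib)
  then have "\<bar>mean (PiE V X) (eprod w ((e # S) @ T)) - p ^ length (e # S) * mean (PiE V X) (eprod w T)\<bar>
     = \<bar>E + p * (mean (PiE V X) (eprod w (S @ T)) - p ^ length S * mean (PiE V X) (eprod w T))\<bar>"
    by (simp add: algebra_simps)
  also have "\<dots> \<le> \<bar>E\<bar> + p * \<bar>mean (PiE V X) (eprod w (S @ T)) - p ^ length S * mean (PiE V X) (eprod w T)\<bar>"
    using p by (intro order_trans[OF abs_triangle_ineq]) (simp add: abs_mult)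
  also have "\<dots> \<le> c * (2 * p) ^ Suc n + p * (length S * (c * (2 * p) ^ n))"
    using E IH p by (intro add_mono mult_left_mono) auto
  \<comment> \<open>A factor 2 is given away so that the old errors take the same form as the new
    one.\<close>
  also have "\<dots> \<le> c * (2 * p) ^ Suc n + 2 * (p * (length S * (c * (2 * p) ^ n)))"
    using p c by (intro add_left_mono) (simp add: mult_nonneg_nonneg)
  also have "\<dots> = length (e # S) * (c * (2 * p) ^ (length (e # S) + length T))"
    by (simp add: n_def algebra_simps)
  finally show ?case .
qed simp

end

text \<open>Cauchy-Schwarz over all vertices but b: the factor g of S is pulled out at the cost of its
  majorant, and the vertex b together with the edges in L is duplicated.\<close>

lemma mean_duplicate_vertex:
  assumes fin: "finite V" "\<And>i. i \<in> V \<Longrightarrow> finite (X i) \<and> X i \<noteq> {}"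
    and b: "b \<in> V" "b' \<notin> V" "X b' = X b"
    and S: "\<And>e. e \<in> set S \<Longrightarrow> ends e \<subseteq> V - {b}" and L: "\<And>e. e \<in> set L \<Longrightarrow> ends e \<subseteq> V"
    and le: "\<And>x. x \<in> PiE V X \<Longrightarrow> \<bar>eprod g S x\<bar> \<le> eprod \<gamma> S x"
    and \<rho>: "\<rho> = (\<lambda>i. if i = b then b' else i)"
    and w: "\<And>e. e \<in> set L \<Longrightarrow> w (map_prod \<rho> \<rho> e) = w e"
  shows "(mean (PiE V X) (\<lambda>x. eprod g S x * eprod w L x))\<^sup>2 \<le>
    mean (PiE V X) (eprod \<gamma> S) *
    mean (PiE (insert b' V) X) (\<lambda>x. eprod \<gamma> S x * eprod w (L @ map (map_prod \<rho> \<rho>) L) x)"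
proof -
  define V0 where "V0 = V - {b}"
  have V: "V = insert b V0" "finite V0" "b \<notin> V0" "b' \<notin> insert b V0" "b \<noteq> b'"
    using b fin by (auto simp: V0_def)
  have Xb: "finite (X b)" "X b \<noteq> {}"
    using fin(2) b(1) by auto
  have updS: "eprod f S (x(b := y)) = eprod f S x" "eprod f S (x(b' := y)) = eprod f S x" for f x y
    using S b(2) by (intro eprod_upd; fastforce)+
  have updL: "eprod f L (x(b' := y)) = eprod f L x" for f x y
    using L b(2) by (intro eprod_upd) fastforce
  \<comment> \<open>The copied edges read the value at \<open>b'\<close> where the originals read
    the one at \<open>b\<close>.\<close>
  have copy: "eprod w (map (map_prod \<rho> \<rho>) L) (x(b := y, b' := y')) = eprod w L (x(b := y'))"
    for x y y'
    using L w
  proof (induction L)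
    case (Cons e L)
    have "(x(b := y, b' := y')) (\<rho> i) = (x(b := y')) i" if "i \<in> V" for i
      using that b(2) by (auto simp: \<rho>)
    moreover have "fst e \<in> V" "snd e \<in> V"
      using Cons.prems(1)[of e] by auto
    ultimately show ?case
      using Cons.IH Cons.prems by (simp del: fun_upd_apply)
  qed simp
  define m where "m x = mean (X b) (\<lambda>y. eprod w L (x(b := y)))" for x
  have "mean (PiE V X) (\<lambda>x. eprod g S x * eprod w L x) = mean (PiE V0 X) (\<lambda>x. eprod g S x * m x)"
    unfolding V(1) mean_PiE_insert'[OF V(2,3)] m_def by (simp add: updS mean_cmult)
  moreover have "(mean (PiE V0 X) (\<lambda>x. eprod g S x * m x))\<^sup>2
    \<le> mean (PiE V0 X) (eprod \<gamma> S) * mean (PiE V0 X) (\<lambda>x. eprod \<gamma> S x * (m x)\<^sup>2)"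
  proof (rule mean_weighted_Cauchy_Schwarz)
    fix x assume "x \<in> PiE V0 X"
    moreover obtain y where "y \<in> X b"
      using Xb by auto
    ultimately have "x(b := y) \<in> PiE V X"
      unfolding V(1) by (rule PiE_fun_upd[rotated])
    from le[OF this] show "\<bar>eprod g S x\<bar> \<le> eprod \<gamma> S x"
      by (simp add: updS)
  qed
  moreover have "mean (PiE V0 X) (eprod \<gamma> S) = mean (PiE V X) (eprod \<gamma> S)"
    unfolding V(1) using V Xb by (intro mean_PiE_insert_indep[symmetric] updS)
  \<comment> \<open>The square of the average over \<open>b\<close> is a double average; its second
    variable becomes the value at \<open>b'\<close>.\<close>
  moreover have "mean (PiE V0 X) (\<lambda>x. eprod \<gamma> S x * (m x)\<^sup>2) =
    mean (PiE (insert b' V) X) (\<lambda>x. eprod \<gamma> S x * eprod w (L @ map (map_prod \<rho> \<rho>) L) x)"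
    unfolding V(1) mean_PiE_insert'[OF finite.insertI[OF V(2)] V(4)] mean_PiE_insert'[OF V(2,3)] b(3)
    by (simp only: eprod_append copy updL updS m_def mean_power2 mean_cmult)
  ultimately show ?thesis
    by simp
qed

section \<open>The 4-cycle count of a function of small discrepancy\<close>

lemma mean_Times: "mean A (\<lambda>x. mean B (h x)) = mean (A \<times> B) (\<lambda>(x, y). h x y)"
  by (simp add: mean_def sum_divide_distrib[symmetric] sum.cartesian_product card_cartesian_product
      mult.commute)

lemma mean2_weighted_Cauchy_Schwarz:
  assumes "\<And>x y. x \<in> A \<Longrightarrow> y \<in> B \<Longrightarrow> \<bar>r x y\<bar> \<le> \<rho> x y"
  shows "(mean A (\<lambda>x. mean B (\<lambda>y. r x y * h x y)))\<^sup>2 \<le>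
    mean A (\<lambda>x. mean B (\<lambda>y. \<rho> x y)) * mean A (\<lambda>x. mean B (\<lambda>y. \<rho> x y * (h x y)\<^sup>2))"
  using mean_weighted_Cauchy_Schwarz[of "A \<times> B" "\<lambda>(x, y). r x y" "\<lambda>(x, y). \<rho> x y" "\<lambda>(x, y). h x y"]
    assms
  by (auto simp: mean_Times case_prod_unfold)

lemma mean2_Cauchy_Schwarz:
  "\<bar>mean A (\<lambda>x. mean B (\<lambda>y. f x y * g x y))\<bar> \<le>
    sqrt (mean A (\<lambda>x. mean B (\<lambda>y. (f x y)\<^sup>2))) * sqrt (mean A (\<lambda>x. mean B (\<lambda>y. (g x y)\<^sup>2)))"
  using mean_Cauchy_Schwarz[of "A \<times> B" "\<lambda>(x, y). f x y" "\<lambda>(x, y). g x y"]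
  by (simp add: mean_Times case_prod_unfold)

lemma mean2_sqrt_le:
  assumes "finite A" "A \<noteq> {}" "finite B" "B \<noteq> {}" "\<And>x y. x \<in> A \<Longrightarrow> y \<in> B \<Longrightarrow> 0 \<le> f x y"
  shows "mean A (\<lambda>x. mean B (\<lambda>y. sqrt (f x y))) \<le> sqrt (mean A (\<lambda>x. mean B (\<lambda>y. f x y)))"
  using mean_sqrt_le[of "A \<times> B" "\<lambda>(x, y). f x y"] assms
  by (auto simp: mean_Times case_prod_unfold)

lemma mean_swap4:
  "mean A (\<lambda>x. mean B (\<lambda>y. mean C (\<lambda>z. mean D (\<lambda>w. T x y z w)))) =
   mean C (\<lambda>z. mean D (\<lambda>w. mean A (\<lambda>x. mean B (\<lambda>y. T x y z w))))"
proof -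
  have "mean A (\<lambda>x. mean B (\<lambda>y. mean C (\<lambda>z. mean D (\<lambda>w. T x y z w)))) =
      mean A (\<lambda>x. mean C (\<lambda>z. mean B (\<lambda>y. mean D (\<lambda>w. T x y z w))))"
    by (rule mean_cong, rule mean_swap)
  also have "\<dots> = mean C (\<lambda>z. mean A (\<lambda>x. mean B (\<lambda>y. mean D (\<lambda>w. T x y z w))))"
    by (rule mean_swap)
  also have "\<dots> = mean C (\<lambda>z. mean A (\<lambda>x. mean D (\<lambda>w. mean B (\<lambda>y. T x y z w))))"
    by (rule mean_cong, rule mean_cong, rule mean_swap)
  also have "\<dots> = mean C (\<lambda>z. mean D (\<lambda>w. mean A (\<lambda>x. mean B (\<lambda>y. T x y z w))))"
    by (rule mean_cong, rule mean_swap)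
  finally show ?thesis .
qed

text \<open>The codegree \<open>F y y' = mean A (\<lambda>x. f x y * f x y')\<close> is bounded by \<open>2 * p\<^sup>2\<close> outside a
  negligible set of pairs, so that up to a small error one factor of the fourth moment
  \<open>mean F\<^sup>2\<close> can be replaced by a weight with values in [-1, 1]. With bounded weights
  the discrepancy condition applies.\<close>

lemma C4_small:
  fixes A B :: "'a set" and f \<nu> :: "'a \<Rightarrow> 'a \<Rightarrow> real"
  assumes fin: "finite A" "A \<noteq> {}" "finite B" "B \<noteq> {}"
    and p: "0 < p" "p \<le> 1" and s: "0 < s" "s \<le> 1" and k: "2 \<le> k"
    and maj: "\<And>x y. x \<in> A \<Longrightarrow> y \<in> B \<Longrightarrow> \<bar>f x y\<bar> \<le> \<nu> x y"
             "\<And>x y. x \<in> A \<Longrightarrow> y \<in> B \<Longrightarrow> \<nu> x y \<le> 1"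
    and jumb: "sjumb A B (\<lambda>x y. \<nu> x y - p) (s ^ 16 * p powr k)"
    and disc: "\<And>u v. (\<And>x. x \<in> A \<Longrightarrow> \<bar>u x\<bar> \<le> 1) \<Longrightarrow> (\<And>y. y \<in> B \<Longrightarrow> \<bar>v y\<bar> \<le> 1) \<Longrightarrow>
       \<bar>mean A (\<lambda>x. mean B (\<lambda>y. f x y * u x * v y))\<bar> \<le> s ^ 16 * p"
  shows "mean A (\<lambda>x. mean A (\<lambda>x'. mean B (\<lambda>y. mean B (\<lambda>y'. f x y * f x y' * (f x' y * f x' y')))))
    \<le> 80 * s ^ 4 * p ^ 4"
proof -
  \<comment> \<open>The exponent 16 makes the two nested square roots below exact:
    \<open>sqrt c = s ^ 8\<close> and \<open>sqrt (s ^ 8) = s ^ 4\<close>.\<close>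
  define c where "c = s ^ 16"
  have c: "0 \<le> c" "c \<le> 1"
    using s by (simp_all add: c_def power_le_one)
  have c8: "c \<le> s ^ 8" "c = (s ^ 8)\<^sup>2"
    using s by (auto simp: c_def power_mult[symmetric] intro!: power_decreasing)
  have s8: "s ^ 8 \<le> s ^ 4"
    using s by (intro power_decreasing) auto
  have nn: "0 \<le> \<nu> x y" if "x \<in> A" "y \<in> B" for x y
    using maj(1)[OF that] by linarith
  have "p powr k \<le> p powr 2"
    using p k by (intro powr_mono') auto
  then have pk: "p powr k \<le> p\<^sup>2"
    using p by (simp add: powr_numeral)
  have jumb2: "sjumb A B (\<lambda>x y. \<nu> x y - p) (c * p\<^sup>2)"
    using pk c by (intro sjumb_mono[OF jumb]) (simp add: c_def mult_left_mono)

  \<comment> \<open>Vertices 0 and 1 range over \<open>A\<close>, 2 and 3 over \<open>B\<close>.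
    Both moments of the codegree are then counts of small graphs in \<open>\<nu>\<close>, a path
    with two edges and a 4-cycle. In the latter the first edge meets two later ones, which is why
    \<open>k\<close> must be at least 2.\<close>
  define X :: "nat \<Rightarrow> 'a set" where "X i = (if i < 2 then A else B)" for i
  define N :: "nat \<times> nat \<Rightarrow> 'a \<Rightarrow> 'a \<Rightarrow> real" where "N e = \<nu>" for e
  have X: "X 0 = A" "X 1 = A" "X 2 = B" "X 3 = B"
    by (simp_all add: X_def)
  have finX: "finite (X i) \<and> X i \<noteq> {}" for i
    using fin by (simp add: X_def)
  define \<Phi> where "\<Phi> y y' = mean A (\<lambda>x. \<nu> x y * \<nu> x y')" for y y'
  have sing: "mean {x} h = h x" for x :: 'z and h
    by (simp add: mean_def)
  have X_simps: "X (Suc 0) = A"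
    by (simp add: X_def)
  let ?K2 = "[(0, 2), (0, 3)] :: (nat \<times> nat) list"
  let ?K4 = "[(0, 2), (0, 3), (1, 2), (1, 3)] :: (nat \<times> nat) list"
  have host2: "host {0, 2, 3} X p c k N ?K2"
    using nn maj k jumb c
    by (auto simp: host_def majorized_def nb_Cons X X_simps N_def doubleton_eq_iff loopfree_simple_def c_def)
  have host4: "host {0, 1, 2, 3} X p c k N ?K4"
    using nn maj k jumb c
    by (auto simp: host_def majorized_def nb_Cons X X_simps N_def doubleton_eq_iff loopfree_simple_def c_def)
  have K2: "mean (PiE {0, 2, 3} X) (eprod N ?K2) = mean B (\<lambda>y. mean B (\<lambda>y'. \<Phi> y y'))"
  proof -
    have "mean (PiE {0, 2, 3} X) (eprod N ?K2) = mean A (\<lambda>x. mean B (\<lambda>y. mean B (\<lambda>y'. \<nu> x y * \<nu> x y')))"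
      by (simp add: mean_PiE_insert sing X N_def)
    also have "\<dots> = mean B (\<lambda>y. mean A (\<lambda>x. mean B (\<lambda>y'. \<nu> x y * \<nu> x y')))"
      by (rule mean_swap)
    also have "\<dots> = mean B (\<lambda>y. mean B (\<lambda>y'. \<Phi> y y'))"
      unfolding \<Phi>_def by (rule mean_cong, rule mean_swap)
    finally show ?thesis .
  qed
  have K4: "mean (PiE {0, 1, 2, 3} X) (eprod N ?K4) = mean B (\<lambda>y. mean B (\<lambda>y'. (\<Phi> y y')\<^sup>2))"
  proof -
    have "mean (PiE {0, 1, 2, 3} X) (eprod N ?K4) =
      mean A (\<lambda>x. mean A (\<lambda>x'. mean B (\<lambda>y. mean B (\<lambda>y'. \<nu> x y * \<nu> x y' * (\<nu> x' y * \<nu> x' y')))))"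
      by (simp add: mean_PiE_insert sing X X_simps N_def mult.assoc)
    also have "\<dots> = mean B (\<lambda>y. mean B (\<lambda>y'. (\<Phi> y y')\<^sup>2))"
      unfolding \<Phi>_def mean_power2 by (rule mean_swap4)
    finally show ?thesis .
  qed
  have eNil: "eprod N [] = (\<lambda>_. 1)"
    by (rule ext) simp
  have maj2: "majorized {0, 2, 3} X N N ?K2" and maj4: "majorized {0, 1, 2, 3} X N N ?K4"
    using host2 host4 unfolding host_def by blast+
  have le2: "mean (PiE {0, 2, 3} X) (eprod N ?K2) \<le> (2 * p) ^ length ?K2"
    by (rule mean_eprod_host_le[OF _ _ p c host2]) (use finX in simp_all)
  have le4: "mean (PiE {0, 1, 2, 3} X) (eprod N ?K4) \<le> (2 * p) ^ length ?K4"
    by (rule mean_eprod_host_le[OF _ _ p c host4]) (use finX in simp_all)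
  have len4: "length ?K4 = 4" and pw4: "(2 * p) ^ 4 = 16 * p ^ 4"
    by (simp_all add: power_mult_distrib)
  have \<Phi>_le: "mean B (\<lambda>y. mean B (\<lambda>y'. \<Phi> y y')) \<le> 4 * p\<^sup>2"
    using le2 unfolding K2
    by (simp add: power_mult_distrib numeral_2_eq_2)
  have \<Phi>_eq: "\<bar>mean B (\<lambda>y. mean B (\<lambda>y'. \<Phi> y y')) - p\<^sup>2\<bar> \<le> 8 * c * p\<^sup>2"
  proof -
    have "\<bar>mean (PiE {0, 2, 3} X) (eprod N (?K2 @ [])) - p ^ length ?K2 * mean (PiE {0, 2, 3} X) (eprod N [])\<bar>
        \<le> length ?K2 * (c * (2 * p) ^ (length ?K2 + length ([] :: (nat \<times> nat) list)))"
      by (rule mean_remove_edges[OF _ _ p c]) (use finX host2 maj2 in simp_all)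
    moreover have "mean (PiE {0, 2, 3} X) (eprod N []) = 1"
      using finite_nonempty_PiE[of "{0, 2, 3}" X] finX by (simp add: eNil mean_const)
    ultimately show ?thesis
      unfolding append_Nil2 K2 by (simp add: power_mult_distrib power2_eq_square)
  qed
  have \<Phi>2_le: "mean B (\<lambda>y. mean B (\<lambda>y'. (\<Phi> y y')\<^sup>2)) \<le> 16 * p ^ 4"
    using le4 unfolding K4 len4 pw4
    by simp
  have \<Phi>2_eq: "\<bar>mean B (\<lambda>y. mean B (\<lambda>y'. (\<Phi> y y')\<^sup>2)) - p ^ 4\<bar> \<le> 64 * c * p ^ 4"
  proof -
    have "\<bar>mean (PiE {0, 1, 2, 3} X) (eprod N (?K4 @ [])) - p ^ length ?K4 * mean (PiE {0, 1, 2, 3} X) (eprod N [])\<bar>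
        \<le> length ?K4 * (c * (2 * p) ^ (length ?K4 + length ([] :: (nat \<times> nat) list)))"
      by (rule mean_remove_edges[OF _ _ p c]) (use finX host4 maj4 in simp_all)
    moreover have "mean (PiE {0, 1, 2, 3} X) (eprod N []) = 1"
      using finite_nonempty_PiE[of "{0, 1, 2, 3}" X] finX by (simp add: eNil mean_const)
    ultimately show ?thesis
      unfolding append_Nil2 K4 list.size(3) add_0_right len4 pw4 by simp
  qed
  \<comment> \<open>First and second moment agree with those of the constant
    \<open>p\<^sup>2\<close> up to errors of order \<open>c\<close>; the 80 is 64 + 2 * 8.\<close>
  have \<Phi>_var: "mean B (\<lambda>y. mean B (\<lambda>y'. (\<Phi> y y' - p\<^sup>2)\<^sup>2)) \<le> 80 * c * p ^ 4"
  proof -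
    have "mean B (\<lambda>y. mean B (\<lambda>y'. (\<Phi> y y' - p\<^sup>2)\<^sup>2)) =
      mean B (\<lambda>y. mean B (\<lambda>y'. (\<Phi> y y')\<^sup>2 - 2 * p\<^sup>2 * \<Phi> y y' + p ^ 4))"
      by (simp add: power2_diff algebra_simps flip: power_mult)
    also have "\<dots> = mean B (\<lambda>y. mean B (\<lambda>y'. (\<Phi> y y')\<^sup>2)) - 2 * p\<^sup>2 * mean B (\<lambda>y. mean B (\<lambda>y'. \<Phi> y y')) + p ^ 4"
      using fin by (simp add: mean_add mean_diff mean_cmult mean_const)
    also have "\<dots> = (mean B (\<lambda>y. mean B (\<lambda>y'. (\<Phi> y y')\<^sup>2)) - p ^ 4)
        + 2 * p\<^sup>2 * (p\<^sup>2 - mean B (\<lambda>y. mean B (\<lambda>y'. \<Phi> y y')))"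
      by (simp add: algebra_simps flip: power_add)
    also have "\<dots> \<le> 64 * c * p ^ 4 + 2 * p\<^sup>2 * (8 * c * p\<^sup>2)"
      using \<Phi>_eq \<Phi>2_eq by (intro add_mono mult_left_mono) auto
    also have "\<dots> = 80 * c * p ^ 4"
      by (simp add: algebra_simps flip: power_add)
    finally show ?thesis .
  qed

  define d where "d x = mean B (\<nu> x)" for x
  have d_nn: "0 \<le> d x" if "x \<in> A" for x
    unfolding d_def using nn that by (intro mean_nonneg)
  have d_sq: "mean A (\<lambda>x. (d x)\<^sup>2) \<le> 4 * p\<^sup>2"
  proof -
    have "mean A (\<lambda>x. (d x)\<^sup>2) = mean A (\<lambda>x. mean B (\<lambda>y. mean B (\<lambda>y'. \<nu> x y * \<nu> x y')))"
      unfolding d_def mean_power2 ..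
    also have "\<dots> = mean B (\<lambda>y. mean A (\<lambda>x. mean B (\<lambda>y'. \<nu> x y * \<nu> x y')))"
      by (rule mean_swap)
    also have "\<dots> = mean B (\<lambda>y. mean B (\<lambda>y'. \<Phi> y y'))"
      unfolding \<Phi>_def by (rule mean_cong, rule mean_swap)
    finally show ?thesis
      using \<Phi>_le by simp
  qed
  have d_abs: "\<bar>d x - p\<bar> \<le> 1" if "x \<in> A" for x
  proof -
    have "d x \<le> 1"
      using mean_abs_le[OF fin(3,4), of "\<nu> x" 1] nn maj(2) that by (simp add: d_def)
    then show ?thesis
      using d_nn[OF that] p by simp
  qed
  \<comment> \<open>The degree deviation serves as its own test function, so jumbledness bounds its
    second moment.\<close>
  have d_var: "mean A (\<lambda>x. (d x - p)\<^sup>2) \<le> c * p\<^sup>2"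
  proof -
    have "mean A (\<lambda>x. (d x - p)\<^sup>2) = mean A (\<lambda>x. mean B (\<lambda>y. (\<nu> x y - p) * (d x - p) * 1))"
      using fin by (simp add: mean_multc mean_diff mean_const d_def power2_eq_square)
    also have "\<dots> \<le> c * p\<^sup>2 * sqrt (mean A (\<lambda>x. \<bar>d x - p\<bar>))"
      using sjumb_abs_le[OF jumb2 _ fin, of "\<lambda>x. d x - p" "\<lambda>_. 1"] c d_abs by simp
    also have "\<dots> \<le> c * p\<^sup>2 * 1"
    proof -
      have "mean A (\<lambda>x. \<bar>d x - p\<bar>) \<le> 1"
        using mean_abs_le[OF fin(1,2), of "\<lambda>x. \<bar>d x - p\<bar>" 1] d_abs by simp
      then show ?thesis
        using c by (intro mult_left_mono) auto
    qed
    finally show ?thesis by simp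
  qed
  have \<nu>_mean: "mean A (\<lambda>x. mean B (\<lambda>y. \<nu> x y)) \<le> 2 * p"
  proof -
    have "(mean A (\<lambda>x. 1 * d x))\<^sup>2 \<le> mean A (\<lambda>_. 1) * mean A (\<lambda>x. 1 * (d x)\<^sup>2)"
      by (rule mean_weighted_Cauchy_Schwarz) simp
    then have "(mean A d)\<^sup>2 \<le> mean A (\<lambda>x. (d x)\<^sup>2)"
      unfolding mean_const[OF fin(1,2)] mult_1 .
    also have "\<dots> \<le> (2 * p)\<^sup>2"
      using d_sq by (simp only: power_mult_distrib) simp
    finally have "mean A d \<le> 2 * p"
      by (rule power2_le_imp_le) (use p in simp)
    moreover have "mean A (\<lambda>x. mean B (\<lambda>y. \<nu> x y)) = mean A d"
      by (rule mean_cong) (simp add: d_def)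
    ultimately show ?thesis
      by simp
  qed

  \<comment> \<open>Where \<open>d x \<le> 2 * p\<close>, one of the two factors of the square is at
    most \<open>2 * p\<close>. Elsewhere \<open>d x \<le> 2 * \<bar>d x - p\<bar>\<close>, and the
    small variance of the degrees takes over.\<close>
  have square_small: "mean A (\<lambda>x. (\<phi> x)\<^sup>2) \<le> 6 * s ^ 8 * p\<^sup>2"
    if \<phi>: "\<And>x. x \<in> A \<Longrightarrow> \<bar>\<phi> x\<bar> \<le> d x" "mean A (\<lambda>x. \<bar>\<phi> x\<bar>) \<le> c * p" for \<phi>
  proof -
    have "mean A (\<lambda>x. (\<phi> x)\<^sup>2) \<le> mean A (\<lambda>x. 2 * p * \<bar>\<phi> x\<bar> + 2 * (d x * \<bar>d x - p\<bar>))"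
    proof (rule mean_mono)
      fix x assume x: "x \<in> A"
      have "(\<phi> x)\<^sup>2 = \<bar>\<phi> x\<bar> * \<bar>\<phi> x\<bar>"
        by (simp add: power2_eq_square)
      also have "\<dots> \<le> 2 * p * \<bar>\<phi> x\<bar> + 2 * (d x * \<bar>d x - p\<bar>)"
      proof (cases "d x \<le> 2 * p")
        case True
        then have "\<bar>\<phi> x\<bar> * \<bar>\<phi> x\<bar> \<le> 2 * p * \<bar>\<phi> x\<bar>"
          using \<phi>(1)[OF x] by (intro mult_right_mono) auto
        then show ?thesis
          using d_nn[OF x] by (simp add: add_increasing2)
      next
        case False
        have "\<bar>\<phi> x\<bar> * \<bar>\<phi> x\<bar> \<le> d x * (2 * \<bar>d x - p\<bar>)"
          using \<phi>(1)[OF x] d_nn[OF x] False by (intro mult_mono) auto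
        then show ?thesis
          using p by (simp add: add_increasing)
      qed
      finally show "(\<phi> x)\<^sup>2 \<le> 2 * p * \<bar>\<phi> x\<bar> + 2 * (d x * \<bar>d x - p\<bar>)" .
    qed
    also have "\<dots> = 2 * p * mean A (\<lambda>x. \<bar>\<phi> x\<bar>) + 2 * mean A (\<lambda>x. d x * \<bar>d x - p\<bar>)"
      by (simp add: mean_add mean_cmult)
    also have "\<dots> \<le> 2 * p * (c * p) + 2 * (sqrt (4 * p\<^sup>2) * sqrt (c * p\<^sup>2))"
    proof -
      have "mean A (\<lambda>x. d x * \<bar>d x - p\<bar>) \<le>
          sqrt (mean A (\<lambda>x. (d x)\<^sup>2)) * sqrt (mean A (\<lambda>x. \<bar>d x - p\<bar>\<^sup>2))"
        using mean_Cauchy_Schwarz[of A d "\<lambda>x. \<bar>d x - p\<bar>"] by linarith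
      also have "\<dots> \<le> sqrt (4 * p\<^sup>2) * sqrt (c * p\<^sup>2)"
        using d_sq d_var c by (intro mult_mono) (auto intro!: mean_nonneg)
      finally show ?thesis
        using \<phi>(2) p by (intro add_mono mult_left_mono) auto
    qed
    also have "\<dots> = 2 * c * p\<^sup>2 + 4 * s ^ 8 * p\<^sup>2"
    proof -
      have "sqrt (4 * p\<^sup>2) = 2 * p"
        using p by (simp add: real_sqrt_mult)
      moreover have "sqrt (c * p\<^sup>2) = s ^ 8 * p"
        unfolding c8(2) real_sqrt_mult real_sqrt_abs using s p by simp
      ultimately show ?thesis
        by (simp add: power2_eq_square)
    qed
    also have "\<dots> \<le> 2 * s ^ 8 * p\<^sup>2 + 4 * s ^ 8 * p\<^sup>2"
      using c8 by (intro add_mono mult_right_mono mult_left_mono) auto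
    finally show ?thesis by (simp add: algebra_simps)
  qed

  define F where "F y y' = mean A (\<lambda>x. f x y * f x y')" for y y'
  have ff: "\<bar>f x y * f x y'\<bar> \<le> \<nu> x y * \<nu> x y'" if "x \<in> A" "y \<in> B" "y' \<in> B" for x y y'
    unfolding abs_mult using maj(1) nn that by (intro mult_mono) auto
  have \<nu>\<nu>: "\<nu> x y * \<nu> x y' \<le> 1" if "x \<in> A" "y \<in> B" "y' \<in> B" for x y y'
    using maj(2) nn that by (intro mult_le_one) auto
  have F_le: "\<bar>F y y'\<bar> \<le> \<Phi> y y'" if "y \<in> B" "y' \<in> B" for y y'
    unfolding F_def \<Phi>_def using that ff by (intro order_trans[OF mean_abs] mean_mono)
  have \<Phi>_nn: "0 \<le> \<Phi> y y'" if "y \<in> B" "y' \<in> B" for y y'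
    using F_le[OF that] by linarith

  \<comment> \<open>Cauchy-Schwarz over the pairs \<open>(x, y')\<close> turns \<open>f x y'\<close>
    into \<open>\<nu> x y'\<close>, which acts like \<open>p\<close> up to the error
    \<open>err\<close>. There remains the average of the square of \<open>\<phi>\<close>, to which
    \<open>square_small\<close> applies.\<close>
  have bounded_weight: "\<bar>mean B (\<lambda>y. mean B (\<lambda>y'. F y y' * g y y'))\<bar> \<le> 4 * s ^ 4 * p\<^sup>2"
    if g: "\<And>y y'. y \<in> B \<Longrightarrow> y' \<in> B \<Longrightarrow> \<bar>g y y'\<bar> \<le> 1" for g
  proof -
    define \<phi> where "\<phi> y' x = mean B (\<lambda>y. f x y * g y y')" for y' x
    have \<phi>_le: "\<bar>\<phi> y' x\<bar> \<le> d x" if "x \<in> A" "y' \<in> B" for x y'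
    proof -
      have "\<bar>f x y * g y y'\<bar> \<le> \<nu> x y" if "y \<in> B" for y
        using mult_mono[OF maj(1)[OF \<open>x \<in> A\<close> that] g[OF that \<open>y' \<in> B\<close>]] nn \<open>x \<in> A\<close> that
        by (simp add: abs_mult)
      then show ?thesis
        unfolding \<phi>_def d_def by (intro order_trans[OF mean_abs] mean_mono)
    qed
    have \<phi>_mean: "mean A (\<lambda>x. \<bar>\<phi> y' x\<bar>) \<le> c * p" if "y' \<in> B" for y'
    proof -
      \<comment> \<open>Discrepancy is tested with the sign of \<open>\<phi> y'\<close> on
        \<open>A\<close>, which turns the average into that of the absolute value.\<close>
      have "mean A (\<lambda>x. \<bar>\<phi> y' x\<bar>) = mean A (\<lambda>x. mean B (\<lambda>y. f x y * sgn (\<phi> y' x) * g y y'))"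
      proof (rule mean_cong)
        fix x
        have "\<bar>\<phi> y' x\<bar> = mean B (\<lambda>y. f x y * g y y') * sgn (\<phi> y' x)"
          unfolding \<phi>_def by (simp add: abs_sgn)
        also have "\<dots> = mean B (\<lambda>y. f x y * g y y' * sgn (\<phi> y' x))"
          by (simp only: mean_multc)
        also have "\<dots> = mean B (\<lambda>y. f x y * sgn (\<phi> y' x) * g y y')"
          by (simp only: mult_ac)
        finally show "\<bar>\<phi> y' x\<bar> = mean B (\<lambda>y. f x y * sgn (\<phi> y' x) * g y y')" .
      qed
      also have "\<dots> \<le> c * p"
        using disc[of "\<lambda>x. sgn (\<phi> y' x)" "\<lambda>y. g y y'"] g that
        by (simp add: abs_sgn_eq c_def)
      finally show ?thesis .
    qed
    have sq: "mean A (\<lambda>x. mean B (\<lambda>y'. (\<phi> y' x)\<^sup>2)) \<le> 6 * s ^ 8 * p\<^sup>2"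
    proof -
      have "mean A (\<lambda>x. mean B (\<lambda>y'. (\<phi> y' x)\<^sup>2)) = mean B (\<lambda>y'. mean A (\<lambda>x. (\<phi> y' x)\<^sup>2))"
        by (rule mean_swap)
      also have "\<dots> \<le> mean B (\<lambda>y'. 6 * s ^ 8 * p\<^sup>2)"
        using \<phi>_le \<phi>_mean by (intro mean_mono square_small)
      finally show ?thesis
        using fin by (simp add: mean_const)
    qed
    \<comment> \<open>Expanding the square into \<open>y1\<close> and \<open>y2\<close> and fixing
      these, the weight on \<open>(x, y')\<close> becomes a function of \<open>x\<close> times a
      function of \<open>y'\<close>, as jumbledness requires.\<close>
    have err: "mean A (\<lambda>x. mean B (\<lambda>y'. (\<nu> x y' - p) * (\<phi> y' x)\<^sup>2)) \<le> 2 * c * p ^ 3"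
    proof -
      have "mean A (\<lambda>x. mean B (\<lambda>y'. (\<nu> x y' - p) * (\<phi> y' x)\<^sup>2)) =
        mean A (\<lambda>x. mean B (\<lambda>y'. mean B (\<lambda>y1. mean B (\<lambda>y2.
          (\<nu> x y' - p) * (f x y1 * f x y2) * (g y1 y' * g y2 y')))))"
        unfolding \<phi>_def mean_power2 mean_cmult[symmetric]
        by (intro mean_cong) (simp only: mult_ac)
      also have "\<dots> = mean B (\<lambda>y1. mean B (\<lambda>y2. mean A (\<lambda>x. mean B (\<lambda>y'.
          (\<nu> x y' - p) * (f x y1 * f x y2) * (g y1 y' * g y2 y')))))"
        by (rule mean_swap4)
      also have "\<dots> \<le> mean B (\<lambda>y1. mean B (\<lambda>y2. c * p\<^sup>2 * sqrt (\<Phi> y1 y2)))"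
      proof (intro mean_mono)
        fix y1 y2 assume y: "y1 \<in> B" "y2 \<in> B"
        have "mean A (\<lambda>x. mean B (\<lambda>y'. (\<nu> x y' - p) * (f x y1 * f x y2) * (g y1 y' * g y2 y')))
          \<le> c * p\<^sup>2 * sqrt (mean A (\<lambda>x. \<bar>f x y1 * f x y2\<bar>))"
        proof (rule order_trans[OF abs_ge_self sjumb_abs_le[OF jumb2 _ fin]])
          show "\<bar>f x y1 * f x y2\<bar> \<le> 1" if "x \<in> A" for x
            using ff[OF that y] \<nu>\<nu>[OF that y] by linarith
          show "\<bar>g y1 y' * g y2 y'\<bar> \<le> 1" if "y' \<in> B" for y'
            unfolding abs_mult using g y that by (intro mult_le_one) auto
        qed (use c in simp)
        also have "\<dots> \<le> c * p\<^sup>2 * sqrt (\<Phi> y1 y2)"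
          unfolding \<Phi>_def using c ff y by (intro mult_left_mono real_sqrt_le_mono mean_mono) auto
        finally show "mean A (\<lambda>x. mean B (\<lambda>y'. (\<nu> x y' - p) * (f x y1 * f x y2) * (g y1 y' * g y2 y')))
          \<le> c * p\<^sup>2 * sqrt (\<Phi> y1 y2)" .
      qed
      also have "\<dots> = c * p\<^sup>2 * mean B (\<lambda>y1. mean B (\<lambda>y2. sqrt (\<Phi> y1 y2)))"
        by (simp add: mean_cmult)
      also have "\<dots> \<le> c * p\<^sup>2 * sqrt (4 * p\<^sup>2)"
        using c \<Phi>_nn order_trans[OF mean2_sqrt_le[OF fin(3,4,3,4), of \<Phi>] real_sqrt_le_mono[OF \<Phi>_le]]
        by (intro mult_left_mono) auto
      also have "\<dots> = 2 * c * p ^ 3"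
        using p by (simp add: real_sqrt_mult power2_eq_square power3_eq_cube)
      finally show ?thesis .
    qed
    have "mean B (\<lambda>y. mean B (\<lambda>y'. F y y' * g y y')) =
      mean B (\<lambda>y. mean B (\<lambda>y'. mean A (\<lambda>x. f x y' * (f x y * g y y'))))"
      unfolding F_def mean_multc[symmetric] by (simp only: mult_ac)
    also have "\<dots> = mean B (\<lambda>y. mean A (\<lambda>x. mean B (\<lambda>y'. f x y' * (f x y * g y y'))))"
      by (rule mean_cong, rule mean_swap)
    also have "\<dots> = mean A (\<lambda>x. mean B (\<lambda>y. mean B (\<lambda>y'. f x y' * (f x y * g y y'))))"
      by (rule mean_swap)
    also have "\<dots> = mean A (\<lambda>x. mean B (\<lambda>y'. mean B (\<lambda>y. f x y' * (f x y * g y y'))))"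
      by (rule mean_cong, rule mean_swap)
    also have "\<dots> = mean A (\<lambda>x. mean B (\<lambda>y'. f x y' * \<phi> y' x))"
      by (simp only: mean_cmult \<phi>_def)
    finally have "(mean B (\<lambda>y. mean B (\<lambda>y'. F y y' * g y y')))\<^sup>2 \<le>
      mean A (\<lambda>x. mean B (\<lambda>y'. \<nu> x y')) * mean A (\<lambda>x. mean B (\<lambda>y'. \<nu> x y' * (\<phi> y' x)\<^sup>2))"
      using maj(1) by (simp add: mean2_weighted_Cauchy_Schwarz)
    also have "mean A (\<lambda>x. mean B (\<lambda>y'. \<nu> x y' * (\<phi> y' x)\<^sup>2)) =
      mean A (\<lambda>x. mean B (\<lambda>y'. (\<nu> x y' - p) * (\<phi> y' x)\<^sup>2)) + p * mean A (\<lambda>x. mean B (\<lambda>y'. (\<phi> y' x)\<^sup>2))"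
      by (simp add: mean_add[symmetric] mean_cmult[symmetric] left_diff_distrib)
    also have "mean A (\<lambda>x. mean B (\<lambda>y'. \<nu> x y')) * \<dots> \<le> (2 * p) * (2 * c * p ^ 3 + p * (6 * s ^ 8 * p\<^sup>2))"
    proof (intro mult_mono add_mono mult_left_mono \<nu>_mean err sq)
      have "0 \<le> mean A (\<lambda>x. mean B (\<lambda>y'. \<nu> x y' * (\<phi> y' x)\<^sup>2))"
        using nn by (intro mean_nonneg mult_nonneg_nonneg) auto
      then show "0 \<le> mean A (\<lambda>x. mean B (\<lambda>y'. (\<nu> x y' - p) * (\<phi> y' x)\<^sup>2)) + p * mean A (\<lambda>x. mean B (\<lambda>y'. (\<phi> y' x)\<^sup>2))"
        by (simp add: mean_add[symmetric] mean_cmult[symmetric] left_diff_distrib)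
    qed (use p in \<open>auto intro!: mean_nonneg\<close>)
    also have "\<dots> = 4 * p ^ 4 * c + 12 * p ^ 4 * s ^ 8"
      by (simp add: algebra_simps power2_eq_square power3_eq_cube power4_eq_xxxx)
    also have "\<dots> \<le> 4 * p ^ 4 * s ^ 8 + 12 * p ^ 4 * s ^ 8"
      using c8 by (intro add_mono mult_left_mono) auto
    also have "\<dots> = (4 * s ^ 4 * p\<^sup>2)\<^sup>2"
      by (simp add: power_mult_distrib flip: power_mult)
    finally show ?thesis
      by (rule iffD1[OF power2_le_iff_abs_le, rotated]) (use s in simp)
  qed

  \<comment> \<open>Truncation at \<open>2 * p\<^sup>2\<close>, twice the typical codegree. It has
    an effect only where \<open>\<Phi>\<close> exceeds \<open>2 * p\<^sup>2\<close>, and there the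
    excess is controlled by the deviation of \<open>\<Phi>\<close> from
    \<open>p\<^sup>2\<close>.\<close>
  define g where "g y y' = max (- 1) (min 1 (F y y' / (2 * p\<^sup>2)))" for y y'
  have trunc: "\<bar>F y y' - 2 * p\<^sup>2 * g y y'\<bar> \<le> 2 * \<bar>\<Phi> y y' - p\<^sup>2\<bar>" if "y \<in> B" "y' \<in> B" for y y'
  proof -
    define t where "t = F y y' / (2 * p\<^sup>2)"
    have F: "F y y' = 2 * p\<^sup>2 * t"
      using p by (simp add: t_def)
    have "\<bar>t - g y y'\<bar> \<le> max 0 (\<bar>t\<bar> - 1)"
      unfolding g_def t_def[symmetric] by linarith
    then have "2 * p\<^sup>2 * \<bar>t - g y y'\<bar> \<le> 2 * p\<^sup>2 * max 0 (\<bar>t\<bar> - 1)"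
      by (rule mult_left_mono) simp
    also have "2 * p\<^sup>2 * max 0 (\<bar>t\<bar> - 1) = max 0 (\<bar>F y y'\<bar> - 2 * p\<^sup>2)"
      unfolding F by (simp add: max_mult_distrib_left abs_mult right_diff_distrib)
    also have "\<dots> \<le> 2 * \<bar>\<Phi> y y' - p\<^sup>2\<bar>"
    proof -
      have "\<bar>F y y'\<bar> - 2 * p\<^sup>2 \<le> 2 * \<bar>\<Phi> y y' - p\<^sup>2\<bar>"
        using F_le[OF that] by argo
      then show ?thesis
        by simp
    qed
    finally show ?thesis
      unfolding F by (simp add: right_diff_distrib[symmetric] abs_mult)
  qed
  have "mean A (\<lambda>x. mean A (\<lambda>x'. mean B (\<lambda>y. mean B (\<lambda>y'. f x y * f x y' * (f x' y * f x' y'))))) =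
    mean B (\<lambda>y. mean B (\<lambda>y'. (F y y')\<^sup>2))"
    unfolding F_def mean_power2 by (rule mean_swap4)
  \<comment> \<open>One factor \<open>F\<close> is split into its truncation, a bounded weight, and
    the excess, which Cauchy-Schwarz compares with the variance of \<open>\<Phi>\<close>.\<close>
  also have "\<dots> = 2 * p\<^sup>2 * mean B (\<lambda>y. mean B (\<lambda>y'. F y y' * g y y'))
      + mean B (\<lambda>y. mean B (\<lambda>y'. F y y' * (F y y' - 2 * p\<^sup>2 * g y y')))"
    unfolding mean_cmult[symmetric] mean_add[symmetric]
    by (simp add: algebra_simps power2_eq_square)
  also have "\<dots> \<le> 2 * p\<^sup>2 * (4 * s ^ 4 * p\<^sup>2) + 2 * (sqrt (16 * p ^ 4) * sqrt (80 * c * p ^ 4))"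
  proof (intro add_mono mult_left_mono)
    show "mean B (\<lambda>y. mean B (\<lambda>y'. F y y' * g y y')) \<le> 4 * s ^ 4 * p\<^sup>2"
      using bounded_weight[of g] by (simp add: g_def abs_le_iff)
    have "mean B (\<lambda>y. mean B (\<lambda>y'. F y y' * (F y y' - 2 * p\<^sup>2 * g y y'))) \<le>
      mean B (\<lambda>y. mean B (\<lambda>y'. 2 * (\<Phi> y y' * \<bar>\<Phi> y y' - p\<^sup>2\<bar>)))"
    proof (intro mean_mono)
      fix y y' assume y: "y \<in> B" "y' \<in> B"
      have "\<bar>F y y' * (F y y' - 2 * p\<^sup>2 * g y y')\<bar> \<le> \<Phi> y y' * (2 * \<bar>\<Phi> y y' - p\<^sup>2\<bar>)"
        unfolding abs_mult using F_le[OF y] trunc[OF y] \<Phi>_nn[OF y] by (intro mult_mono) auto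
      then show "F y y' * (F y y' - 2 * p\<^sup>2 * g y y') \<le> 2 * (\<Phi> y y' * \<bar>\<Phi> y y' - p\<^sup>2\<bar>)"
        by linarith
    qed
    also have "\<dots> = 2 * mean B (\<lambda>y. mean B (\<lambda>y'. \<Phi> y y' * \<bar>\<Phi> y y' - p\<^sup>2\<bar>))"
      by (simp add: mean_cmult)
    also have "\<dots> \<le> 2 * (sqrt (mean B (\<lambda>y. mean B (\<lambda>y'. (\<Phi> y y')\<^sup>2)))
        * sqrt (mean B (\<lambda>y. mean B (\<lambda>y'. \<bar>\<Phi> y y' - p\<^sup>2\<bar>\<^sup>2))))"
      using mean2_Cauchy_Schwarz[of B B \<Phi> "\<lambda>y y'. \<bar>\<Phi> y y' - p\<^sup>2\<bar>"] by linarith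
    also have "\<dots> \<le> 2 * (sqrt (16 * p ^ 4) * sqrt (80 * c * p ^ 4))"
      using \<Phi>2_le \<Phi>_var c by (intro mult_left_mono mult_mono) (auto intro!: mean_nonneg)
    finally show "mean B (\<lambda>y. mean B (\<lambda>y'. F y y' * (F y y' - 2 * p\<^sup>2 * g y y')))
      \<le> 2 * (sqrt (16 * p ^ 4) * sqrt (80 * c * p ^ 4))" .
  qed (use p in auto)
  \<comment> \<open>Rounding 80 up to 81 makes the root 9, so the second coefficient is 2 * 4 * 9 =
    72.\<close>
  also have "\<dots> \<le> 8 * s ^ 4 * p ^ 4 + 72 * s ^ 8 * p ^ 4"
  proof -
    have "16 * p ^ 4 = (4 * p\<^sup>2)\<^sup>2"
      by (simp add: power_mult_distrib flip: power_mult)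
    then have "sqrt (16 * p ^ 4) \<le> 4 * p\<^sup>2"
      by (intro real_le_lsqrt) simp_all
    moreover have "80 * c * p ^ 4 \<le> (9 * s ^ 8 * p\<^sup>2)\<^sup>2"
    proof -
      have "80 * (c * p ^ 4) \<le> 81 * (c * p ^ 4)"
        using c p by (intro mult_right_mono) auto
      also have "\<dots> = (9 * s ^ 8 * p\<^sup>2)\<^sup>2"
        unfolding c8(2) by (simp add: power_mult_distrib flip: power_mult)
      finally show ?thesis
        by simp
    qed
    then have "sqrt (80 * c * p ^ 4) \<le> 9 * s ^ 8 * p\<^sup>2"
      using s by (intro real_le_lsqrt) auto
    ultimately have "sqrt (16 * p ^ 4) * sqrt (80 * c * p ^ 4) \<le> 4 * p\<^sup>2 * (9 * s ^ 8 * p\<^sup>2)"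
      using c by (intro mult_mono) auto
    then show ?thesis
      by (simp add: algebra_simps flip: power_add)
  qed
  also have "\<dots> \<le> 8 * s ^ 4 * p ^ 4 + 72 * s ^ 4 * p ^ 4"
    using s8 by (intro add_mono mult_right_mono mult_left_mono) auto
  finally show ?thesis
    by (simp add: mult_ac)
qed

section \<open>Duplicating the ends of an edge\<close>

lemma loopfree_simple_append:
  "loopfree_simple (K @ L) \<longleftrightarrow>
     loopfree_simple K \<and> loopfree_simple L \<and> ends ` set K \<inter> ends ` set L = {}"
  by (auto simp: loopfree_simple_def)

lemma loopfree_simple_Nil [simp]: "loopfree_simple []"
  by (simp add: loopfree_simple_def)

text \<open>In a simple list \<open>ends\<close> is injective, so edges can be counted by their
  possible sets of ends.\<close>

lemma length_filter_le_card_ends: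
  assumes "loopfree_simple L" "finite Z" "\<And>e. e \<in> set L \<Longrightarrow> P e \<Longrightarrow> ends e \<in> Z"
  shows "length (filter P L) \<le> card Z"
proof -
  have "distinct (map ends (filter P L))"
    using loopfree_simple_filter[OF assms(1), of P] by (simp add: loopfree_simple_def)
  then have "length (filter P L) = card (ends ` set (filter P L))"
    by (metis distinct_card length_map set_map)
  also have "\<dots> \<le> card Z"
    using assms(2,3) by (intro card_mono) auto
  finally show ?thesis .
qed

text \<open>Even if all edges meet, the front edge meets at most \<open>length K - 1\<close> later
  ones.\<close>

lemma removable_short: "real (length K) + 1 \<le> 2 * k \<Longrightarrow> removable k K"
proof (induction K)
  case (Cons e K)
  then show ?case
    using nb_le_length[of e K] by simp
qed simp

text \<open>Only the edges joining \<open>b\<close> to the two ends of \<open>e\<close> can meet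
  \<open>e\<close>.\<close>

lemma nb_star_avoiding:
  assumes "loopfree_simple L" "\<And>e. e \<in> set L \<Longrightarrow> b \<in> ends e" "b \<notin> ends e"
  shows "nb e L \<le> 2"
proof -
  have "nb e L \<le> card ((\<lambda>z. {b, z}) ` ends e)"
    unfolding nb_def
  proof (rule length_filter_le_card_ends[OF assms(1)])
    fix e' assume e': "e' \<in> set L" "ends e \<inter> ends e' \<noteq> {}"
    have "b = fst e' \<or> b = snd e'"
      using assms(2)[OF e'(1)] by simp
    then obtain z where "ends e' = {b, z}"
      by blast
    then show "ends e' \<in> (\<lambda>z. {b, z}) ` ends e"
      using e'(2) assms(3) by auto
  qed simp
  also have "\<dots> \<le> card (ends e)"
    by (rule card_image_le) simp
  also have "\<dots> \<le> 2"
    by (simp add: card_insert_if)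
  finally show ?thesis .
qed

section \<open>A star at \<open>b\<close> and its copy at a new vertex\<close>

context
  fixes b b' :: 'v and \<rho> :: "'v \<Rightarrow> 'v" and L L' :: "('v \<times> 'v) list"
  assumes \<rho>: "\<rho> = (\<lambda>i. if i = b then b' else i)" and L': "L' = map (map_prod \<rho> \<rho>) L"
    and simple: "loopfree_simple L" and b: "\<And>e. e \<in> set L \<Longrightarrow> b \<in> ends e"
    and b': "\<And>e. e \<in> set L \<Longrightarrow> b' \<notin> ends e" "b \<noteq> b'"
begin

lemma ends_star:
  assumes "e \<in> set L"
  obtains z where "ends e = {b, z}" "z \<noteq> b" "z \<noteq> b'" "ends (map_prod \<rho> \<rho> e) = {b', z}"
proof -
  have "fst e \<noteq> snd e"
    using simple assms by (auto simp: loopfree_simple_def)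
  then show ?thesis
    using b[OF assms] b'(1)[OF assms] that[of "if fst e = b then snd e else fst e"]
    by (auto simp: \<rho> insert_commute split: if_splits)
qed

lemma loopfree_simple_copy: "loopfree_simple L'"
proof -
  have "inj_on ends (map_prod \<rho> \<rho> ` set L) \<and> inj_on (map_prod \<rho> \<rho>) (set L)"
  proof -
    have "e = e'" if "e \<in> set L" "e' \<in> set L" "ends (map_prod \<rho> \<rho> e) = ends (map_prod \<rho> \<rho> e')" for e e'
    proof -
      obtain z where z: "ends e = {b, z}" "z \<noteq> b" "z \<noteq> b'" "ends (map_prod \<rho> \<rho> e) = {b', z}"
        using ends_star[OF \<open>e \<in> set L\<close>] .
      obtain z' where z': "ends e' = {b, z'}" "z' \<noteq> b" "z' \<noteq> b'" "ends (map_prod \<rho> \<rho> e') = {b', z'}"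
        using ends_star[OF \<open>e' \<in> set L\<close>] .
      have "{b', z} = {b', z'}"
        using that(3) z(4) z'(4) by simp
      then have "z = z'"
        using z(3) z'(3) by (auto simp: doubleton_eq_iff)
      then have "ends e = ends e'"
        using z z' by simp
      moreover have "inj_on ends (set L)"
        using simple by (simp add: loopfree_simple_def distinct_map)
      ultimately show ?thesis
        using that(1,2) by (meson inj_onD)
    qed
    then show ?thesis
      by (auto simp: inj_on_def)
  qed
  moreover have "distinct L"
    using simple by (simp add: loopfree_simple_def distinct_map)
  moreover have "fst e \<noteq> snd e" if "e \<in> set L'" for e
  proof -
    obtain e0 where e0: "e0 \<in> set L" "e = map_prod \<rho> \<rho> e0"
      using \<open>e \<in> set L'\<close> L' by auto
    obtain z where z: "z \<noteq> b'" "ends e = {b', z}"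
      using ends_star[OF e0(1)] e0(2) by metis
    then show ?thesis
      by auto
  qed
  ultimately show ?thesis
    unfolding loopfree_simple_def L' distinct_map by simp
qed

lemma ends_copy_disjoint: "ends ` set L \<inter> ends ` set L' = {}"
proof -
  have "b \<notin> ends e" if e: "e \<in> set L'" for e
    using e b'(2) by (auto simp: L' \<rho> split: if_splits)
  then show ?thesis
    using b by fastforce
qed

lemma nb_copy_avoiding: "b \<notin> ends e \<Longrightarrow> b' \<notin> ends e \<Longrightarrow> nb e L' = nb e L"
  unfolding nb_def L' filter_map length_map
  by (rule arg_cong[of _ _ length], rule filter_cong) (auto simp: \<rho>)

text \<open>The centres differ, so the edge from \<open>b\<close> to \<open>z\<close> meets no
  copied edge except its own copy from \<open>b'\<close> to \<open>z\<close>.\<close>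

lemma nb_copy_star:
  assumes "e \<in> set L"
  shows "nb e L' \<le> 1"
proof -
  have "nb e L' = length (filter (\<lambda>e'. ends e \<inter> ends (map_prod \<rho> \<rho> e') \<noteq> {}) L)"
    by (simp add: nb_def L' filter_map comp_def)
  also have "\<dots> \<le> card {ends e}"
  proof (rule length_filter_le_card_ends[OF simple])
    fix e' assume e': "e' \<in> set L" "ends e \<inter> ends (map_prod \<rho> \<rho> e') \<noteq> {}"
    obtain z where z: "ends e = {b, z}" "z \<noteq> b'"
      using ends_star[OF assms] by metis
    obtain z' where z': "ends e' = {b, z'}" "z' \<noteq> b" "ends (map_prod \<rho> \<rho> e') = {b', z'}"
      using ends_star[OF e'(1)] by metis
    have "z = z'"
      using e'(2) z z' b'(2) by auto
    then show "ends e' \<in> {ends e}"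
      using z z' by simp
  qed simp
  finally show ?thesis
    by simp
qed

text \<open>An edge of \<open>L\<close> may meet all later edges of \<open>L\<close>, at most
  \<open>length L - 1\<close>, but only one edge of the copy.\<close>

lemma removable_star_copy:
  assumes "real (length L) + 2 \<le> 2 * k"
  shows "removable k (L @ L')"
proof (rule removable_appendI)
  show "removable k L'"
    using assms by (intro removable_short) (simp add: L')
  fix S1 e S2 assume L: "L = S1 @ e # S2"
  have "nb e S2 \<le> length S2" "nb e L' \<le> 1"
    using nb_le_length[of e S2] nb_copy_star[of e] L by auto
  then show "real (nb e S2 + nb e L') + 2 \<le> 2 * k"
    using assms L by simp
qed

end

text \<open>The two alternatives are the conditions on \<open>k\<close> in terms of maximum degree and degeneracy of the
  line graph. The edges are replaced from the front of the list, so the earlier neighbours in a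
  degeneracy ordering come later in the list.\<close>

definition sparse_order :: "real \<Rightarrow> ('v \<times> 'v) list \<Rightarrow> bool" where
  "sparse_order k K \<longleftrightarrow>
     (\<exists>D::nat. real D + 4 \<le> 2 * k \<and> (\<forall>K1 e K2. K = K1 @ e # K2 \<longrightarrow> nb e K1 + nb e K2 \<le> D)) \<or>
     (\<exists>d::nat. real d + 6 \<le> 2 * k \<and> (\<forall>K1 e K2. K = K1 @ e # K2 \<longrightarrow> nb e K2 \<le> d))"

lemma sparse_order_Cons:
  assumes "sparse_order k (e # K)"
  shows "sparse_order k K"
proof -
  have 1: "nb e' K1 + nb e' K2 \<le> D"
    if "\<forall>K1 e' K2. e # K = K1 @ e' # K2 \<longrightarrow> nb e' K1 + nb e' K2 \<le> D" "K = K1 @ e' # K2"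
    for e' K1 K2 D
    using that(1)[rule_format, of "e # K1" e' K2] that(2) by (simp add: nb_Cons)
  have 2: "nb e' K2 \<le> D"
    if "\<forall>K1 e' K2. e # K = K1 @ e' # K2 \<longrightarrow> nb e' K2 \<le> D" "K = K1 @ e' # K2"
    for e' K1 K2 D
    using that(1)[rule_format, of "e # K1" e' K2] that(2) by simp
  show ?thesis
    using assms 1 2 unfolding sparse_order_def by meson
qed

text \<open>The edges at \<open>b\<close> all meet the front edge \<open>(a, b)\<close>, whose
  neighbours come later in the list and are bounded in either alternative.\<close>

lemma sparse_order_star:
  assumes "sparse_order k ((a, b) # K)"
  shows "real (length (filter (\<lambda>e. b \<in> ends e) K)) + 4 \<le> 2 * k"
proof -
  have *: "length (filter (\<lambda>e. b \<in> ends e) K) \<le> nb (a, b) K"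
    by (induction K) (auto simp: nb_Cons)
  have "nb (a, b) K \<le> D" if "\<forall>K1 e K2. (a, b) # K = K1 @ e # K2 \<longrightarrow> nb e K1 + nb e K2 \<le> D" for D
    using that[rule_format, of "[]" "(a, b)" K] by simp
  moreover have "nb (a, b) K \<le> D" if "\<forall>K1 e K2. (a, b) # K = K1 @ e # K2 \<longrightarrow> nb e K2 \<le> D" for D
    using that[rule_format, of "[]" "(a, b)" K] by simp
  ultimately show ?thesis
    using assms * unfolding sparse_order_def by force
qed

text \<open>This is the source of both thresholds. An edge \<open>e\<close> avoiding
  \<open>b\<close> meets at most two edges of the star. A degree bound \<open>D\<close> already
  includes these, so only the copy is new and the total is at most \<open>D + 2\<close>. A
  degeneracy bound \<open>d\<close> covers later edges only, while edges of the star may precede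
  \<open>e\<close> in \<open>K\<close>; star and copy then both count as new, giving
  \<open>d + 4\<close>.\<close>

lemma sparse_order_remove:
  assumes "sparse_order k ((a, b) # K)" "loopfree_simple ((a, b) # K)"
    and K: "K = K1 @ e # K2" and e: "b \<notin> ends e"
  shows "real (nb e (filter (\<lambda>e. b \<notin> ends e) K2) + 2 * nb e ((a, b) # filter (\<lambda>e. b \<in> ends e) K)) + 2
    \<le> 2 * k"
proof -
  define L where "L = (a, b) # filter (\<lambda>e. b \<in> ends e) K"
  have L2: "nb e L \<le> 2"
    using assms(2) e by (intro nb_star_avoiding[of _ b]) (auto simp: L_def loopfree_simple_filter)
  have L: "nb e L = nb e [(a, b)] + nb e (filter (\<lambda>e. b \<in> ends e) K1) + nb e (filter (\<lambda>e. b \<in> ends e) K2)"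
    using e by (auto simp: L_def K nb_Cons)
  have le: "nb e (filter (\<lambda>e. b \<in> ends e) K1) \<le> nb e K1"
    "nb e K2 = nb e (filter (\<lambda>e. b \<in> ends e) K2) + nb e (filter (\<lambda>e. b \<notin> ends e) K2)"
    using nb_filter_le nb_filter_split by blast+
  have "(a, b) # K = ((a, b) # K1) @ e # K2"
    by (simp add: K)
  then consider (D) D where "real D + 4 \<le> 2 * k" "nb e ((a, b) # K1) + nb e K2 \<le> D"
    | (d) d where "real d + 6 \<le> 2 * k" "nb e K2 \<le> d"
    using assms(1) unfolding sparse_order_def by fast
  then show ?thesis
  proof cases
    case D
    have "nb e ((a, b) # K1) = nb e [(a, b)] + nb e K1"
      by (simp add: nb_Cons)
    then have "nb e (filter (\<lambda>e. b \<notin> ends e) K2) + 2 * nb e L \<le> D + 2"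
      using D(2) L le L2 by linarith
    then show ?thesis
      using D(1) unfolding L_def[symmetric] by linarith
  next
    case d
    have "nb e (filter (\<lambda>e. b \<notin> ends e) K2) + 2 * nb e L \<le> d + 4"
      using d(2) le L2 by linarith
    then show ?thesis
      using d(1) unfolding L_def[symmetric] by linarith
  qed
qed

lemma filter_eq_appendD:
  "filter P K = S1 @ e # S2 \<Longrightarrow> \<exists>K1 K2. K = K1 @ e # K2 \<and> P e \<and> S2 = filter P K2"
proof (induction S1 arbitrary: K)
  case Nil
  then show ?case
    by (auto dest!: filter_eq_ConsD)
next
  case (Cons s S1)
  then obtain us vs where "K = us @ s # vs" "filter P vs = S1 @ e # S2"
    by (auto dest!: filter_eq_ConsD)
  then show ?case
    using Cons.IH[of vs] by (metis append_Cons append_assoc)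
qed

text \<open>Serves both duplications: \<open>B\<close> counts the \<open>n\<close> edges pulled out,
  \<open>E\<close> is the count after duplication, and \<open>Q1\<close> is what remains of it once
  those edges are replaced by \<open>p\<close>, with \<open>m\<close> edges left. Up to constants
  \<open>Q0\<^sup>2\<close> is at most \<open>p ^ n * p ^ n * \<sigma>\<^sup>2 * p ^ m\<close>, the
  square of \<open>\<sigma> * p ^ r\<close>; the removal error fits in because
  \<open>c \<le> \<sigma>\<^sup>2\<close>.\<close>

lemma Cauchy_Schwarz_step_bound:
  fixes p \<sigma> c \<alpha> Q0 Q1 B E :: real
  assumes p: "0 < p" "p \<le> 1" and \<sigma>: "0 \<le> \<sigma>" and c: "0 \<le> c" "c \<le> \<sigma>\<^sup>2"
    and n: "n \<le> M" "n + m \<le> M'" "2 * n + m = 2 * r" and \<alpha>: "1 \<le> \<alpha>"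
    and Q: "Q0\<^sup>2 \<le> B * E" "B \<le> (2 * p) ^ n" "0 \<le> B" "\<bar>E - p ^ n * Q1\<bar> \<le> n * (c * (2 * p) ^ (n + m))"
      "Q1 \<le> \<alpha> * \<sigma>\<^sup>2 * p ^ m"
  shows "\<bar>Q0\<bar> \<le> 2 ^ M * (\<alpha> + M * 2 ^ M') * \<sigma> * p ^ r"
proof -
  define C where "C = 2 ^ M * (\<alpha> + M * 2 ^ M')"
  have "1 * 1 \<le> C"
    unfolding C_def using \<alpha> by (intro mult_mono) (auto intro: add_increasing2)
  then have C: "1 \<le> C"
    by simp
  have "E \<le> p ^ n * Q1 + n * (c * (2 * p) ^ (n + m))"
    using Q(4) by linarith
  also have "\<dots> \<le> p ^ n * (\<alpha> * \<sigma>\<^sup>2 * p ^ m) + M * (\<sigma>\<^sup>2 * (2 ^ M' * p ^ (n + m)))"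
  proof (rule add_mono)
    show "p ^ n * Q1 \<le> p ^ n * (\<alpha> * \<sigma>\<^sup>2 * p ^ m)"
      using Q(5) p by (intro mult_left_mono) auto
    have "(2 * p) ^ (n + m) \<le> 2 ^ M' * p ^ (n + m)"
      unfolding power_mult_distrib using p n by (intro mult_right_mono power_increasing) auto
    then show "n * (c * (2 * p) ^ (n + m)) \<le> M * (\<sigma>\<^sup>2 * (2 ^ M' * p ^ (n + m)))"
      using p n c by (intro mult_mono) auto
  qed
  also have "\<dots> = (\<alpha> + M * 2 ^ M') * \<sigma>\<^sup>2 * p ^ (n + m)"
    by (simp add: algebra_simps power_add)
  finally have E: "E \<le> (\<alpha> + M * 2 ^ M') * \<sigma>\<^sup>2 * p ^ (n + m)" .
  have "Q0\<^sup>2 \<le> B * ((\<alpha> + M * 2 ^ M') * \<sigma>\<^sup>2 * p ^ (n + m))"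
    using Q(1) mult_left_mono[OF E Q(3)] by linarith
  also have "\<dots> \<le> (2 ^ M * p ^ n) * ((\<alpha> + M * 2 ^ M') * \<sigma>\<^sup>2 * p ^ (n + m))"
  proof (rule mult_right_mono)
    have "(2 * p) ^ n \<le> 2 ^ M * p ^ n"
      unfolding power_mult_distrib using p n by (intro mult_right_mono power_increasing) auto
    then show "B \<le> 2 ^ M * p ^ n"
      using Q(2) by linarith
  qed (use p \<alpha> in auto)
  also have "\<dots> = C * (\<sigma>\<^sup>2 * p ^ (n + (n + m)))"
    by (simp add: C_def power_add mult_ac)
  also have "n + (n + m) = 2 * r"
    using n(3) by simp
  \<comment> \<open>Enlarging \<open>C\<close> to its square avoids a root of the constant.\<close>
  also have "C * (\<sigma>\<^sup>2 * p ^ (2 * r)) \<le> C\<^sup>2 * (\<sigma>\<^sup>2 * p ^ (2 * r))"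
    using C p by (intro mult_right_mono) (auto simp: power2_eq_square)
  also have "\<dots> = (C * \<sigma> * p ^ r)\<^sup>2"
    by (simp only: power_mult_distrib power_even_eq mult.assoc)
  finally have "Q0\<^sup>2 \<le> (C * \<sigma> * p ^ r)\<^sup>2" .
  then have "\<bar>Q0\<bar> \<le> C * \<sigma> * p ^ r"
    by (rule iffD1[OF power2_le_iff_abs_le, rotated]) (use C \<sigma> p in simp)
  then show ?thesis
    by (simp add: C_def)
qed

text \<open>The constants of \<open>Cauchy_Schwarz_step_bound\<close> in its two uses. The 80 comes
  from \<open>C4_small\<close>. When \<open>a\<close> is duplicated, at most \<open>2 * N\<close>
  edges are removed and four remain; when \<open>b\<close> is, at most \<open>N\<close> are removed,
  and \<open>3 * N + 2\<close> bounds the number of all edges.\<close>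

definition bound1 :: "nat \<Rightarrow> real" where
  "bound1 N = 2 ^ (2 * N) * (80 + real (2 * N) * 2 ^ (2 * N + 4))"

definition bound2 :: "nat \<Rightarrow> real" where
  "bound2 N = 2 ^ N * (bound1 N + real N * 2 ^ (3 * N + 2))"

lemma bound1_ge_1: "1 \<le> bound1 N"
proof -
  have "1 * 1 \<le> bound1 N"
    unfolding bound1_def by (intro mult_mono) (auto intro: add_increasing2)
  then show ?thesis by simp
qed

text \<open>The deviation \<open>f\<close> has a majorant \<open>\<mu>\<close> of its own because G
  minus a constant is not majorized by \<Gamma>: it need not vanish at non-edges of
  \<Gamma>.\<close>

lemma deviation_edge_small:
  fixes V :: "'v set" and X :: "'v \<Rightarrow> 'a set" and f g \<gamma> \<mu> :: "'a \<Rightarrow> 'a \<Rightarrow> real"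
  assumes fin: "finite V" "\<And>i. i \<in> V \<Longrightarrow> finite (X i) \<and> X i \<noteq> {}"
    and K: "loopfree_simple ((a, b) # K)" "\<And>e. e \<in> set ((a, b) # K) \<Longrightarrow> ends e \<subseteq> V"
      "sparse_order k ((a, b) # K)" "length K \<le> N"
    and new: "a' \<notin> V" "b' \<notin> V" "a' \<noteq> b'" "X a' = X a" "X b' = X b"
    and p: "0 < p" "p \<le> 1" and s: "0 < s" "s \<le> 1"
    and g: "\<And>x y. \<bar>g x y\<bar> \<le> \<gamma> x y" "\<And>x y. \<gamma> x y \<le> 1"
    and f: "\<And>x y. \<bar>f x y\<bar> \<le> \<mu> x y" "\<And>x y. \<mu> x y \<le> 1"
    and jumb: "\<And>i j. i \<in> V \<Longrightarrow> j \<in> V \<Longrightarrow> i \<noteq> j \<Longrightarrow>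
      sjumb (X i) (X j) (\<lambda>x y. \<gamma> x y - p) (s ^ 16 * p powr k)"
    and jumb_ab: "sjumb (X a) (X b) (\<lambda>x y. \<mu> x y - p) (s ^ 16 * p powr k)"
    and disc: "\<And>u v. (\<And>x. x \<in> X a \<Longrightarrow> \<bar>u x\<bar> \<le> 1) \<Longrightarrow> (\<And>y. y \<in> X b \<Longrightarrow> \<bar>v y\<bar> \<le> 1) \<Longrightarrow>
       \<bar>mean (X a) (\<lambda>x. mean (X b) (\<lambda>y. f x y * u x * v y))\<bar> \<le> s ^ 16 * p"
  shows "\<bar>mean (PiE V X) (\<lambda>x. f (x a) (x b) * eprod (\<lambda>_. g) K x)\<bar> \<le> bound2 N * s * p ^ (length K + 1)"
proof -
  define c where "c = s ^ 16"
  have c: "0 \<le> c" "c \<le> 1" "c \<le> (s\<^sup>2)\<^sup>2" "c \<le> s\<^sup>2"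
    using s unfolding c_def power_mult[symmetric] by (auto simp: power_le_one intro!: power_decreasing)
  have ab: "a \<in> V" "b \<in> V" "a \<noteq> b"
    using K(1) K(2)[of "(a, b)"] by auto
  have neq: "a \<noteq> a'" "a \<noteq> b'" "b \<noteq> a'" "b \<noteq> b'"
    using ab new by auto
  \<comment> \<open>\<open>S\<close> is pulled out when \<open>b\<close> is duplicated;
    \<open>B\<close> consists of the other edges at \<open>b\<close> apart from
    \<open>(a, b)\<close>.\<close>
  define S where "S = filter (\<lambda>e. b \<notin> ends e) K"
  define B where "B = filter (\<lambda>e. b \<in> ends e) K"
  define L where "L = (a, b) # B"
  define \<rho> where "\<rho> = (\<lambda>i. if i = b then b' else i)"
  define \<rho>a where "\<rho>a = (\<lambda>i. if i = a then a' else i)"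
  define L' where "L' = map (map_prod \<rho> \<rho>) L"
  define B' where "B' = map (map_prod \<rho> \<rho>) B"
  define C where "C = [(a, b), (a, b'), (a', b), (a', b')]"
  \<comment> \<open>The weights after the first and the second duplication: \<open>w1\<close> still
    has \<open>g\<close> on the edges at \<open>b\<close> and its copy, whereas in \<open>w2\<close>
    only the copies of \<open>(a, b)\<close>, forming the 4-cycle \<open>C\<close>, differ from
    \<open>\<gamma>\<close>.\<close>
  define w1 where "w1 e = (if e \<in> set C then f else if b \<in> ends e \<or> b' \<in> ends e then g else \<gamma>)" for e
  define w2 where "w2 e = (if e \<in> set C then f else \<gamma>)" for e
  define \<nu> where "\<nu> e = (if e \<in> set C then \<mu> else \<gamma>)" for e
  define V1 where "V1 = insert b' V"
  define V2 where "V2 = insert a' V1"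
  have L'_eq: "L' = (a, b') # B'"
    using ab by (simp add: L'_def L_def B'_def \<rho>_def)
  have finV: "finite V1" "finite V2"
    using fin by (simp_all add: V1_def V2_def)
  have XV1: "finite (X i) \<and> X i \<noteq> {}" if "i \<in> V1" for i
    using that fin(2) ab new by (auto simp: V1_def)
  have XV2: "finite (X i) \<and> X i \<noteq> {}" if "i \<in> V2" for i
    using that fin(2) ab new by (auto simp: V1_def V2_def)
  have X\<rho>: "X (\<rho> i) = X i" for i
    using new by (simp add: \<rho>_def)

  have KV: "ends e \<subseteq> V" "fst e \<noteq> snd e" "ends e \<noteq> {a, b}" if "e \<in> set K" for e
    using K(1) K(2)[of e] that by (auto simp: loopfree_simple_def)
  have L_simple: "loopfree_simple L"
    using K(1) by (auto simp: L_def B_def loopfree_simple_filter)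
  have B_simple: "loopfree_simple B" and S_simple: "loopfree_simple S"
    using K(1) by (auto simp: B_def S_def loopfree_simple_filter)
  have L_b: "b \<in> ends e" "b' \<notin> ends e" if "e \<in> set L" for e
    using that KV(1)[of e] neq new(2) ab by (auto simp: L_def B_def)
  have B_L: "e \<in> set L" if "e \<in> set B" for e
    using that by (simp add: L_def)
  note copyL = \<rho>_def L'_def L_simple L_b neq(4)
  note copyB = \<rho>_def B'_def B_simple L_b[OF B_L] neq(4)
  have B_end: "\<exists>z. ends e = {b, z} \<and> z \<in> V \<and> z \<noteq> a \<and> z \<noteq> b" if "e \<in> set B" for e
  proof -
    have e: "e \<in> set K" "b \<in> ends e"
      using that by (auto simp: B_def)
    show ?thesis
      using KV[OF e(1)] e(2) by (intro exI[of _ "if fst e = b then snd e else fst e"]) auto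
  qed
  have B'_end: "\<exists>z. ends e = {b', z} \<and> z \<in> V \<and> z \<noteq> a \<and> z \<noteq> b" if "e \<in> set B'" for e
  proof -
    obtain e0 where e0: "e0 \<in> set B" "e = map_prod \<rho> \<rho> e0"
      using \<open>e \<in> set B'\<close> B'_def by auto
    obtain z where z: "ends e0 = {b, z}" "z \<in> V" "z \<noteq> a" "z \<noteq> b"
      using B_end[OF e0(1)] by blast
    have "ends e = \<rho> ` ends e0"
      by (simp add: e0(2))
    also have "\<dots> = {b', z}"
      using z by (auto simp: \<rho>_def)
    finally show ?thesis
      using z by blast
  qed
  have BB'_end: "\<exists>y z. ends e = {y, z} \<and> (y = b \<or> y = b') \<and> z \<in> V \<and> z \<noteq> a \<and> z \<noteq> b"
    if "e \<in> set B \<or> e \<in> set B'" for e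
    using that B_end[of e] B'_end[of e] by (elim disjE) metis+
  have notA: "a \<notin> ends e \<and> a' \<notin> ends e" if mem: "e \<in> set B \<or> e \<in> set B'" for e
  proof -
    obtain y z where e: "ends e = {y, z}" and yz: "y = b \<or> y = b'" "z \<in> V" "z \<noteq> a" "z \<noteq> b"
      using BB'_end[OF mem] by auto
    show ?thesis
      unfolding e using yz neq new ab by auto
  qed
  have notC: "e \<notin> set C" if mem: "e \<in> set S \<or> e \<in> set B \<or> e \<in> set B'" for e
  proof
    assume "e \<in> set C"
    then have "e = (a, b) \<or> e = (a, b') \<or> e = (a', b) \<or> e = (a', b')"
      by (simp add: C_def)
    then have eC: "ends e = {a, b} \<or> ends e = {a, b'} \<or> ends e = {a', b} \<or> ends e = {a', b'}"
      by (elim disjE) simp_all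
    consider "e \<in> set S" | "e \<in> set B" | "e \<in> set B'"
      using mem by blast
    then show False
    proof cases
      case 1
      then have "ends e \<subseteq> V" "b \<notin> ends e"
        using KV(1)[of e] by (auto simp: S_def)
      then show False
        using eC new by (elim disjE) simp_all
    next
      case 2
      then obtain z where "ends e = {b, z}" "z \<in> V" "z \<noteq> a" "z \<noteq> b"
        using B_end by blast
      then show False
        using eC new neq ab by (elim disjE) (auto simp only: doubleton_eq_iff)
    next
      case 3
      then obtain z where "ends e = {b', z}" "z \<in> V" "z \<noteq> a" "z \<noteq> b"
        using B'_end by blast
      then show False
        using eC new neq ab by (elim disjE) (auto simp only: doubleton_eq_iff)
    qed
  qed

  have jumb_list: "sjumb (X (fst e)) (X (snd e)) (\<lambda>x y. \<nu> e x y - p) (c * p powr k)"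
    if mem: "e \<in> set S \<or> e \<in> set B \<or> e \<in> set B' \<or> e \<in> set C" for e
  proof -
    have jumb_K: "sjumb (X (fst e)) (X (snd e)) (\<lambda>x y. \<gamma> x y - p) (c * p powr k)" if "e \<in> set K" for e
      unfolding c_def using KV[OF that] by (intro jumb) auto
    consider "e \<in> set S \<or> e \<in> set B" | "e \<in> set B'" | "e \<in> set C"
      using mem by blast
    then show ?thesis
    proof cases
      case 1
      then have "e \<in> set K" "e \<notin> set C"
        using notC[of e] by (auto simp: S_def B_def)
      then show ?thesis
        using jumb_K[of e] by (simp add: \<nu>_def)
    next
      case 2
      then obtain e0 where e0: "e0 \<in> set K" "e = map_prod \<rho> \<rho> e0"
        unfolding B'_def B_def by auto
      have "sjumb (X (fst e)) (X (snd e)) (\<lambda>x y. \<gamma> x y - p) (c * p powr k)"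
        using jumb_K[OF e0(1)] by (simp add: e0(2) X\<rho>)
      then show ?thesis
        using notC[of e] 2 by (simp add: \<nu>_def)
    next
      case 3
      then show ?thesis
        using jumb_ab new by (auto simp: \<nu>_def C_def c_def)
    qed
  qed
  have \<gamma>0: "0 \<le> \<gamma> x y" "0 \<le> \<mu> x y" for x y
    using g(1)[of x y] f(1)[of x y] by linarith+
  have maj: "majorized W X w1 \<nu> J" "majorized W X w2 \<nu> J" "majorized W X \<nu> \<nu> J"
    "majorized W X (\<lambda>_. g) (\<lambda>_. \<gamma>) J"
    if "\<And>e. e \<in> set J \<Longrightarrow> ends e \<subseteq> W" for W J
  proof -
    have "\<bar>w1 e x y\<bar> \<le> \<nu> e x y" "\<bar>w2 e x y\<bar> \<le> \<nu> e x y" "\<bar>\<nu> e x y\<bar> \<le> \<nu> e x y" "\<nu> e x y \<le> 1" for e x y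
      using f g \<gamma>0 by (simp_all add: w1_def w2_def \<nu>_def)
    then show "majorized W X w1 \<nu> J" "majorized W X w2 \<nu> J" "majorized W X \<nu> \<nu> J"
      "majorized W X (\<lambda>_. g) (\<lambda>_. \<gamma>) J"
      unfolding majorized_def using that g by blast+
  qed

  have endsV: "ends e \<subseteq> V" if "e \<in> set S \<or> e \<in> set L" for e
    using that K(2)[of e] by (auto simp: S_def L_def B_def)
  have endsV1: "ends e \<subseteq> V1" if "e \<in> set S \<or> e \<in> set L \<or> e \<in> set L'" for e
  proof -
    have L'V1: "ends e \<subseteq> V1" if e: "e \<in> set L'"
    proof -
      obtain e0 where "e0 \<in> set L" "e = map_prod \<rho> \<rho> e0"
        using e L'_def by auto
      then show ?thesis
        using endsV[of e0] by (auto simp: \<rho>_def V1_def)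
    qed
    then show ?thesis
      using that endsV[of e] L'V1 by (auto simp: V1_def)
  qed
  have endsB: "ends e \<subseteq> V1" if "e \<in> set (B @ B')" for e
    using that endsV1[of e] by (auto simp: L_def L'_eq)

  have len_B: "real (length B) + 4 \<le> 2 * k"
    unfolding B_def using K(3) by (rule sparse_order_star)
  have len: "length S + length B = length K"
    using sum_length_filter_compl[of "\<lambda>e. b \<in> ends e" K] by (simp add: S_def B_def)
  have len': "length B' = length B" "length L = length B + 1" "length L' = length B + 1"
    by (simp_all add: B'_def L_def L'_def)

  have bS: "b \<notin> ends e" "b' \<notin> ends e" if "e \<in> set S" for e
    using that KV(1)[of e] new(2) by (auto simp: S_def)
  \<comment> \<open>The edges of \<open>S\<close> keep their order from \<open>K\<close> and come
    first. Since they meet \<open>L\<close> and its copy equally often,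
    \<open>sparse_order_remove\<close> is exactly their condition for removal.\<close>
  have hostS: "host V1 X p c k \<nu> (S @ L @ L')"
  proof -
    have "loopfree_simple (S @ L @ L')"
      unfolding loopfree_simple_append
    proof (intro conjI S_simple L_simple)
      show "loopfree_simple L'"
        by (rule loopfree_simple_copy[OF copyL])
      show "ends ` set L \<inter> ends ` set L' = {}"
        by (rule ends_copy_disjoint[OF copyL])
      have "b \<in> ends e \<or> b' \<in> ends e" if "e \<in> set (L @ L')" for e
        using that L_b(1)[of e] B'_end[of e] by (auto simp: L'_eq)
      then show "ends ` set S \<inter> ends ` set (L @ L') = {}"
        using bS by (smt (verit) disjoint_iff image_iff)
    qed
    moreover have "removable k (S @ L @ L')"
    proof (rule removable_appendI)
      show "removable k (L @ L')"
        using removable_star_copy[OF copyL, of k] len_B len' by simp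
      fix S1 e S2 assume S: "S = S1 @ e # S2"
      then obtain K1 K2 where K12: "K = K1 @ e # K2" "b \<notin> ends e" "S2 = filter (\<lambda>e. b \<notin> ends e) K2"
        using filter_eq_appendD[of "\<lambda>e. b \<notin> ends e" K S1 e S2] by (auto simp: S_def)
      have "nb e L' = nb e L"
        using bS[of e] S by (intro nb_copy_avoiding[OF copyL]) auto
      moreover have "real (nb e S2 + 2 * nb e L) + 2 \<le> 2 * k"
        using sparse_order_remove[OF K(3,1) K12(1,2)] by (simp only: K12(3) L_def B_def)
      ultimately show "real (nb e S2 + nb e (L @ L')) + 2 \<le> 2 * k"
        unfolding nb_append by simp
    qed
    moreover have "majorized V1 X \<nu> \<nu> (S @ L @ L')"
      using endsV1 by (intro maj) auto
    moreover have "sjumb (X (fst e)) (X (snd e)) (\<lambda>x y. \<nu> e x y - p) (c * p powr k)"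
      if "e \<in> set (S @ L @ L')" for e
      using that by (intro jumb_list) (auto simp: L_def L'_eq C_def)
    ultimately show ?thesis
      unfolding host_def by blast
  qed
  have hostS': "host V X p c k \<nu> S"
    unfolding host_def
  proof (intro conjI ballI S_simple)
    show "majorized V X \<nu> \<nu> S"
      using endsV by (intro maj) auto
    show "removable k S"
    proof -
      have "removable k (S @ [])"
      proof (rule removable_appendI)
        fix S1 e S2 assume S: "S = S1 @ e # S2"
        then obtain K1 K2 where K12: "K = K1 @ e # K2" "b \<notin> ends e" "S2 = filter (\<lambda>e. b \<notin> ends e) K2"
          using filter_eq_appendD[of "\<lambda>e. b \<notin> ends e" K S1 e S2] by (auto simp: S_def)
        show "real (nb e S2 + nb e []) + 2 \<le> 2 * k"
          using sparse_order_remove[OF K(3,1) K12(1,2)] by (simp add: K12(3))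
      qed simp
      then show ?thesis
        by simp
    qed
  qed (auto intro: jumb_list)

  \<comment> \<open>An edge of \<open>B\<close> meets at most \<open>length B - 1\<close> later
    edges of \<open>B\<close>, one of \<open>B'\<close> and two of \<open>C\<close>. The sum is
    \<open>length B + 2\<close>, just what \<open>len_B\<close> permits.\<close>
  have hostC: "host V2 X p c k \<nu> ((B @ B') @ C)"
  proof -
    have nbC: "nb e C \<le> 2" if mem: "e \<in> set B \<or> e \<in> set B'" for e
    proof -
      obtain y z where e: "ends e = {y, z}" and yz: "y = b \<or> y = b'" "z \<in> V" "z \<noteq> a" "z \<noteq> b"
        using BB'_end[OF mem] by auto
      show ?thesis
        unfolding nb_def e using yz neq new ab by (auto simp: C_def)
    qed
    have "removable k C"
      using neq new ab len_B by (auto simp: C_def nb_Cons)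
    then have "removable k (B' @ C)"
    proof (rule removable_appendI)
      fix S1 e S2 assume B': "B' = S1 @ e # S2"
      have "nb e S2 \<le> length S2" "nb e C \<le> 2"
        using nb_le_length[of e S2] nbC[of e] B' by auto
      moreover have "length S2 + 1 \<le> length B"
        using arg_cong[OF B', of length] len' by simp
      ultimately show "real (nb e S2 + nb e C) + 2 \<le> 2 * k"
        using len_B by linarith
    qed
    then have "removable k (B @ B' @ C)"
    proof (rule removable_appendI)
      fix S1 e S2 assume B: "B = S1 @ e # S2"
      have "nb e S2 \<le> length S2" "nb e C \<le> 2" "nb e B' \<le> 1"
        using nb_le_length[of e S2] nbC[of e] B nb_copy_star[OF copyB, of e] by auto
      moreover have "length S2 + 1 \<le> length B"
        using arg_cong[OF B, of length] by simp
      ultimately show "real (nb e S2 + nb e (B' @ C)) + 2 \<le> 2 * k"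
        using len_B unfolding nb_append by linarith
    qed
    moreover have "loopfree_simple ((B @ B') @ C)"
    proof -
      have "loopfree_simple (B @ B')"
        unfolding loopfree_simple_append
        using B_simple loopfree_simple_copy[OF copyB] ends_copy_disjoint[OF copyB] by blast
      moreover have "loopfree_simple C"
        using neq new ab by (auto simp: C_def doubleton_eq_iff)
      moreover have "ends e \<notin> ends ` set C" if "e \<in> set (B @ B')" for e
        using that notA[of e] by (auto simp: C_def)
      ultimately show ?thesis
        unfolding loopfree_simple_append[of "B @ B'" C] by blast
    qed
    moreover have "majorized V2 X \<nu> \<nu> ((B @ B') @ C)"
      using endsB ab by (intro maj) (auto simp: V2_def V1_def C_def)
    moreover have "sjumb (X (fst e)) (X (snd e)) (\<lambda>x y. \<nu> e x y - p) (c * p powr k)"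
      if "e \<in> set ((B @ B') @ C)" for e
      using that by (intro jumb_list) auto
    ultimately show ?thesis
      unfolding host_def append_assoc by blast
  qed
  \<comment> \<open>This list arises from the tail \<open>L @ L'\<close> of the previous one by
    dropping the two copies of \<open>(a, b)\<close>.\<close>
  have hostB: "host V1 X p c k \<nu> (B @ B')"
  proof -
    have "host V1 X p c k \<nu> (filter (\<lambda>e. e \<notin> set C) (L @ L'))"
    proof (rule host_filter)
      show "host V1 X p c k \<nu> (L @ L')"
        using hostS by (induction S) (auto dest: host_ConsD)
    qed
    moreover have "filter (\<lambda>e. e \<notin> set C) B = B" "filter (\<lambda>e. e \<notin> set C) B' = B'"
      unfolding filter_id_conv using notC by blast+
    moreover have "(a, b) \<in> set C" "(a, b') \<in> set C"
      by (simp_all add: C_def)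
    ultimately show ?thesis
      by (simp add: L_def L'_eq)
  qed

  have eprod_\<gamma>: "eprod (\<lambda>_. \<gamma>) J = eprod \<nu> J" "eprod (\<lambda>_. \<gamma>) J = eprod w2 J"
    if "\<And>e. e \<in> set J \<Longrightarrow> e \<notin> set C" for J
    by (rule ext, rule eprod_cong, use that in \<open>simp add: \<nu>_def w2_def\<close>)+
  have w1_B: "w1 e = g" if "e \<in> set B \<or> e \<in> set B'" for e
  proof -
    have "b \<in> ends e \<or> b' \<in> ends e"
      using that B_end[of e] B'_end[of e] by blast
    then show ?thesis
      using that notC[of e] by (simp add: w1_def)
  qed

  have C4: "mean (PiE V2 X) (eprod w2 C) \<le> 80 * (s\<^sup>2)\<^sup>2 * p ^ 4"
  proof -
    define V0 where "V0 = V - {a, b}"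
    have V0: "V2 = insert a (insert a' (insert b (insert b' V0)))" "finite V0" "b' \<notin> V0" "b \<notin> insert b' V0"
      "a' \<notin> insert b (insert b' V0)" "a \<notin> insert a' (insert b (insert b' V0))"
      using ab new neq fin(1) by (auto simp: V0_def V2_def V1_def)
    have const: "mean (PiE V0 X) (\<lambda>_. r) = r" for r
      using fin by (intro mean_const finite_nonempty_PiE) (auto simp: V0_def)
    have "mean (PiE V2 X) (eprod w2 C) = mean (X a) (\<lambda>x. mean (X a) (\<lambda>x'. mean (X b) (\<lambda>y. mean (X b) (\<lambda>y'.
        f x y * f x y' * (f x' y * f x' y')))))"
      unfolding V0(1) using V0(2-) neq ab new
      by (simp add: mean_PiE_insert const C_def w2_def mult.assoc)
    also have "\<dots> \<le> 80 * s ^ 4 * p ^ 4"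
      using fin(2)[OF ab(1)] fin(2)[OF ab(2)] p s len_B f jumb_ab disc
      by (intro C4_small[where k = k and \<nu> = \<mu>]) auto
    finally show ?thesis
      by (simp flip: power_mult)
  qed

  define T where "T = L @ L'"
  define Q1 where "Q1 = mean (PiE V1 X) (eprod w1 T)"
  \<comment> \<open>Duplicating \<open>a\<close> pulls out all edges of \<open>B @ B'\<close>; the
    two deviation edges at \<open>a\<close> and their copies form \<open>C\<close>.\<close>
  have Q1: "\<bar>Q1\<bar> \<le> bound1 N * s\<^sup>2 * p ^ (length (B @ B') + 2)"
  proof -
    have "Q1 = mean (PiE V1 X) (\<lambda>x. eprod (\<lambda>_. g) (B @ B') x * eprod w2 [(a, b), (a, b')] x)"
      unfolding Q1_def
    proof (rule mean_cong)
      fix x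
      have "eprod w1 B x = eprod (\<lambda>_. g) B x" "eprod w1 B' x = eprod (\<lambda>_. g) B' x"
        using w1_B by (intro eprod_cong; blast)+
      then show "eprod w1 T x = eprod (\<lambda>_. g) (B @ B') x * eprod w2 [(a, b), (a, b')] x"
        by (simp add: T_def L_def L'_eq w1_def w2_def C_def)
    qed
    moreover have "(mean (PiE V1 X) (\<lambda>x. eprod (\<lambda>_. g) (B @ B') x * eprod w2 [(a, b), (a, b')] x))\<^sup>2 \<le>
      mean (PiE V1 X) (eprod (\<lambda>_. \<gamma>) (B @ B')) *
      mean (PiE (insert a' V1) X) (\<lambda>x. eprod (\<lambda>_. \<gamma>) (B @ B') x *
        eprod w2 ([(a, b), (a, b')] @ map (map_prod \<rho>a \<rho>a) [(a, b), (a, b')]) x)"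
    proof (rule mean_duplicate_vertex[OF finV(1) XV1 _ _ new(4) _ _ _ \<rho>a_def])
      show "\<bar>eprod (\<lambda>_. g) (B @ B') x\<bar> \<le> eprod (\<lambda>_. \<gamma>) (B @ B') x" if "x \<in> PiE V1 X" for x
        using endsB by (intro eprod_majorized(1)[OF maj(4) that])
      show "ends e \<subseteq> V1 - {a}" if "e \<in> set (B @ B')" for e
        using that endsB[OF that] notA[of e] by auto
      show "w2 (map_prod \<rho>a \<rho>a e) = w2 e" if "e \<in> set [(a, b), (a, b')]" for e
        using that neq ab by (auto simp: w2_def C_def \<rho>a_def)
    qed (use ab new in \<open>auto simp: V1_def\<close>)
    moreover have "mean (PiE (insert a' V1) X) (\<lambda>x. eprod (\<lambda>_. \<gamma>) (B @ B') x *
        eprod w2 ([(a, b), (a, b')] @ map (map_prod \<rho>a \<rho>a) [(a, b), (a, b')]) x) =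
        mean (PiE V2 X) (eprod w2 ((B @ B') @ C))"
    proof -
      have "eprod (\<lambda>_. \<gamma>) (B @ B') = eprod w2 (B @ B')"
        by (rule eprod_\<gamma>(2)) (use notC in \<open>auto simp del: split_paired_All\<close>)
      then show ?thesis
        using neq ab by (simp add: eprod_append_eq V2_def C_def \<rho>a_def mult.assoc del: eprod_append)
    qed
    moreover have "mean (PiE V1 X) (eprod (\<lambda>_. \<gamma>) (B @ B')) = mean (PiE V1 X) (eprod \<nu> (B @ B'))"
      by (subst eprod_\<gamma>(1)) (use notC in \<open>auto\<close>)
    ultimately have sq: "Q1\<^sup>2 \<le> mean (PiE V1 X) (eprod \<nu> (B @ B')) * mean (PiE V2 X) (eprod w2 ((B @ B') @ C))"
      by simp
    have len_C: "length C = 4"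
      by (simp add: C_def)
    have rem: "\<bar>mean (PiE V2 X) (eprod w2 ((B @ B') @ C)) - p ^ length (B @ B') * mean (PiE V2 X) (eprod w2 C)\<bar>
      \<le> length (B @ B') * (c * (2 * p) ^ (length (B @ B') + length C))"
    proof (rule mean_remove_edges[OF finV(2) XV2 p c(1,2) hostC])
      show "majorized V2 X w2 \<nu> ((B @ B') @ C)"
        using endsB ab by (intro maj) (auto simp: V2_def V1_def C_def)
      show "w2 e = \<nu> e" if "e \<in> set (B @ B')" for e
        using that notC[of e] by (simp add: w2_def \<nu>_def)
    qed
    have "\<bar>Q1\<bar> \<le> 2 ^ (2 * N) * (80 + real (2 * N) * 2 ^ (2 * N + 4)) * s\<^sup>2 * p ^ (length (B @ B') + 2)"
    proof (rule Cauchy_Schwarz_step_bound[OF p _ c(1,3) _ _ _ _ sq _ _ rem[unfolded len_C] C4])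
      show "mean (PiE V1 X) (eprod \<nu> (B @ B')) \<le> (2 * p) ^ length (B @ B')"
        by (rule mean_eprod_host_le[OF finV(1) _ p c(1,2) hostB]) (rule XV1)
      show "0 \<le> mean (PiE V1 X) (eprod \<nu> (B @ B'))"
        using endsB by (intro mean_nonneg eprod_majorant_nonneg[OF maj(3)])
    qed (use K(4) len len' in auto)
    then show ?thesis
      by (simp only: bound1_def)
  qed

  \<comment> \<open>The duplication of \<open>b\<close> logically precedes that of \<open>a\<close>,
    but its estimate needs the bound on \<open>Q1\<close>.\<close>
  define Q0 where "Q0 = mean (PiE V X) (\<lambda>x. f (x a) (x b) * eprod (\<lambda>_. g) K x)"
  have "Q0 = mean (PiE V X) (\<lambda>x. eprod (\<lambda>_. g) S x * eprod w1 L x)"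
    unfolding Q0_def
  proof (rule mean_cong)
    fix x
    have "eprod w1 B x = eprod (\<lambda>_. g) B x"
      using w1_B by (intro eprod_cong) blast
    moreover have "eprod (\<lambda>_. g) K x = eprod (\<lambda>_. g) B x * eprod (\<lambda>_. g) S x"
      unfolding S_def B_def by (rule eprod_filter_split)
    ultimately show "f (x a) (x b) * eprod (\<lambda>_. g) K x = eprod (\<lambda>_. g) S x * eprod w1 L x"
      by (simp add: L_def w1_def C_def)
  qed
  moreover have "(mean (PiE V X) (\<lambda>x. eprod (\<lambda>_. g) S x * eprod w1 L x))\<^sup>2 \<le>
      mean (PiE V X) (eprod (\<lambda>_. \<gamma>) S) *
      mean (PiE (insert b' V) X) (\<lambda>x. eprod (\<lambda>_. \<gamma>) S x * eprod w1 (L @ map (map_prod \<rho> \<rho>) L) x)"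
  proof (rule mean_duplicate_vertex[OF fin ab(2) new(2,5) _ _ _ \<rho>_def])
    show "\<bar>eprod (\<lambda>_. g) S x\<bar> \<le> eprod (\<lambda>_. \<gamma>) S x" if "x \<in> PiE V X" for x
      using endsV by (intro eprod_majorized(1)[OF maj(4) that]) auto
    show "ends e \<subseteq> V - {b}" if "e \<in> set S" for e
      using that endsV[of e] bS(1)[OF that] by auto
    show "w1 (map_prod \<rho> \<rho> e) = w1 e" if "e \<in> set L" for e
    proof (cases "e = (a, b)")
      case True
      then show ?thesis
        using ab by (simp add: w1_def C_def \<rho>_def)
    next
      case False
      then have e: "e \<in> set B" "map_prod \<rho> \<rho> e \<in> set B'"
        using that by (auto simp: L_def B'_def)
      have "b' \<in> ends (map_prod \<rho> \<rho> e)"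
        using B'_end[OF e(2)] by auto
      moreover have "b \<in> ends e"
        using B_end[OF e(1)] by auto
      ultimately show ?thesis
        using notC[of e] notC[of "map_prod \<rho> \<rho> e"] e by (simp only: w1_def) simp
    qed
  qed (use endsV in auto)
  moreover have "mean (PiE (insert b' V) X) (\<lambda>x. eprod (\<lambda>_. \<gamma>) S x * eprod w1 (L @ map (map_prod \<rho> \<rho>) L) x)
    = mean (PiE V1 X) (eprod w1 (S @ T))"
  proof -
    have "w1 e = \<gamma>" if "e \<in> set S" for e
      using that notC[of e] bS[of e] by (simp add: w1_def)
    then have "eprod w1 S x = eprod (\<lambda>_. \<gamma>) S x" for x
      by (rule eprod_cong)
    then show ?thesis
      by (simp add: eprod_append_eq V1_def T_def L'_def del: eprod_append)
  qed
  moreover have "mean (PiE V X) (eprod (\<lambda>_. \<gamma>) S) = mean (PiE V X) (eprod \<nu> S)"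
    using notC by (subst eprod_\<gamma>(1)) auto
  ultimately have sq: "Q0\<^sup>2 \<le> mean (PiE V X) (eprod \<nu> S) * mean (PiE V1 X) (eprod w1 (S @ T))"
    by simp
  have rem: "\<bar>mean (PiE V1 X) (eprod w1 (S @ T)) - p ^ length S * Q1\<bar>
      \<le> length S * (c * (2 * p) ^ (length S + length T))"
    unfolding Q1_def
  proof (rule mean_remove_edges[OF finV(1) XV1 p c(1,2)])
    show "host V1 X p c k \<nu> (S @ T)"
      unfolding T_def by (rule hostS)
    show "majorized V1 X w1 \<nu> (S @ T)"
      using endsV1 by (intro maj) (auto simp: T_def)
    show "w1 e = \<nu> e" if "e \<in> set S" for e
      using that notC[of e] bS[of e] by (simp add: w1_def \<nu>_def)
  qed
  have T: "length T = length (B @ B') + 2"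
    by (simp add: T_def len')
  have "\<bar>Q0\<bar> \<le> 2 ^ N * (bound1 N + real N * 2 ^ (3 * N + 2)) * s * p ^ (length K + 1)"
  proof (rule Cauchy_Schwarz_step_bound[OF p _ c(1,4) _ _ _ bound1_ge_1 sq _ _ rem[unfolded T]])
    show "Q1 \<le> bound1 N * s\<^sup>2 * p ^ (length (B @ B') + 2)"
      using Q1 by linarith
    show "mean (PiE V X) (eprod \<nu> S) \<le> (2 * p) ^ length S"
      by (rule mean_eprod_host_le[OF fin(1) _ p c(1,2) hostS']) (rule fin(2))
    show "0 \<le> mean (PiE V X) (eprod \<nu> S)"
      using endsV by (intro mean_nonneg eprod_majorant_nonneg[OF maj(3)]) auto
  qed (use K(4) len len' s in auto)
  then show ?thesis
    by (simp only: bound2_def Q0_def)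
qed

section \<open>Replacing the edges one by one\<close>

text \<open>Splitting both test functions into positive and negative parts gives four terms with
  nonnegative test functions, hence the factor 4.\<close>

lemma mean2_signed_le:
  assumes "\<And>u' v'. (\<And>x. 0 \<le> u' x \<and> u' x \<le> \<bar>u x\<bar>) \<Longrightarrow> (\<And>y. 0 \<le> v' y \<and> v' y \<le> \<bar>v y\<bar>) \<Longrightarrow>
    \<bar>mean A (\<lambda>x. mean B (\<lambda>y. h x y * u' x * v' y))\<bar> \<le> R"
  shows "\<bar>mean A (\<lambda>x. mean B (\<lambda>y. h x y * u x * v y))\<bar> \<le> 4 * R"
proof -
  define M where "M u' v' = mean A (\<lambda>x. mean B (\<lambda>y. h x y * u' x * v' y))"
    for u' :: "'a \<Rightarrow> real" and v' :: "'b \<Rightarrow> real"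
  let ?up = "\<lambda>x. max 0 (u x)" and ?un = "\<lambda>x. max 0 (- u x)"
  let ?vp = "\<lambda>y. max 0 (v y)" and ?vn = "\<lambda>y. max 0 (- v y)"
  have "h x y * u x * v y = h x y * ?up x * ?vp y - h x y * ?up x * ?vn y
      - h x y * ?un x * ?vp y + h x y * ?un x * ?vn y" for x y
  proof -
    have "h x y * u x * v y = h x y * (?up x - ?un x) * (?vp y - ?vn y)"
      by (simp add: max_def)
    then show ?thesis
      by (simp only: right_diff_distrib left_diff_distrib)
  qed
  then have "M u v = M ?up ?vp - M ?up ?vn - M ?un ?vp + M ?un ?vn"
    unfolding M_def by (simp only: mean_add mean_diff)
  moreover have "\<bar>M ?up ?vp\<bar> \<le> R" "\<bar>M ?up ?vn\<bar> \<le> R" "\<bar>M ?un ?vp\<bar> \<le> R" "\<bar>M ?un ?vn\<bar> \<le> R"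
    unfolding M_def by (rule assms; simp)+
  ultimately show ?thesis
    unfolding M_def by linarith
qed

lemma mean2_eq_sum:
  "mean A (\<lambda>x. mean B (\<lambda>y. h x y)) = 1 / (real (card A) * real (card B)) * (\<Sum>x\<in>A. \<Sum>y\<in>B. h x y)"
  by (simp add: mean_def sum_divide_distrib[symmetric])

text \<open>Normalizing the double sum divides by both cardinalities. The masses under the roots
  absorb the square root of their product, and the factor in the hypothesis absorbs the other
  one.\<close>

lemma jumbled_imp_sjumb:
  assumes fin: "finite A" "A \<noteq> {}" "finite B" "B \<noteq> {}" and "0 \<le> c"
    and jumb: "jumbled A B g p (c * sqrt (real (card A) * real (card B)))"
  shows "sjumb A B (\<lambda>x y. g x y - p) (4 * c)"
  unfolding sjumb_def
proof (intro allI impI, elim conjE)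
  fix u :: "_ \<Rightarrow> real" and v :: "_ \<Rightarrow> real"
  assume uv: "\<forall>x\<in>A. \<bar>u x\<bar> \<le> 1" "\<forall>y\<in>B. \<bar>v y\<bar> \<le> 1"
  define nA where "nA = real (card A)"
  define nB where "nB = real (card B)"
  have n: "0 < nA" "0 < nB"
    using fin by (simp_all add: nA_def nB_def card_gt_0_iff)
  have "\<bar>mean A (\<lambda>x. mean B (\<lambda>y. (g x y - p) * u x * v y))\<bar>
    \<le> 4 * (c * sqrt (mean A (\<lambda>x. \<bar>u x\<bar>)) * sqrt (mean B (\<lambda>y. \<bar>v y\<bar>)))"
  proof (rule mean2_signed_le)
    fix u' :: "_ \<Rightarrow> real" and v' :: "_ \<Rightarrow> real"
    assume u': "\<And>x. 0 \<le> u' x \<and> u' x \<le> \<bar>u x\<bar>" and v': "\<And>y. 0 \<le> v' y \<and> v' y \<le> \<bar>v y\<bar>"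
    have "u' x \<in> {0..1}" if "x \<in> A" for x
      using uv(1) u'[of x] that by (auto intro: order_trans)
    moreover have "v' y \<in> {0..1}" if "y \<in> B" for y
      using uv(2) v'[of y] that by (auto intro: order_trans)
    ultimately have "\<bar>\<Sum>x\<in>A. \<Sum>y\<in>B. (g x y - p) * u' x * v' y\<bar>
      \<le> c * sqrt (nA * nB) * sqrt (\<Sum>x\<in>A. u' x) * sqrt (\<Sum>y\<in>B. v' y)"
      using jumb unfolding jumbled_def nA_def nB_def by blast
    also have "\<dots> \<le> c * sqrt (nA * nB) * sqrt (\<Sum>x\<in>A. \<bar>u x\<bar>) * sqrt (\<Sum>y\<in>B. \<bar>v y\<bar>)"
    proof -
      have "sqrt (\<Sum>x\<in>A. u' x) \<le> sqrt (\<Sum>x\<in>A. \<bar>u x\<bar>)" "sqrt (\<Sum>y\<in>B. v' y) \<le> sqrt (\<Sum>y\<in>B. \<bar>v y\<bar>)"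
        using u' v' by (auto intro!: sum_mono)
      moreover have "0 \<le> c * sqrt (nA * nB)" "0 \<le> (\<Sum>x\<in>A. u' x)" "0 \<le> (\<Sum>y\<in>B. v' y)"
        using n \<open>0 \<le> c\<close> u' v' by (auto intro!: sum_nonneg)
      ultimately show ?thesis
        by (intro mult_mono mult_left_mono) (auto intro!: mult_nonneg_nonneg sum_nonneg)
    qed
    also have "\<dots> = nA * nB * (c * sqrt (mean A (\<lambda>x. \<bar>u x\<bar>)) * sqrt (mean B (\<lambda>y. \<bar>v y\<bar>)))"
    proof -
      have "sqrt (nA * nB) = nA * nB / (sqrt nA * sqrt nB)"
        using n by (simp add: real_sqrt_mult field_simps)
      then show ?thesis
        by (simp add: mean_def nA_def[symmetric] nB_def[symmetric] real_sqrt_divide)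
    qed
    finally show "\<bar>mean A (\<lambda>x. mean B (\<lambda>y. (g x y - p) * u' x * v' y))\<bar>
        \<le> c * sqrt (mean A (\<lambda>x. \<bar>u x\<bar>)) * sqrt (mean B (\<lambda>y. \<bar>v y\<bar>))"
      unfolding mean2_eq_sum nA_def[symmetric] nB_def[symmetric]
      using n by (simp add: abs_mult divide_le_eq mult.commute)
  qed
  then show "\<bar>mean A (\<lambda>x. mean B (\<lambda>y. (g x y - p) * u x * v y))\<bar>
    \<le> 4 * c * sqrt (mean A (\<lambda>x. \<bar>u x\<bar>)) * sqrt (mean B (\<lambda>y. \<bar>v y\<bar>))"
    by (simp only: mult.assoc)
qed

lemma DISC_signed:
  assumes "DISC A B g q p \<epsilon>" "\<And>x. x \<in> A \<Longrightarrow> \<bar>u x\<bar> \<le> 1" "\<And>y. y \<in> B \<Longrightarrow> \<bar>v y\<bar> \<le> 1"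
  shows "\<bar>mean A (\<lambda>x. mean B (\<lambda>y. (g x y - q) * u x * v y))\<bar> \<le> 4 * (\<epsilon> * p)"
proof (rule mean2_signed_le)
  fix u' :: "_ \<Rightarrow> real" and v' :: "_ \<Rightarrow> real"
  assume u': "\<And>x. 0 \<le> u' x \<and> u' x \<le> \<bar>u x\<bar>" and v': "\<And>y. 0 \<le> v' y \<and> v' y \<le> \<bar>v y\<bar>"
  have "u' x \<in> {0..1}" if "x \<in> A" for x
    using assms(2)[OF that] u'[of x] by auto
  moreover have "v' y \<in> {0..1}" if "y \<in> B" for y
    using assms(3)[OF that] v'[of y] by auto
  ultimately show "\<bar>mean A (\<lambda>x. mean B (\<lambda>y. (g x y - q) * u' x * v' y))\<bar> \<le> \<epsilon> * p"
    using assms(1) unfolding DISC_def mean2_eq_sum by blast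
qed

section \<open>From the line graph of H to an ordered list of edges\<close>

definition edge_pair :: "nat set \<Rightarrow> nat \<times> nat" where
  "edge_pair e = (Min e, Max e)"

lemma ends_edge_pair:
  assumes "card e = 2"
  shows "ends (edge_pair e) = e" "fst (edge_pair e) < snd (edge_pair e)"
proof -
  obtain i j where ij: "e = {i, j}" "i \<noteq> j"
    using assms by (auto simp: card_2_iff)
  show "ends (edge_pair e) = e" "fst (edge_pair e) < snd (edge_pair e)"
    using ij(2) by (auto simp: ij(1) edge_pair_def min_def max_def)
qed

lemma edge_pairs_eq_image:
  assumes "simple_graph H"
  shows "edge_pairs H = edge_pair ` edges H"
proof -
  have card: "card e = 2" if "e \<in> edges H" for e
    using assms that by (simp add: simple_graph_def)
  have "(i, j) = edge_pair {i, j}" if "i < j" for i j :: nat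
    using that by (simp add: edge_pair_def)
  then have "edge_pairs H \<subseteq> edge_pair ` edges H"
    unfolding edge_pairs_def by blast
  moreover have "edge_pair e \<in> edge_pairs H" if "e \<in> edges H" for e
    using ends_edge_pair[OF card[OF that]] that by (cases "edge_pair e") (simp add: edge_pairs_def)
  ultimately show ?thesis
    by blast
qed

lemma nb_edge_pair:
  assumes "card e = 2" "\<And>e'. e' \<in> set es \<Longrightarrow> card e' = 2"
  shows "nb (edge_pair e) (map edge_pair es) = length (filter (\<lambda>e'. e \<inter> e' \<noteq> {}) es)"
proof -
  have "nb (edge_pair e) (map edge_pair es) =
      length (filter (\<lambda>e'. ends (edge_pair e) \<inter> ends (edge_pair e') \<noteq> {}) es)"
    by (simp add: nb_def filter_map comp_def)
  also have "filter (\<lambda>e'. ends (edge_pair e) \<inter> ends (edge_pair e') \<noteq> {}) es = filter (\<lambda>e'. e \<inter> e' \<noteq> {}) es"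
    unfolding ends_edge_pair(1)[OF assms(1)]
    by (rule filter_cong) (use assms(2) ends_edge_pair(1) in auto)
  finally show ?thesis .
qed

lemma degeneracy_order:
  assumes "finite (verts G)"
  obtains vs where "distinct vs" "set vs = verts G"
    "\<And>i. i < length vs \<Longrightarrow> card {j. j < i \<and> {vs ! j, vs ! i} \<in> edges G} \<le> degeneracy G"
proof -
  let ?P = "\<lambda>d. \<exists>vs. distinct vs \<and> set vs = verts G \<and>
    (\<forall>i<length vs. card {j. j < i \<and> {vs ! j, vs ! i} \<in> edges G} \<le> d)"
  obtain vs where vs: "set vs = verts G" "distinct vs"
    using finite_distinct_list[OF assms] by blast
  have "card {j. j < i \<and> {vs ! j, vs ! i} \<in> edges G} \<le> length vs" if "i < length vs" for i
  proof -
    have "card {j. j < i \<and> {vs ! j, vs ! i} \<in> edges G} \<le> card {..<i}"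
      by (rule card_mono) auto
    then show ?thesis
      using that by simp
  qed
  then have "?P (length vs)"
    using vs by blast
  then have "?P (degeneracy G)"
    unfolding degeneracy_def by (rule LeastI)
  then show ?thesis
    using that by blast
qed

lemma edges_line_graphI:
  "e \<in> edges H \<Longrightarrow> f \<in> edges H \<Longrightarrow> e \<noteq> f \<Longrightarrow> e \<inter> f \<noteq> {} \<Longrightarrow> {e, f} \<in> edges (line_graph H)"
  unfolding line_graph_def by auto

lemma sparse_order_exists:
  assumes H: "simple_graph H"
    and k: "k \<ge> min ((real (max_degree (line_graph H)) + 4) / 2)
                 ((real (degeneracy (line_graph H)) + 6) / 2)"
  obtains K where "set K = edge_pairs H" "distinct K" "loopfree_simple K" "sparse_order k K"
proof -
  have card: "card e = 2" if "e \<in> edges H" for e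
    using H that by (simp add: simple_graph_def)
  have fin: "finite (edges H)"
    using H by (auto simp: simple_graph_def intro!: finite_subset[of "edges H" "Pow (verts H)"])
  have LG: "verts (line_graph H) = edges H"
    by (simp add: line_graph_def)
  have list: "set (map edge_pair es) = edge_pairs H" "distinct (map edge_pair es)" "loopfree_simple (map edge_pair es)"
    if "distinct es" "set es = edges H" for es
  proof -
    have ends: "ends (edge_pair e) = e" if "e \<in> set es" for e
      using ends_edge_pair(1) card \<open>set es = edges H\<close> that by blast
    then have "map ends (map edge_pair es) = es"
      by (simp add: map_idI)
    then have *: "distinct (map ends (map edge_pair es))"
      using that(1) by simp
    then show "distinct (map edge_pair es)"
      unfolding distinct_map[of ends] by blast
    have "fst (edge_pair e) < snd (edge_pair e)" if "e \<in> set es" for e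
      using ends_edge_pair(2) card \<open>set es = edges H\<close> that by blast
    then have "fst e \<noteq> snd e" if "e \<in> set (map edge_pair es)" for e
      using that by fastforce
    then show "loopfree_simple (map edge_pair es)"
      unfolding loopfree_simple_def using * by blast
    show "set (map edge_pair es) = edge_pairs H"
      using edge_pairs_eq_image[OF H] that(2) by simp
  qed
  consider (D) "real (max_degree (line_graph H)) + 4 \<le> 2 * k"
    | (d) "real (degeneracy (line_graph H)) + 6 \<le> 2 * k"
    using k by (auto simp: min_def split: if_splits)
  then show ?thesis
  proof cases
    case D
    obtain es where es: "set es = edges H" "distinct es"
      using finite_distinct_list[OF fin] by blast
    \<comment> \<open>Leaving out the entry \<open>e\<close> itself matters: an edge meets itself
      but is not its own neighbour in the line graph.\<close>
    have "nb e K1 + nb e K2 \<le> max_degree (line_graph H)" if K12: "map edge_pair es = K1 @ e # K2" for K1 e K2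
    proof -
      obtain A1 e0 A2 where A: "es = A1 @ e0 # A2" "K1 = map edge_pair A1" "e = edge_pair e0" "K2 = map edge_pair A2"
        using K12 by (auto simp: map_eq_append_conv map_eq_Cons_conv)
      have e0: "e0 \<in> edges H"
        using es(1) A(1) by auto
      have "nb e K1 = length (filter (\<lambda>e'. e0 \<inter> e' \<noteq> {}) A1)"
        unfolding A(2,3) using es(1) card A(1) by (intro nb_edge_pair) auto
      moreover have "nb e K2 = length (filter (\<lambda>e'. e0 \<inter> e' \<noteq> {}) A2)"
        unfolding A(3,4) using es(1) card A(1) by (intro nb_edge_pair) auto
      ultimately have "nb e K1 + nb e K2 = length (filter (\<lambda>e'. e0 \<inter> e' \<noteq> {}) (A1 @ A2))"
        by simp
      also have "\<dots> = card (set (filter (\<lambda>e'. e0 \<inter> e' \<noteq> {}) (A1 @ A2)))"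
        using es(2) A(1) by (intro distinct_card[symmetric]) auto
      also have "\<dots> \<le> degree (line_graph H) e0"
        unfolding degree_def LG using es e0 fin
        by (intro card_mono) (auto simp: A(1) intro!: edges_line_graphI)
      also have "\<dots> \<le> max_degree (line_graph H)"
        unfolding max_degree_def LG using fin e0 by (intro Max_ge) auto
      finally show ?thesis .
    qed
    then have "sparse_order k (map edge_pair es)"
      unfolding sparse_order_def using D by blast
    then show ?thesis
      using list[OF es(2,1)] that by blast
  next
    case d
    obtain vs where vs: "distinct vs" "set vs = edges H"
      "\<And>i. i < length vs \<Longrightarrow>
        card {j. j < i \<and> {vs ! j, vs ! i} \<in> edges (line_graph H)} \<le> degeneracy (line_graph H)"
      using degeneracy_order[of "line_graph H"] fin unfolding LG by blast
    \<comment> \<open>In the reversed list the edges after \<open>e\<close> are those before it in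
      \<open>vs\<close>, so the degeneracy ordering bounds them.\<close>
    have "nb e K2 \<le> degeneracy (line_graph H)" if K12: "map edge_pair (rev vs) = K1 @ e # K2" for K1 e K2
    proof -
      obtain A1 e0 A2 where A: "rev vs = A1 @ e0 # A2" "e = edge_pair e0" "K2 = map edge_pair A2"
        using K12 unfolding map_eq_append_conv map_eq_Cons_conv by blast
      have V: "vs = rev A2 @ e0 # rev A1"
        using arg_cong[OF A(1), of rev] by simp
      define i where "i = length A2"
      have i: "i < length vs" "vs ! i = e0"
        by (simp_all add: V i_def nth_append)
      have nth: "vs ! j = rev A2 ! j" if "j < i" for j
        using that by (simp add: V i_def nth_append)
      have mem: "vs ! j \<in> edges H" if "j < length vs" for j
        using that vs(2) nth_mem by blast
      have "nb e K2 = length (filter (\<lambda>e'. e0 \<inter> e' \<noteq> {}) A2)"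
        unfolding A(2,3) using vs(2) V card by (intro nb_edge_pair) auto
      also have "\<dots> = length (filter (\<lambda>e'. e0 \<inter> e' \<noteq> {}) (rev A2))"
        by (simp add: rev_filter[symmetric])
      also have "\<dots> = card {j. j < i \<and> e0 \<inter> rev A2 ! j \<noteq> {}}"
        by (simp add: length_filter_conv_card i_def)
      also have "\<dots> \<le> card {j. j < i \<and> {vs ! j, vs ! i} \<in> edges (line_graph H)}"
      proof (rule card_mono)
        show "{j. j < i \<and> e0 \<inter> rev A2 ! j \<noteq> {}} \<subseteq> {j. j < i \<and> {vs ! j, vs ! i} \<in> edges (line_graph H)}"
        proof clarify
          fix j assume j: "j < i" "e0 \<inter> rev A2 ! j \<noteq> {}"
          have "vs ! j \<noteq> vs ! i"
            using j(1) i(1) vs(1) by (simp add: nth_eq_iff_index_eq)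
          moreover have "vs ! j \<in> edges H" "vs ! i \<in> edges H"
            using mem i(1) j(1) by simp_all
          moreover have "vs ! j \<inter> vs ! i \<noteq> {}"
            using j i(2) nth[OF j(1)] by auto
          ultimately show "{vs ! j, vs ! i} \<in> edges (line_graph H)"
            by (intro edges_line_graphI)
        qed
      qed simp
      also have "\<dots> \<le> degeneracy (line_graph H)"
        by (rule vs(3)[OF i(1)])
      finally show ?thesis .
    qed
    then have "sparse_order k (map edge_pair (rev vs))"
      unfolding sparse_order_def using d by blast
    moreover have "distinct (rev vs)" "set (rev vs) = edges H"
      using vs(1,2) by simp_all
    ultimately show ?thesis
      using list that by blast
  qed
qed

text \<open>With \<open>M\<close> the average and \<open>Q\<close> the product for the tail, the
  difference for \<open>e # K\<close> is the average of the deviation at \<open>e\<close> times the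
  other edges, plus \<open>q a b * (M - Q)\<close>. As \<open>q a b \<le> p\<close>, the induction
  hypothesis gains the missing factor \<open>p\<close>. The 4 in the hypotheses pays for signed test
  functions.\<close>

lemma counting_telescope:
  fixes X :: "nat \<Rightarrow> 'a set" and G \<Gamma> :: "'a ugraph" and q :: "nat \<Rightarrow> nat \<Rightarrow> real"
  assumes X: "\<And>i. i \<in> {1..m} \<Longrightarrow> finite (X i) \<and> X i \<noteq> {}"
    and sub: "edges G \<subseteq> edges \<Gamma>" and p: "0 < p" "p \<le> 1" and s: "0 < s" "s \<le> 1"
    and jumb: "\<And>i j. i \<in> {1..m} \<Longrightarrow> j \<in> {1..m} \<Longrightarrow> i < j \<Longrightarrow>
      jumbled (X i) (X j) (adj \<Gamma>) p (s ^ 16 / 4 * p powr k * sqrt (real (card (X i)) * real (card (X j))))"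
    and K: "loopfree_simple K" "sparse_order k K" "length K \<le> N"
      "\<And>i j. (i, j) \<in> set K \<Longrightarrow> i < j \<and> i \<in> {1..m} \<and> j \<in> {1..m} \<and>
        0 \<le> q i j \<and> q i j \<le> p \<and> DISC (X i) (X j) (adj G) (q i j) p (s ^ 16 / 4)"
  shows "\<bar>mean (PiE {1..m} X) (eprod (\<lambda>_. adj G) K) - (\<Prod>(i, j)\<leftarrow>K. q i j)\<bar>
    \<le> length K * (2 * bound2 N * s) * p ^ length K"
  using K
proof (induction K)
  case Nil
  have "eprod (\<lambda>_. adj G) [] = (\<lambda>_. 1)"
    by (rule ext) simp
  then show ?case
    using finite_nonempty_PiE[of "{1..m}" X] X by (simp add: mean_const)
next
  case (Cons e K)
  obtain a b where e: "e = (a, b)"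
    by (cases e)
  have ab: "a < b" "a \<in> {1..m}" "b \<in> {1..m}" "0 \<le> q a b" "q a b \<le> p"
    "DISC (X a) (X b) (adj G) (q a b) p (s ^ 16 / 4)"
    using Cons.prems(4)[of a b] by (simp_all add: e)
  \<comment> \<open>The vertices 0 and \<open>m + 1\<close>, which do not occur in the graph, serve as copies of \<open>a\<close> and \<open>b\<close>.\<close>
  define Y where "Y = X(0 := X a, m + 1 := X b)"
  have Y: "Y i = X i" if "i \<in> {1..m}" for i
    using that by (auto simp: Y_def)
  have PY: "PiE {1..m} Y = PiE {1..m} X"
    by (rule PiE_cong) (rule Y)
  have sj: "sjumb (X i) (X j) (\<lambda>x y. adj \<Gamma> x y - p) (s ^ 16 * p powr k)"
    if "i \<in> {1..m}" "j \<in> {1..m}" "i \<noteq> j" for i j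
  proof -
    have less: "sjumb (X i) (X j) (\<lambda>x y. adj \<Gamma> x y - p) (s ^ 16 * p powr k)"
      if "i \<in> {1..m}" "j \<in> {1..m}" "i < j" for i j
      using jumbled_imp_sjumb[OF _ _ _ _ _ jumb[OF that]] X that s by simp
    have "adj \<Gamma> x y = adj \<Gamma> y x" for x y
      by (simp add: adj_def insert_commute)
    then have "sjumb (X i) (X j) (\<lambda>x y. adj \<Gamma> x y - p) (s ^ 16 * p powr k)" if "j < i"
      using sjumb_swap[OF less[OF \<open>j \<in> {1..m}\<close> \<open>i \<in> {1..m}\<close> that]] by simp
    then show ?thesis
      using less that by (meson linorder_neqE_nat)
  qed
  \<comment> \<open>The factor 1/2 gives \<open>\<bar>f\<bar>\<close> the majorant \<open>\<mu>\<close>, which has values in [0, 1] and mean density \<open>p\<close>.\<close>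
  define f where "f x y = (adj G x y - q a b) / 2" for x y
  define \<mu> where "\<mu> x y = (adj \<Gamma> x y + p) / 2" for x y
  have adj: "\<bar>adj G x y\<bar> \<le> adj \<Gamma> x y" "adj \<Gamma> x y \<le> 1" "0 \<le> adj G x y" for x y
    using sub by (auto simp: adj_def)
  have E: "\<bar>mean (PiE {1..m} Y) (\<lambda>x. f (x a) (x b) * eprod (\<lambda>_. adj G) K x)\<bar>
    \<le> bound2 N * s * p ^ (length K + 1)"
  proof (rule deviation_edge_small[where a' = 0 and b' = "m + 1" and k = k and \<gamma> = "adj \<Gamma>" and \<mu> = \<mu>])
    show "finite (Y i) \<and> Y i \<noteq> {}" if "i \<in> {1..m}" for i
      using X Y that by simp
    show "ends e' \<subseteq> {1..m}" if "e' \<in> set ((a, b) # K)" for e'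
      using Cons.prems(4)[of "fst e'" "snd e'"] that by (auto simp: e)
    show "\<bar>f x y\<bar> \<le> \<mu> x y" "\<mu> x y \<le> 1" for x y
    proof -
      have "\<bar>adj G x y - q a b\<bar> \<le> adj \<Gamma> x y + p"
        using adj[of x y] ab(4,5) p by linarith
      then show "\<bar>f x y\<bar> \<le> \<mu> x y"
        by (simp add: f_def \<mu>_def)
      show "\<mu> x y \<le> 1"
        using adj[of x y] p by (simp add: \<mu>_def)
    qed
    show "sjumb (Y i) (Y j) (\<lambda>x y. adj \<Gamma> x y - p) (s ^ 16 * p powr k)"
      if "i \<in> {1..m}" "j \<in> {1..m}" "i \<noteq> j" for i j
      using sj that by (simp add: Y)
    have "sjumb (X a) (X b) (\<lambda>x y. 1 / 2 * (adj \<Gamma> x y - p)) (\<bar>1 / 2\<bar> * (s ^ 16 * p powr k))"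
      using ab by (intro sjumb_cmult sj) auto
    then have "sjumb (X a) (X b) (\<lambda>x y. \<mu> x y - p) (\<bar>1 / 2\<bar> * (s ^ 16 * p powr k))"
      by (simp add: \<mu>_def field_simps)
    then have "sjumb (X a) (X b) (\<lambda>x y. \<mu> x y - p) (s ^ 16 * p powr k)"
      by (rule sjumb_mono) (use s in simp)
    then show "sjumb (Y a) (Y b) (\<lambda>x y. \<mu> x y - p) (s ^ 16 * p powr k)"
      using ab by (simp add: Y)
    show "\<bar>mean (Y a) (\<lambda>x. mean (Y b) (\<lambda>y. f x y * u x * v y))\<bar> \<le> s ^ 16 * p"
      if uv: "\<And>x. x \<in> Y a \<Longrightarrow> \<bar>u x\<bar> \<le> 1" "\<And>y. y \<in> Y b \<Longrightarrow> \<bar>v y\<bar> \<le> 1" for u v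
    proof -
      have "mean (X a) (\<lambda>x. mean (X b) (\<lambda>y. f x y * u x * v y)) =
        1 / 2 * mean (X a) (\<lambda>x. mean (X b) (\<lambda>y. (adj G x y - q a b) * u x * v y))"
        unfolding mean_cmult[symmetric] by (simp add: f_def)
      moreover have "\<bar>mean (X a) (\<lambda>x. mean (X b) (\<lambda>y. (adj G x y - q a b) * u x * v y))\<bar>
        \<le> 4 * (s ^ 16 / 4 * p)"
        using uv ab by (intro DISC_signed[OF ab(6)]) (simp_all add: Y)
      moreover have "0 \<le> s ^ 16 * p"
        using s p by simp
      ultimately show ?thesis
        using ab(2,3) by (simp add: Y abs_mult)
    qed
  qed (use Cons.prems adj p s ab in \<open>auto simp: e Y_def\<close>)
  define D where "D = mean (PiE {1..m} X) (\<lambda>x. f (x a) (x b) * eprod (\<lambda>_. adj G) K x)"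
  define M where "M = mean (PiE {1..m} X) (eprod (\<lambda>_. adj G) K)"
  define Q where "Q = (\<Prod>(i, j)\<leftarrow>K. q i j)"
  have "mean (PiE {1..m} X) (eprod (\<lambda>_. adj G) (e # K)) = 2 * D + q a b * M"
    unfolding D_def M_def mean_cmult[symmetric] mean_add[symmetric]
    by (rule mean_cong) (simp add: e f_def field_simps)
  then have "mean (PiE {1..m} X) (eprod (\<lambda>_. adj G) (e # K)) - (\<Prod>(i, j)\<leftarrow>e # K. q i j)
      = 2 * D + q a b * (M - Q)"
    by (simp add: e Q_def algebra_simps)
  then have "\<bar>mean (PiE {1..m} X) (eprod (\<lambda>_. adj G) (e # K)) - (\<Prod>(i, j)\<leftarrow>e # K. q i j)\<bar>
      \<le> 2 * \<bar>D\<bar> + q a b * \<bar>M - Q\<bar>"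
    using abs_triangle_ineq[of "2 * D" "q a b * (M - Q)"] ab(4) by (simp add: abs_mult)
  also have "\<dots> \<le> 2 * (bound2 N * s * p ^ (length K + 1)) + p * (length K * (2 * bound2 N * s) * p ^ length K)"
  proof -
    have "\<bar>M - Q\<bar> \<le> length K * (2 * bound2 N * s) * p ^ length K"
      unfolding M_def Q_def using Cons.prems sparse_order_Cons[OF Cons.prems(2)]
      by (intro Cons.IH) auto
    then show ?thesis
      using E ab(4,5) p unfolding PY D_def[symmetric] by (intro add_mono mult_left_mono mult_mono) auto
  qed
  also have "\<dots> = length (e # K) * (2 * bound2 N * s) * p ^ length (e # K)"
    by (simp add: algebra_simps)
  finally show ?case .
qed

text \<open>Only small \<theta> matter, and below \<open>D\<close> the minimum is
  \<open>\<theta> / D\<close>.\<close>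

lemma min_scaled_power_bigomega:
  fixes C D :: real
  assumes "0 < C" "0 < D"
  shows "(\<lambda>\<theta>. C * (min 1 (\<theta> / D)) ^ n) \<in> \<Omega>[at_right 0](\<lambda>\<theta>. \<theta> powr real n)"
proof (rule landau_omega.bigI)
  show "0 < C / D ^ n"
    using assms by simp
  have "\<forall>\<^sub>F \<theta> in at_right 0. \<theta> \<in> {0<..<D}"
    using assms(2) by (rule eventually_at_right_real)
  then show "\<forall>\<^sub>F \<theta> in at_right 0. C / D ^ n * norm (\<theta> powr real n) \<le> norm (C * (min 1 (\<theta> / D)) ^ n)"
  proof eventually_elim
    case (elim \<theta>)
    then have "\<theta> powr real n = \<theta> ^ n" "min 1 (\<theta> / D) = \<theta> / D"
      using assms(2) by (simp_all add: powr_realpow min_def)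
    then show ?case
      using elim assms by (simp add: power_divide)
  qed
qed

theorem theorem1p12:
  fixes m :: nat and H :: "nat ugraph"
  assumes "simple_graph H" and "verts H = {1..m}"
  shows "\<exists>(c :: real \<Rightarrow> real) (\<epsilon> :: real \<Rightarrow> real) (r :: real).
    r > 0 \<and> c \<in> \<Omega>[at_right 0](\<lambda>\<theta>. \<theta> powr r) \<and> \<epsilon> \<in> \<Omega>[at_right 0](\<lambda>\<theta>. \<theta> powr r) \<and>
    (\<forall>\<theta>>0. c \<theta> > 0 \<and> \<epsilon> \<theta> > 0 \<and>
      (\<forall>(p :: real) (k :: real) (\<Gamma> :: 'a ugraph) (G :: 'a ugraph) (X :: nat \<Rightarrow> 'a set)
        (q :: nat \<Rightarrow> nat \<Rightarrow> real).
        0 < p \<and> p \<le> 1 \<and>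
        simple_graph \<Gamma> \<and> subgraph G \<Gamma> \<and>
        (\<forall>i\<in>{1..m}. X i \<noteq> {} \<and> X i \<subseteq> verts G) \<and>
        k \<ge> min ((real (max_degree (line_graph H)) + 4) / 2)
                 ((real (degeneracy (line_graph H)) + 6) / 2) \<and>
        (\<forall>i\<in>{1..m}. \<forall>j\<in>{1..m}. i < j \<longrightarrow>
           jumbled (X i) (X j) (adj \<Gamma>) p
             (c \<theta> * p powr k * sqrt (real (card (X i)) * real (card (X j))))) \<and>
        (\<forall>(i, j)\<in>edge_pairs H.
           0 \<le> q i j \<and> q i j \<le> p \<and> DISC (X i) (X j) (adj G) (q i j) p (\<epsilon> \<theta>))
        \<longrightarrow> \<bar>hom_density G H X - edge_weight q H\<bar> \<le> \<theta> * p ^ card (edges H)))"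
proof -
  define N where "N = card (edges H)"
  \<comment> \<open>The total error is at most \<open>D * s \<theta>\<close> times the power of
    \<open>p\<close>. The summand 1 keeps \<open>D\<close> positive when H has no edges.\<close>
  define D where "D = real N * (2 * bound2 N) + 1"
  \<comment> \<open>The estimates need \<open>s \<theta> \<le> 1\<close>, while \<theta> may be
    arbitrarily large.\<close>
  define s where "s \<theta> = min 1 (\<theta> / D)" for \<theta>
  define c where "c \<theta> = s \<theta> ^ 16 / 4" for \<theta>
  have "0 \<le> bound2 N"
    using bound1_ge_1[of N] by (simp add: bound2_def)
  then have D: "0 < D"
    by (simp add: D_def add_nonneg_pos)
  have "c \<in> \<Omega>[at_right 0](\<lambda>\<theta>. \<theta> powr real 16)"
    using min_scaled_power_bigomega[of "1 / 4" D 16] D by (simp add: c_def[abs_def] s_def)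
  moreover have "0 < c \<theta>" if "0 < \<theta>" for \<theta>
  proof -
    have "0 < s \<theta>"
      using that D by (simp add: s_def)
    then show ?thesis
      by (simp add: c_def)
  qed
  moreover have "\<bar>hom_density G H X - edge_weight q H\<bar> \<le> \<theta> * p ^ card (edges H)"
    if \<theta>: "0 < \<theta>" and p: "0 < p" "p \<le> 1" and \<Gamma>: "simple_graph \<Gamma>" "subgraph G \<Gamma>"
      and X: "\<forall>i\<in>{1..m}. X i \<noteq> {} \<and> X i \<subseteq> verts G"
      and k: "k \<ge> min ((real (max_degree (line_graph H)) + 4) / 2)
                 ((real (degeneracy (line_graph H)) + 6) / 2)"
      and jumb: "\<forall>i\<in>{1..m}. \<forall>j\<in>{1..m}. i < j \<longrightarrow>
           jumbled (X i) (X j) (adj \<Gamma>) p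
             (c \<theta> * p powr k * sqrt (real (card (X i)) * real (card (X j))))"
      and disc: "\<forall>(i, j)\<in>edge_pairs H.
           0 \<le> q i j \<and> q i j \<le> p \<and> DISC (X i) (X j) (adj G) (q i j) p (c \<theta>)"
    for \<theta> p k :: real and \<Gamma> G :: "'a ugraph" and X :: "nat \<Rightarrow> 'a set" and q :: "nat \<Rightarrow> nat \<Rightarrow> real"
  proof -
    obtain K where K: "set K = edge_pairs H" "distinct K" "loopfree_simple K" "sparse_order k K"
      using sparse_order_exists[OF assms(1) k] .
    have "length K = card (edges H)"
    proof -
      have "inj_on edge_pair (edges H)"
        using assms(1) ends_edge_pair(1) unfolding simple_graph_def inj_on_def by metis
      then show ?thesis
        using distinct_card[OF K(2)] by (simp add: K(1) edge_pairs_eq_image[OF assms(1)] card_image)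
    qed
    then have len: "length K = N"
      by (simp add: N_def)
    have s: "0 < s \<theta>" "s \<theta> \<le> 1"
      using \<theta> D by (simp_all add: s_def)
    have finX: "finite (X i) \<and> X i \<noteq> {}" if "i \<in> {1..m}" for i
    proof -
      have "finite (verts G)"
        using \<Gamma>(2) by (simp add: subgraph_def simple_graph_def)
      then show ?thesis
        using X that finite_subset[of "X i" "verts G"] by blast
    qed
    have "hom_density G H X = mean (PiE {1..m} X) (eprod (\<lambda>_. adj G) K)"
    proof -
      have "(\<Prod>(i, j)\<in>edge_pairs H. adj G (x i) (x j)) = eprod (\<lambda>_. adj G) K x" for x
        unfolding eprod_def K(1)[symmetric] prod.distinct_set_conv_list[OF K(2)]
        by (simp add: case_prod_unfold)
      then show ?thesis
        by (simp add: hom_density_def mean_def card_PiE assms(2))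
    qed
    moreover have "edge_weight q H = (\<Prod>(i, j)\<leftarrow>K. q i j)"
      unfolding edge_weight_def K(1)[symmetric] prod.distinct_set_conv_list[OF K(2)] ..
    moreover have "\<bar>mean (PiE {1..m} X) (eprod (\<lambda>_. adj G) K) - (\<Prod>(i, j)\<leftarrow>K. q i j)\<bar>
      \<le> length K * (2 * bound2 N * s \<theta>) * p ^ length K"
    proof (rule counting_telescope[OF finX _ p s _ K(3,4)])
      show "edges G \<subseteq> edges \<Gamma>"
        using \<Gamma>(2) by (simp add: subgraph_def)
      show "jumbled (X i) (X j) (adj \<Gamma>) p
          (s \<theta> ^ 16 / 4 * p powr k * sqrt (real (card (X i)) * real (card (X j))))"
        if "i \<in> {1..m}" "j \<in> {1..m}" "i < j" for i j
        using jumb that by (simp add: c_def)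
      fix i j assume "(i, j) \<in> set K"
      then have ij: "(i, j) \<in> edge_pairs H"
        by (simp add: K(1))
      then have "i < j" "{i, j} \<subseteq> {1..m}"
        using assms by (auto simp: edge_pairs_def simple_graph_def)
      then show "i < j \<and> i \<in> {1..m} \<and> j \<in> {1..m} \<and> 0 \<le> q i j \<and> q i j \<le> p \<and>
          DISC (X i) (X j) (adj G) (q i j) p (s \<theta> ^ 16 / 4)"
        using disc ij by (auto simp: c_def)
    qed (simp_all add: len)
    moreover have "real N * (2 * bound2 N * s \<theta>) \<le> \<theta>"
    proof -
      have "real N * (2 * bound2 N * s \<theta>) = (D - 1) * s \<theta>"
        by (simp add: D_def)
      also have "\<dots> \<le> D * s \<theta>"
        using s by (intro mult_right_mono) auto
      also have "\<dots> \<le> D * (\<theta> / D)"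
        using D by (intro mult_left_mono) (auto simp: s_def)
      also have "\<dots> = \<theta>"
        using D by simp
      finally show ?thesis .
    qed
    then have "length K * (2 * bound2 N * s \<theta>) * p ^ length K \<le> \<theta> * p ^ card (edges H)"
      unfolding len N_def[symmetric] using p by (intro mult_right_mono) auto
    ultimately show ?thesis
      by linarith
  qed
  \<comment> \<open>The same function serves as \<open>c\<close> and as \<open>\<epsilon>\<close>;
    its exponent 16 is the witness for \<open>r\<close>.\<close>
  ultimately show ?thesis
    by (intro exI[of _ c] exI[of _ "real 16"]) auto
qed

end
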